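(* Let $\theta\in(0,\pi/2)$ and let $\mu$ be the ($\sigma$-invariant) probability measure on $\Omega=\{1,2\}^{\mathbb N}$ defined in the context. Then $\mu$ is not a Gibbs state for a continuous potential; that is, there is no continuous function $f:\Omega\to\mathbb R$ with $\sum_{\sigma(y)=x}e^{f(y)}=1$ for all $x\in\Omega$ such that $$\sup_{\rho}\Big\{h(\rho)+\int f\,d\rho\Big\}=h(\mu)+\int f\,d\mu,$$ where the supremum is over all $\sigma$-invariant Borel probability measures $\rho$ on $\Omega$.
   Context: Let $\sigma^x=\begin{pmatrix}0&1\\1&0\end{pmatrix}$ and $H=\sigma^x\otimes\sigma^x$ acting on $\mathbb C^2\otimes\mathbb C^2$. For $n\ge 2$ let $H_n=\sum_{i=0}^{n-2}I^{\otimes i}\otimes H\otimes I^{\otimes(n-i-2)}$ on $(\mathbb C^2)^{\otimes n}$. For $\theta\in(0,\pi/2)$ let $P_1,P_2$ be the orthogonal projections of $\mathbb C^2$ onto the lines spanned by $\psi_1=(\cos\theta,\sin\theta)$ and $\psi_2=(-\sin\theta,\cos\theta)$. For $\beta>0$ and $(j_1,\dots,j_n)\in\{1,2\}^n$ put $$\mu_{\beta,n}(j_1,\dots,j_n)=\frac{\mathrm{Tr}\big[e^{-\beta H_n}(P_{j_1}\otimes\cdots\otimes P_{j_n})\big]}{\mathrm{Tr}(e^{-\beta H_n})},\qquad \mu_{\infty,n}=\lim_{\beta\to+\infty}\mu_{\beta,n}.$$ $\mu$ is the unique Borel probability measure on $\Omega$ with $\mu(\{x:x_1=j_1,\dots,x_n=j_n\})=\mu_{\infty,n}(j_1,\dots,j_n)$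 for all $n\ge2$. $\sigma(x_1,x_2,\dots)=(x_2,x_3,\dots)$ is the shift and $h(\rho)$ denotes the Kolmogorov–Sinai entropy of $\rho$ with respect to $\sigma$. *)

theory Defs
  imports
    "HOL-Probability.Probability"
    "HOL-Library.Disjoint_Sets"
    "Jordan_Normal_Form.Matrix"
begin

hide_const (open) Finite_Cartesian_Product.mat Finite_Cartesian_Product.vec

section \<open>Matrices on tensor powers\<close>

text \<open>
  Operators on the \<open>n\<close>-th tensor power of \<open>\<complex>\<^sup>2\<close> are represented by complex matrices of size
  \<open>2 ^ n\<close>, with respect to the lexicographically ordered product basis (the leftmost tensor
  factor is the most significant digit of the index).
\<close>

definition kron :: "complex mat \<Rightarrow> complex mat \<Rightarrow> complex mat" (infixr "\<otimes>\<^sub>m" 75) where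
  "A \<otimes>\<^sub>m B = Matrix.mat (dim_row A * dim_row B) (dim_col A * dim_col B)
     (\<lambda>(i, j). A $$ (i div dim_row B, j div dim_col B) * B $$ (i mod dim_row B, j mod dim_col B))"

definition kron_list :: "complex mat list \<Rightarrow> complex mat" where
  "kron_list As = foldr kron As (1\<^sub>m 1)"

definition trace_mat :: "complex mat \<Rightarrow> complex" where
  "trace_mat A = (\<Sum>i<dim_row A. A $$ (i, i))"

text \<open>The exponential series, which converges entrywise for every square matrix.\<close>

definition exp_mat :: "complex mat \<Rightarrow> complex mat" where
  "exp_mat A = Matrix.mat (dim_row A) (dim_row A) (\<lambda>(i, j). \<Sum>k. (A ^\<^sub>m k) $$ (i, j) / fact k)"

text \<open>
  The orthogonal projection \<open>v \<mapsto> (\<langle>v, \<psi>\<rangle> / \<langle>\<psi>, \<psi>\<rangle>) \<psi>\<close> onto the line spanned by a nonzero vector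
  \<open>\<psi>\<close>, as a matrix; see \<open>proj_line_mult_vec\<close> below.
\<close>

definition proj_line :: "complex Matrix.vec \<Rightarrow> complex mat" where
  "proj_line \<psi> = Matrix.mat (dim_vec \<psi>) (dim_vec \<psi>)
     (\<lambda>(i, j). vec_index \<psi> i * cnj (vec_index \<psi> j) / (\<psi> \<bullet>c \<psi>))"

lemma proj_line_mult_vec:
  assumes "v \<in> carrier_vec (dim_vec \<psi>)"
  shows "proj_line \<psi> *\<^sub>v v = ((v \<bullet>c \<psi>) / (\<psi> \<bullet>c \<psi>)) \<cdot>\<^sub>v \<psi>"
proof (rule eq_vecI)
  fix i assume "i < dim_vec (((v \<bullet>c \<psi>) / (\<psi> \<bullet>c \<psi>)) \<cdot>\<^sub>v \<psi>)"
  then show "vec_index (proj_line \<psi> *\<^sub>v v) i = vec_index (((v \<bullet>c \<psi>) / (\<psi> \<bullet>c \<psi>)) \<cdot>\<^sub>v \<psi>) i"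
    using assms
    by (simp add: proj_line_def scalar_prod_def sum_distrib_left sum_distrib_right
        sum_divide_distrib conjugate_complex_def mult_ac)
qed (simp add: proj_line_def)


section \<open>The Hamiltonian and the finite-volume weights\<close>

definition sigma_x :: "complex mat" where
  "sigma_x = mat_of_rows_list 2 [[0, 1], [1, 0]]"

definition hamiltonian :: "nat \<Rightarrow> complex mat" where
  "hamiltonian n = foldr (+)
     (map (\<lambda>i. kron_list (replicate i (1\<^sub>m 2)) \<otimes>\<^sub>m (sigma_x \<otimes>\<^sub>m sigma_x)
                 \<otimes>\<^sub>m kron_list (replicate (n - i - 2) (1\<^sub>m 2))) [0..<n - 1])
     (0\<^sub>m (2 ^ n) (2 ^ n))"

definition psi :: "real \<Rightarrow> nat \<Rightarrow> complex Matrix.vec" where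
  "psi \<theta> j = (if j = 1 then vec_of_list [complex_of_real (cos \<theta>), complex_of_real (sin \<theta>)]
              else vec_of_list [complex_of_real (- sin \<theta>), complex_of_real (cos \<theta>)])"

definition gibbs_op :: "real \<Rightarrow> nat \<Rightarrow> complex mat" where
  "gibbs_op \<beta> n = exp_mat (complex_of_real (- \<beta>) \<cdot>\<^sub>m hamiltonian n)"

definition mu_beta :: "real \<Rightarrow> real \<Rightarrow> nat list \<Rightarrow> complex" where
  "mu_beta \<theta> \<beta> js =
     trace_mat (gibbs_op \<beta> (length js) * kron_list (map (\<lambda>j. proj_line (psi \<theta> j)) js))
       / trace_mat (gibbs_op \<beta> (length js))"

definition mu_infty :: "real \<Rightarrow> nat list \<Rightarrow> complex" where
  "mu_infty \<theta> js = Lim at_top (\<lambda>\<beta>. mu_beta \<theta> \<beta> js)"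


section \<open>The shift space\<close>

text \<open>
  Sequences are indexed from \<open>0\<close>, so the \<open>i\<close>-th coordinate \<open>x\<^sub>i\<close> (\<open>i \<ge> 1\<close>) is \<open>x (i - 1)\<close>. The type
  \<open>nat \<Rightarrow> nat\<close> carries the product of the discrete topologies, and \<open>Omega\<close> its subspace topology.
\<close>

definition Omega :: "(nat \<Rightarrow> nat) set" where
  "Omega = {x. \<forall>i. x i \<in> {1, 2}}"

definition shift :: "(nat \<Rightarrow> nat) \<Rightarrow> nat \<Rightarrow> nat" where
  "shift x = (\<lambda>i. x (Suc i))"

definition borel_prob :: "(nat \<Rightarrow> nat) measure \<Rightarrow> bool" where
  "borel_prob M \<longleftrightarrow> prob_space M \<and> sets M = sets (restrict_space borel Omega)"

definition invariant_probs :: "(nat \<Rightarrow> nat) measure set" where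
  "invariant_probs = {M. borel_prob M \<and> distr M M shift = M}"

definition cylinder :: "nat list \<Rightarrow> (nat \<Rightarrow> nat) set" where
  "cylinder js = {x \<in> Omega. \<forall>i<length js. x i = js ! i}"

definition mu :: "real \<Rightarrow> (nat \<Rightarrow> nat) measure" where
  "mu \<theta> = (THE M. borel_prob M \<and>
     (\<forall>js. length js \<ge> 2 \<and> set js \<subseteq> {1, 2} \<longrightarrow>
        complex_of_real (measure M (cylinder js)) = mu_infty \<theta> js))"

text \<open>The pushforward in \<open>invariant_probs\<close> is meaningful, as the shift is Borel on \<open>Omega\<close>.\<close>

lemma shift_measurable:
  assumes "borel_prob M"
  shows "shift \<in> measurable M M"
proof -
  have "continuous_on UNIV shift"
    unfolding shift_def
    by (intro continuous_on_coordinatewise_then_product continuous_on_product_coordinates)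
  then have "shift \<in> borel \<rightarrow>\<^sub>M borel"
    by (rule borel_measurable_continuous_onI)
  then have "shift \<in> restrict_space borel Omega \<rightarrow>\<^sub>M restrict_space borel Omega"
    by (intro measurable_restrict_space3) (auto simp: Omega_def shift_def)
  then show ?thesis
    using assms measurable_cong_sets unfolding borel_prob_def by blast
qed


section \<open>Kolmogorov--Sinai entropy\<close>

definition partition_entropy :: "'a measure \<Rightarrow> 'a set set \<Rightarrow> real" where
  "partition_entropy M \<xi> = - (\<Sum>A\<in>\<xi>. measure M A * ln (measure M A))"

definition pullback_partition :: "'a measure \<Rightarrow> ('a \<Rightarrow> 'a) \<Rightarrow> 'a set set \<Rightarrow> 'a set set" where
  "pullback_partition M T \<xi> = (\<lambda>A. T -` A \<inter> space M) ` \<xi> - {{}}"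

text \<open>The join of the partitions \<open>T\<^sup>-\<^sup>i \<xi>\<close>, \<open>i < n\<close>.\<close>

definition iterated_join :: "'a measure \<Rightarrow> ('a \<Rightarrow> 'a) \<Rightarrow> 'a set set \<Rightarrow> nat \<Rightarrow> 'a set set" where
  "iterated_join M T \<xi> n = common_refinement ((\<lambda>i. pullback_partition M (T ^^ i) \<xi>) ` {..<n})"

definition entropy_wrt :: "'a measure \<Rightarrow> ('a \<Rightarrow> 'a) \<Rightarrow> 'a set set \<Rightarrow> real" where
  "entropy_wrt M T \<xi> = lim (\<lambda>n. partition_entropy M (iterated_join M T \<xi> n) / real n)"

definition ks_entropy :: "'a measure \<Rightarrow> ('a \<Rightarrow> 'a) \<Rightarrow> ereal" where
  "ks_entropy M T =
     (SUP \<xi>\<in>{\<xi>. finite \<xi> \<and> partition_on (space M) \<xi> \<and> \<xi> \<subseteq> sets M}. ereal (entropy_wrt M T \<xi>))"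

end

theory Submission
  imports Defs
begin

text \<open>
  The Hamiltonian is diagonal in the eigenbasis of \<open>sigma_x\<close>, where it is the classical
  antiferromagnetic Ising chain with the two alternating sign patterns as its ground states. With
  \<open>t = sin (2 * \<theta>)\<close>, a spin of sign \<open>a\<close> produces the outcome \<open>1\<close> with probability \<open>(1 + a * t) / 2\<close>.
  Hence the zero-temperature measure \<open>mu \<theta>\<close> is the mean of two product measures, the phases, in
  which the outcome \<open>1\<close> has probability \<open>(1 + t) / 2\<close> and \<open>(1 - t) / 2\<close> at alternate sites
  (\<open>mu_infty_eq\<close>, \<open>mu_cylinder\<close>).

  Given the tail \<open>y\<close> of a sequence, the phase is known almost surely and decides which of these two
  values is the conditional probability of a letter \<open>1\<close> in front of \<open>y\<close>. For \<open>t < 1\<close> the tails of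
  either phase are dense, so that no continuous function of \<open>y\<close> can produce both values; for \<open>t = 1\<close>
  the conditional probabilities are \<open>0\<close> and \<open>1\<close>, which is impossible for \<open>exp f\<close> with a real \<open>f\<close>.
  An equilibrium state of a normalised potential \<open>f\<close> would have \<open>exp f\<close> as its conditional
  probability.

  Quantitatively, let \<open>h\<close> be the entropy of a single outcome. The entropy of \<open>mu \<theta>\<close> is at most \<open>h\<close>
  (\<open>ks_entropy_mu_le\<close>), because the letters form a generator (\<open>ks_entropy_le\<close>). Conditioning on the
  tail and applying Gibbs' inequality bounds the integral of \<open>f\<close> by \<open>- h\<close>, and the inequality is
  strict for the reason just given (\<open>integral_mu_less\<close>). So entropy plus integral is negative for
  \<open>mu \<theta>\<close>. The supremum, on the other hand, is at least zero: the transfer operator of \<open>f\<close> has an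
  invariant probability measure, which is shift-invariant, and its entropy is at least minus
  the integral of \<open>f\<close> (\<open>exists_equilibrium\<close>).
\<close>

section \<open>Sums over words\<close>

definition words :: "'a set \<Rightarrow> nat \<Rightarrow> 'a list set" where
  "words A n = {w. set w \<subseteq> A \<and> length w = n}"

lemma finite_words: "finite A \<Longrightarrow> finite (words A n)"
  unfolding words_def by (rule finite_lists_length_eq)

lemma words_0 [simp]: "words A 0 = {[]}"
  by (auto simp: words_def)

lemma sum_words_Suc:
  fixes F :: "'a list \<Rightarrow> 'b::comm_monoid_add"
  shows "(\<Sum>w\<in>words A (Suc n). F w) = (\<Sum>a\<in>A. \<Sum>w\<in>words A n. F (a # w))"
proof -
  have "(\<Sum>w\<in>words A (Suc n). F w) = (\<Sum>(a, w)\<in>A \<times> words A n. F (a # w))"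
    by (rule sum.reindex_bij_witness[of _ "\<lambda>(a, w). a # w" "\<lambda>w. (hd w, tl w)"])
      (auto simp: words_def length_Suc_conv)
  then show ?thesis
    by (simp add: sum.cartesian_product)
qed

text \<open>
  Row and column indices of \<open>A \<otimes>\<^sub>m B\<close> pair an index of \<open>A\<close> (the quotient) with one of \<open>B\<close> (the
  remainder), so every sum over such indices factors in this way.
\<close>

lemma sum_div_mod:
  fixes F :: "nat \<Rightarrow> nat \<Rightarrow> 'a::comm_monoid_add"
  shows "(\<Sum>k<m * n. F (k div n) (k mod n)) = (\<Sum>a<m. \<Sum>b<n. F a b)"
proof -
  have "(\<Sum>k<m * n. F (k div n) (k mod n)) = (\<Sum>a<m. \<Sum>k\<in>{a * n..<a * n + n}. F (k div n) (k mod n))"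
    by (rule sum.nat_group[symmetric])
  also have "\<dots> = (\<Sum>a<m. \<Sum>b<n. F a b)"
  proof (rule sum.cong[OF refl])
    fix a
    show "(\<Sum>k\<in>{a * n..<a * n + n}. F (k div n) (k mod n)) = (\<Sum>b<n. F a b)"
    proof (rule sum.reindex_bij_witness[of _ "\<lambda>b. a * n + b" "\<lambda>k. k - a * n"])
      fix k assume k: "k \<in> {a * n..<a * n + n}"
      define d where "d = k - a * n"
      have d: "k = a * n + d" "d < n" using k by (auto simp: d_def)
      have "k div n = a" "k mod n = d"
        unfolding d(1) using d(2) by simp_all
      then show "F a (k - a * n) = F (k div n) (k mod n)" by (simp add: d_def)
    qed auto
  qed
  finally show ?thesis .
qed

section \<open>Kronecker products\<close>

lemma dim_kron [simp]:
  "dim_row (A \<otimes>\<^sub>m B) = dim_row A * dim_row B" "dim_col (A \<otimes>\<^sub>m B) = dim_col A * dim_col B"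
  by (simp_all add: kron_def)

lemma kron_carrier:
  "A \<in> carrier_mat a b \<Longrightarrow> B \<in> carrier_mat c d \<Longrightarrow> A \<otimes>\<^sub>m B \<in> carrier_mat (a * c) (b * d)"
  by (rule carrier_matI) (metis carrier_matD(1) dim_kron(1), metis carrier_matD(2) dim_kron(2))

lemma index_kron:
  assumes "i < dim_row A * dim_row B" "j < dim_col A * dim_col B"
  shows "(A \<otimes>\<^sub>m B) $$ (i, j) =
    A $$ (i div dim_row B, j div dim_col B) * B $$ (i mod dim_row B, j mod dim_col B)"
  using assms by (simp add: kron_def)

lemma div_mod_less_mult:
  fixes i m n :: nat
  assumes "i < m * n"
  shows "i div n < m" "i mod n < n"
proof -
  show "i div n < m" using assms by (rule less_mult_imp_div_less)
  show "i mod n < n" using assms by (cases "n = 0") auto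
qed
lemma div_mod_mult:
  fixes x b c :: nat
  shows "x div (b * c) = x div c div b" "(x mod (b * c)) div c = (x div c) mod b"
      "(x mod (b * c)) mod c = x mod c"
proof -
  show "x div (b * c) = x div c div b" by (metis div_mult2_eq mult.commute)
  have *: "x mod (b * c) = c * (x div c mod b) + x mod c"
    using mod_mult2_eq[of x c b] by (simp only: mult.commute)
  show "(x mod (b * c)) div c = (x div c) mod b"
    by (cases "c = 0") (simp_all add: *)
  show "(x mod (b * c)) mod c = x mod c"
    by (simp add: *)
qed

lemma kron_assoc: "(A \<otimes>\<^sub>m B) \<otimes>\<^sub>m C = A \<otimes>\<^sub>m (B \<otimes>\<^sub>m C)"
proof (rule eq_matI)
  fix i j
  assume i: "i < dim_row (A \<otimes>\<^sub>m (B \<otimes>\<^sub>m C))" and j: "j < dim_col (A \<otimes>\<^sub>m (B \<otimes>\<^sub>m C))"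
  from i have "i < dim_row A * dim_row B * dim_row C" by (simp add: mult_ac)
  note i1 = div_mod_less_mult[OF this]
  from j have "j < dim_col A * dim_col B * dim_col C" by (simp add: mult_ac)
  note j1 = div_mod_less_mult[OF this]
  have i2: "i < dim_row A * (dim_row B * dim_row C)" and j2: "j < dim_col A * (dim_col B * dim_col C)"
    using i j by (simp_all add: mult_ac)
  show "((A \<otimes>\<^sub>m B) \<otimes>\<^sub>m C) $$ (i, j) = (A \<otimes>\<^sub>m (B \<otimes>\<^sub>m C)) $$ (i, j)"
    using i2 j2 i1 j1 div_mod_less_mult[OF i2] div_mod_less_mult[OF j2]
    by (simp add: index_kron mult_ac div_mod_mult)
qed (simp_all add: mult_ac)

lemma kron_mult:
  assumes A: "A \<in> carrier_mat a b" "C \<in> carrier_mat b c"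
    and B: "B \<in> carrier_mat a' b'" "D \<in> carrier_mat b' c'"
  shows "(A \<otimes>\<^sub>m B) * (C \<otimes>\<^sub>m D) = (A * C) \<otimes>\<^sub>m (B * D)"
proof (rule eq_matI)
  fix i j
  assume i: "i < dim_row ((A * C) \<otimes>\<^sub>m (B * D))" and j: "j < dim_col ((A * C) \<otimes>\<^sub>m (B * D))"
  then have i': "i < a * a'" and j': "j < c * c'" using assms by auto
  note i1 = div_mod_less_mult[OF i'] and j1 = div_mod_less_mult[OF j']
  have "((A \<otimes>\<^sub>m B) * (C \<otimes>\<^sub>m D)) $$ (i, j) = (\<Sum>k<b * b'. (A \<otimes>\<^sub>m B) $$ (i, k) * (C \<otimes>\<^sub>m D) $$ (k, j))"
    using i' j' assms by (auto simp: scalar_prod_def lessThan_atLeast0)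
  also have "\<dots> = (\<Sum>k<b * b'. (\<lambda>k1 k2. A $$ (i div a', k1) * C $$ (k1, j div c') *
      (B $$ (i mod a', k2) * D $$ (k2, j mod c'))) (k div b') (k mod b'))"
    using i' j' assms by (intro sum.cong) (auto simp: index_kron mult_ac)
  also have "\<dots> = (\<Sum>k1<b. \<Sum>k2<b'. A $$ (i div a', k1) * C $$ (k1, j div c') *
      (B $$ (i mod a', k2) * D $$ (k2, j mod c')))"
    by (rule sum_div_mod)
  also have "\<dots> = (A * C) $$ (i div a', j div c') * (B * D) $$ (i mod a', j mod c')"
    using i1 j1 assms by (auto simp: scalar_prod_def lessThan_atLeast0 sum_product)
  also have "\<dots> = ((A * C) \<otimes>\<^sub>m (B * D)) $$ (i, j)"
    using i' j' assms by (auto simp: index_kron)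
  finally show "((A \<otimes>\<^sub>m B) * (C \<otimes>\<^sub>m D)) $$ (i, j) = ((A * C) \<otimes>\<^sub>m (B * D)) $$ (i, j)" .
qed (use assms in auto)

lemma trace_kron:
  assumes "A \<in> carrier_mat a a" "B \<in> carrier_mat b b"
  shows "trace_mat (A \<otimes>\<^sub>m B) = trace_mat A * trace_mat B"
proof -
  have "trace_mat (A \<otimes>\<^sub>m B) = (\<Sum>k<a * b. (\<lambda>k1 k2. A $$ (k1, k1) * B $$ (k2, k2)) (k div b) (k mod b))"
    unfolding trace_mat_def using assms by (intro sum.cong) (auto simp: index_kron)
  also have "\<dots> = (\<Sum>k1<a. \<Sum>k2<b. A $$ (k1, k1) * B $$ (k2, k2))" by (rule sum_div_mod)
  finally show ?thesis using assms by (auto simp: trace_mat_def sum_product)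
qed

lemma one_kron [simp]: "1\<^sub>m (Suc 0) \<otimes>\<^sub>m A = A"
  by (rule eq_matI) (auto simp: index_kron)

lemma one_kron_one: "1\<^sub>m m \<otimes>\<^sub>m 1\<^sub>m n = 1\<^sub>m (m * n)"
proof (rule eq_matI)
  fix i j assume ij: "i < dim_row (1\<^sub>m (m * n) :: complex mat)" "j < dim_col (1\<^sub>m (m * n) :: complex mat)"
  then have ij: "i < m * n" "j < m * n" by auto
  note i1 = div_mod_less_mult[OF ij(1)] and j1 = div_mod_less_mult[OF ij(2)]
  have "i = j \<longleftrightarrow> i div n = j div n \<and> i mod n = j mod n" by (metis div_mult_mod_eq)
  then show "(1\<^sub>m m \<otimes>\<^sub>m 1\<^sub>m n) $$ (i, j) = (1\<^sub>m (m * n) :: complex mat) $$ (i, j)"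
    using ij i1 j1 by (auto simp: index_kron)
qed auto

lemma smult_kron: "(x \<cdot>\<^sub>m A) \<otimes>\<^sub>m B = x \<cdot>\<^sub>m (A \<otimes>\<^sub>m B)"
  by (rule eq_matI) (auto simp: index_kron div_mod_less_mult)

lemma kron_smult: "A \<otimes>\<^sub>m (x \<cdot>\<^sub>m B) = x \<cdot>\<^sub>m (A \<otimes>\<^sub>m B)"
  by (rule eq_matI) (auto simp: index_kron div_mod_less_mult)

lemma kron_list_Nil [simp]: "kron_list [] = 1\<^sub>m 1"
  and kron_list_Cons [simp]: "kron_list (A # As) = A \<otimes>\<^sub>m kron_list As"
  by (simp_all add: kron_list_def)

lemma kron_list_append: "kron_list (As @ Bs) = kron_list As \<otimes>\<^sub>m kron_list Bs"
  by (induction As) (simp_all add: kron_assoc)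

lemma kron_list_carrier:
  "(\<And>A. A \<in> set As \<Longrightarrow> A \<in> carrier_mat 2 2) \<Longrightarrow> kron_list As \<in> carrier_mat (2 ^ length As) (2 ^ length As)"
  by (induction As) (auto intro!: kron_carrier)

lemma kron_list_replicate_one: "kron_list (replicate k (1\<^sub>m 2)) = 1\<^sub>m (2 ^ k)"
  by (induction k) (simp_all add: one_kron_one)

lemma trace_kron_list_mult:
  assumes "length As = length Bs" "\<And>A. A \<in> set As \<union> set Bs \<Longrightarrow> A \<in> carrier_mat 2 2"
  shows "trace_mat (kron_list As * kron_list Bs) = (\<Prod>i<length As. trace_mat (As ! i * Bs ! i))"
  using assms
proof (induction As Bs rule: list_induct2)
  case Nil
  then show ?case by (simp add: trace_mat_def)
next
  case (Cons A As B Bs)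
  have car: "kron_list As \<in> carrier_mat (2 ^ length As) (2 ^ length As)"
       "kron_list Bs \<in> carrier_mat (2 ^ length As) (2 ^ length As)"
    using Cons kron_list_carrier[of As] kron_list_carrier[of Bs] by auto
  have "kron_list (A # As) * kron_list (B # Bs) = (A * B) \<otimes>\<^sub>m (kron_list As * kron_list Bs)"
    using Cons.prems car
    by (simp, intro kron_mult[where a = 2 and b = 2 and c = 2]) auto
  also have "trace_mat \<dots> = trace_mat (A * B) * trace_mat (kron_list As * kron_list Bs)"
    using Cons.prems by (intro trace_kron[OF mult_carrier_mat[of _ 2 2] mult_carrier_mat[OF car]]) auto
  finally show ?case
    using Cons by (simp add: prod.lessThan_Suc_shift del: prod.lessThan_Suc)
qed

section \<open>Traces of matrix exponentials\<close>

text \<open>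
  A family \<open>Q\<close> that sums to the identity and consists of left eigenmatrices of \<open>A\<close> determines all
  powers of \<open>A\<close>, since \<open>A^k = (\<Sum>s. Q s) A^k = \<Sum>s. (e s)^k Q s\<close>. This yields the exponential of the
  Hamiltonian without any appeal to a diagonalisation theorem.
\<close>

locale spectral_resolution =
  fixes N :: nat and S :: "'s set" and Q :: "'s \<Rightarrow> complex mat" and A :: "complex mat" and e :: "'s \<Rightarrow> complex"
  assumes finS: "finite S"
    and carrier_Q: "s \<in> S \<Longrightarrow> Q s \<in> carrier_mat N N" and carrier_A: "A \<in> carrier_mat N N"
    and complete: "i < N \<Longrightarrow> j < N \<Longrightarrow> (\<Sum>s\<in>S. Q s $$ (i, j)) = (if i = j then 1 else 0)"
    and eigen: "s \<in> S \<Longrightarrow> Q s * A = e s \<cdot>\<^sub>m Q s"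
begin

lemma index_pow:
  assumes "i < N" "j < N"
  shows "(A ^\<^sub>m k) $$ (i, j) = (\<Sum>s\<in>S. e s ^ k * Q s $$ (i, j))"
  using assms
proof (induction k arbitrary: j)
  case 0
  then show ?case using carrier_A by (simp add: complete)
next
  case (Suc k)
  have car: "A ^\<^sub>m k \<in> carrier_mat N N" using carrier_A by simp
  have "(A ^\<^sub>m Suc k) $$ (i, j) = (\<Sum>l<N. (A ^\<^sub>m k) $$ (i, l) * A $$ (l, j))"
    using car carrier_A Suc.prems by (auto simp: scalar_prod_def lessThan_atLeast0)
  also have "\<dots> = (\<Sum>l<N. \<Sum>s\<in>S. e s ^ k * (Q s $$ (i, l) * A $$ (l, j)))"
    using Suc by (intro sum.cong) (auto simp: sum_distrib_right mult.assoc)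
  also have "\<dots> = (\<Sum>s\<in>S. e s ^ k * (\<Sum>l<N. Q s $$ (i, l) * A $$ (l, j)))"
    by (subst sum.swap) (simp add: sum_distrib_left)
  also have "\<dots> = (\<Sum>s\<in>S. e s ^ k * (Q s * A) $$ (i, j))"
    using carrier_Q carrier_A Suc.prems
    by (intro sum.cong refl) (auto simp: scalar_prod_def lessThan_atLeast0 dest!: carrier_Q)
  also have "\<dots> = (\<Sum>s\<in>S. e s ^ Suc k * Q s $$ (i, j))"
    using carrier_Q Suc.prems by (intro sum.cong refl) (auto simp: eigen dest!: carrier_Q)
  finally show ?case .
qed

text \<open>
  The powers of \<open>A\<close> are known entrywise and \<open>S\<close> is finite, so the exponential series can be summed
  separately for each eigenvalue.
\<close>

lemma index_exp_mat:
  assumes "i < N" "j < N"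
  shows "exp_mat A $$ (i, j) = (\<Sum>s\<in>S. exp (e s) * Q s $$ (i, j))"
proof -
  have "(\<lambda>k. (e s ^ k /\<^sub>R fact k) * Q s $$ (i, j)) sums (exp (e s) * Q s $$ (i, j))" for s
    by (intro sums_mult2 exp_converges)
  then have "(\<lambda>k. \<Sum>s\<in>S. (e s ^ k /\<^sub>R fact k) * Q s $$ (i, j)) sums (\<Sum>s\<in>S. exp (e s) * Q s $$ (i, j))"
    by (intro sums_sum)
  moreover have "(\<Sum>s\<in>S. (e s ^ k /\<^sub>R fact k) * Q s $$ (i, j)) = (A ^\<^sub>m k) $$ (i, j) / fact k" for k
    using assms by (simp add: index_pow sum_divide_distrib scaleR_conv_of_real field_simps)
  ultimately show ?thesis
    using assms carrier_A by (auto simp: exp_mat_def sums_iff)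
qed

lemma trace_exp_mat_mult:
  assumes K: "K \<in> carrier_mat N N"
  shows "trace_mat (exp_mat A * K) = (\<Sum>s\<in>S. exp (e s) * trace_mat (Q s * K))"
proof -
  have car: "exp_mat A \<in> carrier_mat N N" using carrier_A by (simp add: exp_mat_def)
  have tr: "trace_mat (B * K) = (\<Sum>i<N. \<Sum>l<N. B $$ (i, l) * K $$ (l, i))" if "B \<in> carrier_mat N N" for B
    using that K by (auto simp: trace_mat_def scalar_prod_def lessThan_atLeast0)
  have "trace_mat (exp_mat A * K) = (\<Sum>i<N. \<Sum>l<N. \<Sum>s\<in>S. exp (e s) * (Q s $$ (i, l) * K $$ (l, i)))"
    using tr[OF car] by (simp add: index_exp_mat sum_distrib_right mult.assoc)
  also have "\<dots> = (\<Sum>i<N. \<Sum>s\<in>S. \<Sum>l<N. exp (e s) * (Q s $$ (i, l) * K $$ (l, i)))"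
    by (intro sum.cong refl sum.swap)
  also have "\<dots> = (\<Sum>s\<in>S. \<Sum>i<N. \<Sum>l<N. exp (e s) * (Q s $$ (i, l) * K $$ (l, i)))"
    by (rule sum.swap)
  also have "\<dots> = (\<Sum>s\<in>S. exp (e s) * trace_mat (Q s * K))"
    using carrier_Q by (intro sum.cong refl) (simp add: tr sum_distrib_left)
  finally show ?thesis .
qed

lemma trace_exp_mat: "trace_mat (exp_mat A) = (\<Sum>s\<in>S. exp (e s) * trace_mat (Q s))"
proof -
  have "exp_mat A \<in> carrier_mat N N" using carrier_A by (simp add: exp_mat_def)
  then show ?thesis
    using trace_exp_mat_mult[of "1\<^sub>m N"] right_mult_one_mat[OF carrier_Q] by simp
qed

end

section \<open>Eigenprojections of the Hamiltonian\<close>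

text \<open>
  For \<open>a = 1\<close> and \<open>a = -1\<close> these are the projections onto the two eigenlines of \<open>sigma_x\<close>.
\<close>

definition sign_proj :: "real \<Rightarrow> complex mat" where
  "sign_proj a = Matrix.mat 2 2 (\<lambda>(i, j). if i = j then 1 / 2 else of_real a / 2)"

text \<open>
  The classical Ising chain: the Hamiltonian acts by this number on the product of the
  eigenlines of \<open>sigma_x\<close> selected by the signs \<open>s\<close>.
\<close>

definition ising_energy :: "real list \<Rightarrow> real" where
  "ising_energy s = (\<Sum>i<length s - 1. s ! i * s ! Suc i)"

lemma sign_proj_carrier [simp]: "sign_proj a \<in> carrier_mat 2 2"
  by (simp add: sign_proj_def)

lemma sigma_x_carrier [simp]: "sigma_x \<in> carrier_mat 2 2"
  by (rule carrier_matI) (simp_all add: sigma_x_def mat_of_rows_list_def)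

lemma less_2_iff: "i < (2::nat) \<longleftrightarrow> i = 0 \<or> i = 1" by auto

lemma sign_proj_mult_sigma_x:
  assumes "a \<in> {1, -1}"
  shows "sign_proj a * sigma_x = complex_of_real a \<cdot>\<^sub>m sign_proj a"
  by (rule eq_matI)
    (use assms in \<open>auto simp: sign_proj_def sigma_x_def mat_of_rows_list_def scalar_prod_def less_2_iff\<close>)

lemma kron_list_sign_proj_carrier: "kron_list (map sign_proj s) \<in> carrier_mat (2 ^ length s) (2 ^ length s)"
  using kron_list_carrier[of "map sign_proj s"] by fastforce

text \<open>
  The Hamiltonian is a folded sum of bond terms; a common left eigenmatrix of the terms is one of
  the sum.
\<close>

lemma mult_foldr_plus:
  assumes B: "B \<in> carrier_mat N N"
    and M: "\<And>i. i \<in> set is \<Longrightarrow> M i \<in> carrier_mat N N \<and> B * M i = c i \<cdot>\<^sub>m B"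
  shows "foldr (+) (map M is) (0\<^sub>m N N) \<in> carrier_mat N N \<and>
    B * foldr (+) (map M is) (0\<^sub>m N N) = sum_list (map c is) \<cdot>\<^sub>m (B :: complex mat)"
  using M
proof (induction "is")
  case Nil
  then show ?case using B by (auto intro!: eq_matI)
next
  case (Cons i "is")
  then have 1: "foldr (+) (map M is) (0\<^sub>m N N) \<in> carrier_mat N N"
    "B * foldr (+) (map M is) (0\<^sub>m N N) = sum_list (map c is) \<cdot>\<^sub>m B"
    "M i \<in> carrier_mat N N" "B * M i = c i \<cdot>\<^sub>m B" by auto
  then show ?case using B by (simp add: mult_add_distrib_mat add_smult_distrib_right_mat)
qed

text \<open>
  The bond at \<open>i\<close> sees only the tensor factors \<open>i\<close> and \<open>Suc i\<close>, where it contributes the two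
  eigenvalues of \<open>sigma_x\<close>; the mixed product rule lets all other factors meet identities.
\<close>

lemma eigen_bond:
  assumes s: "s \<in> words {1, -1} n" and i: "Suc i < n"
  defines "K \<equiv> kron_list (replicate i (1\<^sub>m 2)) \<otimes>\<^sub>m (sigma_x \<otimes>\<^sub>m sigma_x)
                 \<otimes>\<^sub>m kron_list (replicate (n - i - 2) (1\<^sub>m 2))"
  shows "K \<in> carrier_mat (2 ^ n) (2 ^ n) \<and>
    kron_list (map sign_proj s) * K = complex_of_real (s ! i * s ! Suc i) \<cdot>\<^sub>m kron_list (map sign_proj s)"
proof -
  define u a b v where "u = take i s" and "a = s ! i" and "b = s ! Suc i" and "v = drop (Suc (Suc i)) s"
  have len: "length s = n" using s by (simp add: words_def)
  have split: "s = u @ a # b # v"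
    using i len unfolding u_def a_def b_def v_def by (simp add: Cons_nth_drop_Suc)
  have lu: "length u = i" and lv: "length v = n - i - 2" using i len by (auto simp: u_def v_def)
  have ab: "a \<in> {1, -1}" "b \<in> {1, -1}" using s split by (auto simp: words_def)
  have n: "(2::nat) ^ n = 2 ^ i * (2 * 2 * 2 ^ (n - i - 2))"
  proof -
    obtain m where m: "n = i + 2 + m" using i by (metis add_2_eq_Suc' less_iff_Suc_add add_Suc_shift add_Suc add_Suc_right)
    then show ?thesis by (simp add: power_add)
  qed
  let ?U = "kron_list (map sign_proj u)" and ?V = "kron_list (map sign_proj v)"
  let ?I = "1\<^sub>m (2 ^ i) :: complex mat" and ?J = "1\<^sub>m (2 ^ (n - i - 2)) :: complex mat"
  let ?R = "sign_proj a \<otimes>\<^sub>m sign_proj b"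
  have U: "?U \<in> carrier_mat (2 ^ i) (2 ^ i)" and V: "?V \<in> carrier_mat (2 ^ (n - i - 2)) (2 ^ (n - i - 2))"
    using kron_list_sign_proj_carrier lu lv by metis+
  have R: "?R \<in> carrier_mat (2 * 2) (2 * 2)" and SS: "sigma_x \<otimes>\<^sub>m sigma_x \<in> carrier_mat (2 * 2) (2 * 2)"
    by (rule kron_carrier; rule sign_proj_carrier sigma_x_carrier)+
  have Qs: "kron_list (map sign_proj s) = ?U \<otimes>\<^sub>m (?R \<otimes>\<^sub>m ?V)"
    by (simp add: split kron_list_append kron_assoc)
  have K: "K = ?I \<otimes>\<^sub>m ((sigma_x \<otimes>\<^sub>m sigma_x) \<otimes>\<^sub>m ?J)"
    by (simp add: K_def kron_list_replicate_one)
  have SJ: "(sigma_x \<otimes>\<^sub>m sigma_x) \<otimes>\<^sub>m ?J \<in> carrier_mat (2 * 2 * 2 ^ (n - i - 2)) (2 * 2 * 2 ^ (n - i - 2))"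
    using SS by (intro kron_carrier) auto
  have RV: "?R \<otimes>\<^sub>m ?V \<in> carrier_mat (2 * 2 * 2 ^ (n - i - 2)) (2 * 2 * 2 ^ (n - i - 2))"
    using R V by (intro kron_carrier) auto
  have "kron_list (map sign_proj s) * K = (?U * ?I) \<otimes>\<^sub>m ((?R \<otimes>\<^sub>m ?V) * ((sigma_x \<otimes>\<^sub>m sigma_x) \<otimes>\<^sub>m ?J))"
    unfolding Qs K by (rule kron_mult[OF U _ RV SJ]) (rule one_carrier_mat)
  also have "(?R \<otimes>\<^sub>m ?V) * ((sigma_x \<otimes>\<^sub>m sigma_x) \<otimes>\<^sub>m ?J) = (?R * (sigma_x \<otimes>\<^sub>m sigma_x)) \<otimes>\<^sub>m (?V * ?J)"
    by (rule kron_mult[OF R SS V]) (rule one_carrier_mat)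
  also have "?R * (sigma_x \<otimes>\<^sub>m sigma_x) = (sign_proj a * sigma_x) \<otimes>\<^sub>m (sign_proj b * sigma_x)"
    by (rule kron_mult[OF sign_proj_carrier sigma_x_carrier sign_proj_carrier sigma_x_carrier])
  also have "\<dots> = complex_of_real (a * b) \<cdot>\<^sub>m ?R"
    using ab by (auto simp: sign_proj_mult_sigma_x smult_kron kron_smult intro!: eq_matI)
  also have "(complex_of_real (a * b) \<cdot>\<^sub>m ?R) \<otimes>\<^sub>m (?V * ?J) = complex_of_real (a * b) \<cdot>\<^sub>m (?R \<otimes>\<^sub>m ?V)"
    using V by (simp add: smult_kron)
  also have "(?U * ?I) \<otimes>\<^sub>m (complex_of_real (a * b) \<cdot>\<^sub>m (?R \<otimes>\<^sub>m ?V)) = complex_of_real (a * b) \<cdot>\<^sub>m (?U \<otimes>\<^sub>m (?R \<otimes>\<^sub>m ?V))"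
    using U by (simp add: kron_smult)
  finally have "kron_list (map sign_proj s) * K = complex_of_real (s ! i * s ! Suc i) \<cdot>\<^sub>m kron_list (map sign_proj s)"
    unfolding Qs a_def b_def .
  moreover have "K \<in> carrier_mat (2 ^ n) (2 ^ n)"
    unfolding K n using SJ by (intro kron_carrier) auto
  ultimately show ?thesis by simp
qed

lemma hamiltonian_eigen:
  assumes s: "s \<in> words {1, -1} n"
  shows "hamiltonian n \<in> carrier_mat (2 ^ n) (2 ^ n) \<and>
    kron_list (map sign_proj s) * hamiltonian n = complex_of_real (ising_energy s) \<cdot>\<^sub>m kron_list (map sign_proj s)"
proof -
  have len: "length s = n" using s by (simp add: words_def)
  have "kron_list (map sign_proj s) \<in> carrier_mat (2 ^ n) (2 ^ n)"
    using kron_list_sign_proj_carrier len by metis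
  from mult_foldr_plus[OF this, of "[0..<n - 1]" _ "\<lambda>i. complex_of_real (s ! i * s ! Suc i)", OF eigen_bond[OF s]]
  have "hamiltonian n \<in> carrier_mat (2 ^ n) (2 ^ n) \<and>
    kron_list (map sign_proj s) * hamiltonian n =
      sum_list (map (\<lambda>i. complex_of_real (s ! i * s ! Suc i)) [0..<n - 1]) \<cdot>\<^sub>m kron_list (map sign_proj s)"
    unfolding hamiltonian_def by auto
  also have "sum_list (map (\<lambda>i. complex_of_real (s ! i * s ! Suc i)) [0..<n - 1]) = complex_of_real (ising_energy s)"
    by (simp add: ising_energy_def len sum_list_distinct_conv_sum_set lessThan_atLeast0)
  finally show ?thesis .
qed

text \<open>
  In one factor the two projections add up to the identity, and expanding the \<open>n\<close>-fold tensor
  power of that identity gives all sign words.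
\<close>

lemma sign_proj_complete:
  assumes "i < 2 ^ n" "j < 2 ^ n"
  shows "(\<Sum>s\<in>words {1, -1} n. kron_list (map sign_proj s) $$ (i, j)) = (if i = j then 1 else 0)"
  using assms
proof (induction n arbitrary: i j)
  case 0
  then show ?case by simp
next
  case (Suc n)
  have ij: "i < 2 * 2 ^ n" "j < 2 * 2 ^ n" using Suc.prems by auto
  note i1 = div_mod_less_mult[OF ij(1)] and j1 = div_mod_less_mult[OF ij(2)]
  have "(\<Sum>s\<in>words {1, -1} (Suc n). kron_list (map sign_proj s) $$ (i, j)) =
    (\<Sum>a\<in>{1, -1}. \<Sum>s\<in>words {1, -1} n. sign_proj a $$ (i div 2 ^ n, j div 2 ^ n) *
       kron_list (map sign_proj s) $$ (i mod 2 ^ n, j mod 2 ^ n))"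
    unfolding sum_words_Suc
  proof (intro sum.cong refl)
    fix a s assume "s \<in> words {1, -1 :: real} n"
    then have "kron_list (map sign_proj s) \<in> carrier_mat (2 ^ n) (2 ^ n)"
      using kron_list_sign_proj_carrier[of s] by (simp add: words_def)
    then show "kron_list (map sign_proj (a # s)) $$ (i, j) = sign_proj a $$ (i div 2 ^ n, j div 2 ^ n) *
       kron_list (map sign_proj s) $$ (i mod 2 ^ n, j mod 2 ^ n)"
      using ij by (auto simp: index_kron sign_proj_def)
  qed
  also have "\<dots> = (\<Sum>a\<in>{1, -1}. sign_proj a $$ (i div 2 ^ n, j div 2 ^ n)) * (if i mod 2 ^ n = j mod 2 ^ n then 1 else 0)"
    by (simp only: sum_distrib_left[symmetric] Suc.IH[OF i1(2) j1(2)] sum_distrib_right)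
  also have "(\<Sum>a\<in>{1, -1}. sign_proj a $$ (i div 2 ^ n, j div 2 ^ n)) = (if i div 2 ^ n = j div 2 ^ n then 1 else 0)"
    using i1(1) j1(1) by (simp add: sign_proj_def)
  also have "(if i div 2 ^ n = j div 2 ^ n then 1 else 0) * (if i mod 2 ^ n = j mod 2 ^ n then 1 else 0) = (if i = j then 1 else 0 :: complex)"
  proof -
    have "i = j \<longleftrightarrow> i div 2 ^ n = j div 2 ^ n \<and> i mod 2 ^ n = j mod 2 ^ n" by (metis div_mult_mod_eq)
    then show ?thesis by simp
  qed
  finally show ?case .
qed


section \<open>The zero-temperature limit\<close>

text \<open>
  The probability of outcome \<open>j\<close> when the eigenvector of \<open>sigma_x\<close> for the eigenvalue \<open>a\<close> is measured
  in the basis \<open>psi \<theta>\<close>, with \<open>t = sin (2 * \<theta>)\<close>.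
\<close>

definition spin_weight :: "real \<Rightarrow> real \<Rightarrow> nat \<Rightarrow> real" where
  "spin_weight t a j = (1 + (if j = 1 then a else - a) * t) / 2"

lemma psi_simps:
  "dim_vec (psi \<theta> j) = 2"
  "vec_index (psi \<theta> j) 0 = complex_of_real (if j = 1 then cos \<theta> else - sin \<theta>)"
  "vec_index (psi \<theta> j) (Suc 0) = complex_of_real (if j = 1 then sin \<theta> else cos \<theta>)"
  by (simp_all add: psi_def)

lemma psi_norm: "psi \<theta> j \<bullet>c psi \<theta> j = 1"
proof -
  have "psi \<theta> j \<bullet>c psi \<theta> j = complex_of_real ((cos \<theta>)\<^sup>2 + (sin \<theta>)\<^sup>2)"
    by (simp add: scalar_prod_def psi_simps conjugate_complex_def power2_eq_square numeral_2_eq_2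
        del: sin_cos_squared_add sin_cos_squared_add2 sin_cos_squared_add3)
  then show ?thesis by simp
qed

lemma proj_line_psi_carrier [simp]: "proj_line (psi \<theta> j) \<in> carrier_mat 2 2"
  by (simp add: proj_line_def psi_simps)

lemma trace_sign_proj_mult_proj_line:
  "trace_mat (sign_proj a * proj_line (psi \<theta> j)) = complex_of_real (spin_weight (sin (2 * \<theta>)) a j)"
proof -
  have "trace_mat (sign_proj a * proj_line (psi \<theta> j)) =
    (\<Sum>i<2. \<Sum>k<2. sign_proj a $$ (i, k) * proj_line (psi \<theta> j) $$ (k, i))"
    by (auto simp: trace_mat_def scalar_prod_def lessThan_atLeast0 carrier_matD[OF sign_proj_carrier]
      carrier_matD[OF proj_line_psi_carrier])
  also have "\<dots> = complex_of_real (((cos \<theta>)\<^sup>2 + (sin \<theta>)\<^sup>2 + (if j = 1 then a else - a) * (2 * sin \<theta> * cos \<theta>)) / 2)"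
    by (simp add: numeral_2_eq_2 sign_proj_def proj_line_def psi_norm psi_simps power2_eq_square field_simps
        del: sin_cos_squared_add sin_cos_squared_add2 sin_cos_squared_add3)
  also have "\<dots> = complex_of_real (spin_weight (sin (2 * \<theta>)) a j)"
    by (simp add: spin_weight_def sin_double)
  finally show ?thesis .
qed

lemma trace_sign_proj: "trace_mat (sign_proj a) = 1"
  by (simp add: trace_mat_def sign_proj_def numeral_2_eq_2)

lemma trace_kron_list_sign_proj: "trace_mat (kron_list (map sign_proj s)) = 1"
proof (induction s)
  case Nil
  then show ?case by (simp add: trace_mat_def)
next
  case (Cons a s)
  then show ?case
    using trace_kron[OF sign_proj_carrier kron_list_sign_proj_carrier] by (simp add: trace_sign_proj)
qed

text \<open>
  In the eigenbasis of \<open>sigma_x\<close> the quantum Gibbs state becomes a mixture, with the Boltzmann weights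
  of the classical Ising chain, of product measures on the outcomes.
\<close>

lemma mu_beta_eq:
  assumes len: "length js = n"
  shows "mu_beta \<theta> \<beta> js = complex_of_real
    ((\<Sum>s\<in>words {1, -1} n. exp (- \<beta> * ising_energy s) * (\<Prod>i<n. spin_weight (sin (2 * \<theta>)) (s ! i) (js ! i))) /
     (\<Sum>s\<in>words {1, -1} n. exp (- \<beta> * ising_energy s)))"
proof -
  let ?A = "complex_of_real (- \<beta>) \<cdot>\<^sub>m hamiltonian n"
  let ?e = "\<lambda>s. complex_of_real (- \<beta> * ising_energy s)"
  let ?K = "kron_list (map (\<lambda>j. proj_line (psi \<theta> j)) js)"
  have H: "hamiltonian n \<in> carrier_mat (2 ^ n) (2 ^ n)"
    by (rule hamiltonian_eigen[of "replicate n 1" n, THEN conjunct1]) (auto simp: words_def)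
  have Q: "kron_list (map sign_proj s) \<in> carrier_mat (2 ^ n) (2 ^ n)" if "s \<in> words {1, -1} n" for s
    using that kron_list_sign_proj_carrier[of s] by (simp add: words_def)
  interpret spectral_resolution "2 ^ n" "words {1, -1} n" "\<lambda>s. kron_list (map sign_proj s)" ?A ?e
  proof
    show "kron_list (map sign_proj s) * ?A = ?e s \<cdot>\<^sub>m kron_list (map sign_proj s)"
      if "s \<in> words {1, -1} n" for s
      using hamiltonian_eigen[OF that] Q[OF that] mult_smult_distrib[OF Q[OF that] H, of "complex_of_real (- \<beta>)"]
      by (auto intro!: eq_matI)
  qed (use H Q sign_proj_complete in \<open>auto simp: finite_words\<close>)
  have K: "?K \<in> carrier_mat (2 ^ n) (2 ^ n)"
    using kron_list_carrier[of "map (\<lambda>j. proj_line (psi \<theta> j)) js"] len by fastforce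
  have tr: "trace_mat (kron_list (map sign_proj s) * ?K) =
      complex_of_real (\<Prod>i<n. spin_weight (sin (2 * \<theta>)) (s ! i) (js ! i))" if "s \<in> words {1, -1} n" for s
  proof -
    have "length s = n" using that by (simp add: words_def)
    then show ?thesis
      using len by (subst trace_kron_list_mult) (auto simp: trace_sign_proj_mult_proj_line intro!: prod.cong)
  qed
  have "mu_beta \<theta> \<beta> js = trace_mat (exp_mat ?A * ?K) / trace_mat (exp_mat ?A)"
    by (simp add: mu_beta_def gibbs_op_def len)
  also have "trace_mat (exp_mat ?A * ?K) = (\<Sum>s\<in>words {1, -1} n. exp (?e s) *
      complex_of_real (\<Prod>i<n. spin_weight (sin (2 * \<theta>)) (s ! i) (js ! i)))"
    unfolding trace_exp_mat_mult[OF K] by (intro sum.cong refl arg_cong2[where f = "(*)"] tr)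
  also have "trace_mat (exp_mat ?A) = (\<Sum>s\<in>words {1, -1} n. exp (?e s))"
    unfolding trace_exp_mat by (simp add: trace_kron_list_sign_proj)
  finally show ?thesis
    by (simp only: exp_of_real flip: of_real_mult of_real_sum of_real_divide)
qed

primrec alternating :: "real \<Rightarrow> nat \<Rightarrow> real list" where
  "alternating a 0 = []"
| "alternating a (Suc n) = a # alternating (- a) n"

text \<open>
  The product measure of the outcomes for an alternating sign pattern beginning with \<open>a\<close>.
\<close>

primrec alt_weight :: "real \<Rightarrow> real \<Rightarrow> nat list \<Rightarrow> real" where
  "alt_weight t a [] = 1"
| "alt_weight t a (j # js) = spin_weight t a j * alt_weight t (- a) js"

lemma length_alternating [simp]: "length (alternating a n) = n"
  by (induction n arbitrary: a) auto

lemma alternating_in_words: "a \<in> {1, -1} \<Longrightarrow> alternating a n \<in> words {1, -1} n"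
proof -
  have "set (alternating a n) \<subseteq> {a, - a}"
    by (induction n arbitrary: a) fastforce+
  then show "a \<in> {1, -1} \<Longrightarrow> alternating a n \<in> words {1, -1} n"
    by (auto simp: words_def)
qed

lemma prod_spin_weight_alternating:
  "(\<Prod>i<length js. spin_weight t (alternating a (length js) ! i) (js ! i)) = alt_weight t a js"
  by (induction js arbitrary: a) (simp_all add: prod.lessThan_Suc_shift del: prod.lessThan_Suc)

lemma ising_energy_Cons: "ising_energy (a # b # s) = a * b + ising_energy (b # s)"
  by (simp add: ising_energy_def sum.lessThan_Suc_shift del: sum.lessThan_Suc)

text \<open>
  Each bond contributes at least \<open>-1\<close>, with equality exactly when its two signs differ. Hence the
  antiferromagnetic chain has the two alternating patterns as its only ground states.
\<close>

lemma ising_energy_minimum: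
  assumes "set s \<subseteq> {1, -1}" "s \<noteq> []"
  shows "ising_energy s \<ge> 1 - real (length s) \<and>
    (ising_energy s = 1 - real (length s) \<longleftrightarrow> s = alternating (hd s) (length s))"
  using assms
proof (induction s rule: induct_list012)
  case (3 a b s)
  then have "ising_energy (b # s) \<ge> 1 - real (length (b # s)) \<and>
    (ising_energy (b # s) = 1 - real (length (b # s)) \<longleftrightarrow> b # s = alternating b (length (b # s)))"
    by simp
  moreover have "a * b = 1 \<and> a = b \<or> a * b = -1 \<and> a = - b" "b \<noteq> - b" using "3.prems" by auto
  ultimately show ?case by (auto simp: ising_energy_Cons)
qed (simp_all add: ising_energy_def)

lemma tendsto_exp_neg_mult_at_top:
  fixes d :: real
  assumes "d \<ge> 0"
  shows "((\<lambda>\<beta>. exp (- \<beta> * d)) \<longlongrightarrow> (if d = 0 then 1 else 0)) at_top"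
proof (cases "d = 0")
  case False
  then have "filterlim (\<lambda>\<beta>. - \<beta> * d) at_bot at_top"
    using assms by (auto simp: filterlim_uminus_at_bot intro!: filterlim_at_top_mult_tendsto_pos[where c = d] filterlim_ident)
  then show ?thesis
    using False by (auto intro: filterlim_compose[OF exp_at_bot])
qed simp

text \<open>
  As \<open>\<beta>\<close> grows, the Boltzmann weights concentrate on the two ground states, which get weight one half
  each.
\<close>

theorem mu_infty_eq:
  assumes "js \<noteq> []"
  shows "mu_infty \<theta> js = complex_of_real
    ((alt_weight (sin (2 * \<theta>)) 1 js + alt_weight (sin (2 * \<theta>)) (-1) js) / 2)"
proof -
  define n where "n = length js"
  define t where "t = sin (2 * \<theta>)"
  define S where "S = words {1, -1 :: real} n"
  \<comment> \<open>The excitation energy above the ground states; the common factor cancels in the quotient.\<close>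
  define d where "d s = ising_energy s + (real n - 1)" for s
  define c where "c s = (\<Prod>i<n. spin_weight t (s ! i) (js ! i))" for s
  have n: "n > 0" using assms by (simp add: n_def)
  have fin: "finite S" by (simp add: S_def finite_words)
  have S_ne: "s \<noteq> []" if "s \<in> S" for s using that n by (auto simp: S_def words_def)
  have d_nonneg: "d s \<ge> 0" and d_0: "d s = 0 \<longleftrightarrow> s \<in> {alternating 1 n, alternating (-1) n}" if s: "s \<in> S" for s
  proof -
    have sl: "set s \<subseteq> {1, -1}" "length s = n" using s by (auto simp: S_def words_def)
    note m = ising_energy_minimum[OF sl(1) S_ne[OF s], unfolded sl(2)]
    from m show "d s \<ge> 0" by (simp add: d_def)
    have "hd s \<in> {1, -1}" using sl(1) S_ne[OF s] by (meson hd_in_set in_mono)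
    moreover have "hd (alternating a n) = a" for a using n by (cases n) auto
    ultimately have "s = alternating (hd s) n \<longleftrightarrow> s \<in> {alternating 1 n, alternating (-1) n}"
      by auto
    moreover have "d s = 0 \<longleftrightarrow> ising_energy s = 1 - real n" by (auto simp: d_def)
    ultimately show "d s = 0 \<longleftrightarrow> s \<in> {alternating 1 n, alternating (-1) n}" using m by simp
  qed
  have lim: "((\<lambda>\<beta>. \<Sum>s\<in>S. exp (- \<beta> * d s) * g s) \<longlongrightarrow> g (alternating 1 n) + g (alternating (-1) n)) at_top"
    for g :: "real list \<Rightarrow> real"
  proof -
    have "((\<lambda>\<beta>. \<Sum>s\<in>S. exp (- \<beta> * d s) * g s) \<longlongrightarrow> (\<Sum>s\<in>S. (if d s = 0 then 1 else 0) * g s)) at_top"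
      by (intro tendsto_sum tendsto_mult tendsto_const tendsto_exp_neg_mult_at_top d_nonneg)
    also have "(\<Sum>s\<in>S. (if d s = 0 then 1 else 0) * g s) = (\<Sum>s\<in>{alternating 1 n, alternating (-1) n}. g s)"
      using alternating_in_words[of 1 n] alternating_in_words[of "-1" n] fin
      by (intro sum.mono_neutral_cong_right) (auto simp: d_0 S_def)
    also have "\<dots> = g (alternating 1 n) + g (alternating (-1) n)"
      using n by (cases n) auto
    finally show ?thesis .
  qed
  have "mu_beta \<theta> \<beta> js = complex_of_real ((\<Sum>s\<in>S. exp (- \<beta> * d s) * c s) / (\<Sum>s\<in>S. exp (- \<beta> * d s) * 1))" for \<beta>
  proof -
    have e: "exp (- \<beta> * ising_energy s) = exp (\<beta> * (real n - 1)) * exp (- \<beta> * d s)" for s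
      by (simp add: d_def algebra_simps flip: exp_add)
    have "mu_beta \<theta> \<beta> js = complex_of_real ((\<Sum>s\<in>S. exp (- \<beta> * ising_energy s) * c s) / (\<Sum>s\<in>S. exp (- \<beta> * ising_energy s)))"
      unfolding mu_beta_eq[OF n_def[symmetric]] S_def c_def t_def ..
    then show ?thesis
      by (simp only: e mult.assoc sum_distrib_left[symmetric]) simp
  qed
  moreover have "((\<lambda>\<beta>. complex_of_real ((\<Sum>s\<in>S. exp (- \<beta> * d s) * c s) / (\<Sum>s\<in>S. exp (- \<beta> * d s) * 1)))
      \<longlongrightarrow> complex_of_real ((c (alternating 1 n) + c (alternating (-1) n)) / (1 + 1))) at_top"
    by (intro tendsto_of_real tendsto_divide lim) simp
  ultimately have "mu_infty \<theta> js = complex_of_real ((c (alternating 1 n) + c (alternating (-1) n)) / 2)"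
    unfolding mu_infty_def by (intro tendsto_Lim) auto
  then show ?thesis
    by (simp add: c_def n_def t_def prod_spin_weight_alternating)
qed

section \<open>Cylinders in the shift space\<close>

primrec prepend :: "nat list \<Rightarrow> (nat \<Rightarrow> nat) \<Rightarrow> nat \<Rightarrow> nat" where
  "prepend [] x = x"
| "prepend (j # w) x = case_nat j (prepend w x)"

abbreviation letters :: "nat set" where "letters \<equiv> {1, 2}"

lemma sum_words_snoc:
  fixes F :: "'a list \<Rightarrow> 'b::comm_monoid_add"
  shows "(\<Sum>w\<in>words A (Suc n). F w) = (\<Sum>w\<in>words A n. \<Sum>a\<in>A. F (w @ [a]))"
proof -
  have "(\<Sum>w\<in>words A (Suc n). F w) = (\<Sum>(w, a)\<in>words A n \<times> A. F (w @ [a]))"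
    by (rule sum.reindex_bij_witness[of _ "\<lambda>(w, a). w @ [a]" "\<lambda>w. (butlast w, last w)"])
      (auto simp: words_def length_Suc_conv_rev)
  then show ?thesis
    by (simp add: sum.cartesian_product)
qed

lemma shift_case_nat [simp]: "shift (case_nat j x) = x"
  by (simp add: shift_def)

lemma case_nat_in_Omega: "j \<in> letters \<Longrightarrow> x \<in> Omega \<Longrightarrow> case_nat j x \<in> Omega"
  by (auto simp: Omega_def split: nat.split)

lemma shift_in_Omega: "x \<in> Omega \<Longrightarrow> shift x \<in> Omega"
  by (auto simp: Omega_def shift_def)

lemma prepend_in_Omega: "set w \<subseteq> letters \<Longrightarrow> x \<in> Omega \<Longrightarrow> prepend w x \<in> Omega"
  by (induction w) (auto intro!: case_nat_in_Omega)

lemma prepend_nth: "i < length w \<Longrightarrow> prepend w x i = w ! i"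
  by (induction w arbitrary: i) (auto simp: nth_Cons' split: nat.split)

lemma prepend_in_cylinder: "set w \<subseteq> letters \<Longrightarrow> x \<in> Omega \<Longrightarrow> prepend w x \<in> cylinder w"
  by (simp add: cylinder_def prepend_in_Omega prepend_nth)

lemma in_cylinder_iff: "x \<in> cylinder w \<longleftrightarrow> x \<in> Omega \<and> w = map x [0..<length w]"
proof -
  have "w = map x [0..<length w] \<longleftrightarrow> (\<forall>i<length w. x i = w ! i)"
    by (subst list_eq_iff_nth_eq) auto
  then show ?thesis by (simp only: cylinder_def mem_Collect_eq)
qed

lemma prefix_in_words: "x \<in> Omega \<Longrightarrow> map x [0..<n] \<in> words letters n"
  by (auto simp: words_def Omega_def)

lemma cylinder_Nil [simp]: "cylinder [] = Omega"
  by (auto simp: cylinder_def)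

lemma closed_coordinate: "closed {x :: nat \<Rightarrow> nat. x i = c}"
  by (intro closed_Collect_eq continuous_on_product_coordinates continuous_on_const)

lemma compact_Omega: "compact Omega"
proof -
  have "Omega = (\<Pi>\<^sub>E i\<in>UNIV. letters)"
    by (auto simp: Omega_def)
  moreover have "compactin (product_topology (\<lambda>_. euclidean) UNIV) (\<Pi>\<^sub>E i\<in>(UNIV :: nat set). letters)"
    unfolding compactin_PiE by (simp add: finite_imp_compact)
  ultimately have "compactin (product_topology (\<lambda>_. euclidean) UNIV) Omega" by simp
  then show ?thesis
    by (simp add: euclidean_product_topology)
qed

lemma cylinder_eq: "cylinder w = Omega \<inter> (\<Inter>i<length w. {x. x i = w ! i})"
  by (auto simp: cylinder_def)

lemma compact_cylinder: "compact (cylinder w)"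
  unfolding cylinder_eq
  by (intro compact_Int_closed compact_Omega closed_INT ballI closed_coordinate)

lemma closed_cylinder: "closed (cylinder w)"
proof -
  have "Omega = (\<Inter>i. {x. x i = 1} \<union> {x. x i = 2})" by (auto simp: Omega_def)
  moreover have "closed (\<Inter>i. {x :: nat \<Rightarrow> nat. x i = 1} \<union> {x. x i = 2})"
    by (intro closed_INT ballI closed_Un closed_coordinate)
  ultimately have "closed Omega" by simp
  then show ?thesis
    unfolding cylinder_eq by (intro closed_Int closed_INT ballI closed_coordinate)
qed

lemma sets_cylinder: "cylinder w \<in> sets (restrict_space borel Omega)"
proof -
  have "(\<Inter>i<length w. {x :: nat \<Rightarrow> nat. x i = w ! i}) \<in> sets borel"
    by (intro borel_closed closed_INT ballI closed_coordinate)
  then show ?thesis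
    unfolding cylinder_eq sets_restrict_space by (rule imageI)
qed

text \<open>
  Prefixes take over the part of small distances: a neighbourhood in the product topology
  constrains only finitely many coordinates, and each constraint is met by fixing the coordinate.
\<close>

lemma open_contains_prefix:
  fixes U :: "(nat \<Rightarrow> nat) set"
  assumes "open U" "x \<in> U"
  shows "\<exists>n. \<forall>y. (\<forall>i<n. y i = x i) \<longrightarrow> y \<in> U"
proof -
  have "openin (product_topology (\<lambda>_. euclidean) UNIV) U"
    using assms(1) by (simp add: open_fun_def)
  from product_topology_open_contains_basis[OF this assms(2)]
  obtain X where X: "x \<in> (\<Pi>\<^sub>E i\<in>UNIV. X i)" "finite {i. X i \<noteq> UNIV}" "(\<Pi>\<^sub>E i\<in>UNIV. X i) \<subseteq> U"
    by auto
  obtain n where n: "\<And>i. X i \<noteq> UNIV \<Longrightarrow> i < n"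
    using finite_nat_set_iff_bounded X(2) by auto
  have "y \<in> U" if "\<forall>i<n. y i = x i" for y
  proof -
    have "y i \<in> X i" for i
      using X(1) n[of i] that by (cases "X i = UNIV") (auto simp: PiE_iff)
    then show ?thesis using X(3) by (auto simp: PiE_iff)
  qed
  then show ?thesis by blast
qed

lemma open_prefix: "open {y :: nat \<Rightarrow> nat. \<forall>i<n. y i = x i}"
proof -
  have "open {y :: nat \<Rightarrow> nat. \<forall>i\<in>{..<n}. y i \<in> {x i}}"
    by (rule product_topology_basis', simp, rule Topological_Spaces.open_discrete)
  then show ?thesis by (simp add: Ball_def)
qed

text \<open>
  The Heine--Cantor theorem, with agreement on a prefix as the notion of closeness. Around each
  point some prefix controls \<open>f\<close>, and finitely many of these prefixes cover the compact space.
\<close>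

lemma uniformly_continuous_prefix:
  fixes f :: "(nat \<Rightarrow> nat) \<Rightarrow> real"
  assumes f: "continuous_on Omega f" and "e > 0"
  shows "\<exists>n. \<forall>x\<in>Omega. \<forall>y\<in>Omega. (\<forall>i<n. x i = y i) \<longrightarrow> \<bar>f x - f y\<bar> < e"
proof -
  have "\<exists>n. \<forall>y\<in>Omega. (\<forall>i<n. y i = x i) \<longrightarrow> \<bar>f y - f x\<bar> < e / 2" if x: "x \<in> Omega" for x
  proof -
    have "open {f x - e / 2<..<f x + e / 2}" by simp
    then obtain U where U: "open U" "U \<inter> Omega = f -` {f x - e / 2<..<f x + e / 2} \<inter> Omega"
      using f unfolding continuous_on_open_invariant by blast
    have "x \<in> U" using U x \<open>e > 0\<close> by auto
    with open_contains_prefix[OF U(1)] obtain n where "\<And>y. \<forall>i<n. y i = x i \<Longrightarrow> y \<in> U"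
      by blast
    then have "\<bar>f y - f x\<bar> < e / 2" if "y \<in> Omega" "\<forall>i<n. y i = x i" for y
    proof -
      have "y \<in> f -` {f x - e / 2<..<f x + e / 2} \<inter> Omega"
        using \<open>\<And>y. \<forall>i<n. y i = x i \<Longrightarrow> y \<in> U\<close>[OF that(2)] that(1) U(2) by blast
      then have "f x - e / 2 < f y" "f y < f x + e / 2" by auto
      then show ?thesis by linarith
    qed
    then show ?thesis by blast
  qed
  then obtain n where n: "\<And>x y. x \<in> Omega \<Longrightarrow> y \<in> Omega \<Longrightarrow> \<forall>i<n x. y i = x i \<Longrightarrow> \<bar>f y - f x\<bar> < e / 2"
    by metis
  have cover: "Omega \<subseteq> (\<Union>x\<in>Omega. {y. \<forall>i<n x. y i = x i})" by auto
  obtain C where C: "C \<subseteq> Omega" "finite C" "Omega \<subseteq> (\<Union>x\<in>C. {y. \<forall>i<n x. y i = x i})"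
    by (rule compactE_image[OF compact_Omega open_prefix cover])
  have "\<bar>f y - f z\<bar> < e" if yz: "y \<in> Omega" "z \<in> Omega" "\<forall>i<Max (n ` C). y i = z i" for y z
  proof -
    obtain x where x: "x \<in> C" "\<forall>i<n x. y i = x i" using C(3) yz(1) by auto
    moreover have "n x \<le> Max (n ` C)" using C(2) x(1) by simp
    ultimately have "\<forall>i<n x. z i = x i" using yz(3) by auto
    with x C(1) yz have "\<bar>f y - f x\<bar> < e / 2" "\<bar>f z - f x\<bar> < e / 2" by (blast intro: n)+
    then show ?thesis by linarith
  qed
  then show ?thesis by blast
qed

text \<open>
  There are only countably many words, so an open set is a countable union of cylinders. The lower
  bound \<open>k\<close> on the length is for the finite-volume weights, which are prescribed from length two on.
\<close>

lemma sets_Omega_eq_sigma_cylinders: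
  "sets (restrict_space borel Omega) = sigma_sets Omega (cylinder ` {w. set w \<subseteq> letters \<and> length w \<ge> k})"
  (is "_ = sigma_sets Omega ?C")
proof
  have sub: "?C \<subseteq> Pow Omega" by (auto simp: cylinder_def)
  have "id \<in> sigma Omega ?C \<rightarrow>\<^sub>M borel"
  proof (rule borel_measurableI)
    fix U :: "(nat \<Rightarrow> nat) set" assume U: "open U"
    let ?W = "{w. set w \<subseteq> letters \<and> length w \<ge> k \<and> cylinder w \<subseteq> U}"
    have "U \<inter> Omega \<subseteq> (\<Union>w\<in>?W. cylinder w)"
    proof
      fix x assume x: "x \<in> U \<inter> Omega"
      obtain n where n: "\<forall>y. (\<forall>i<n. y i = x i) \<longrightarrow> y \<in> U"
        using open_contains_prefix[OF U] x by blast
      let ?w = "map x [0..<max n k]"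
      have "?w \<in> ?W" using n x prefix_in_words[of x "max n k"] by (auto simp: words_def cylinder_def)
      moreover have "x \<in> cylinder ?w" using x by (simp add: in_cylinder_iff)
      ultimately show "x \<in> (\<Union>w\<in>?W. cylinder w)" by blast
    qed
    then have "id -` U \<inter> space (sigma Omega ?C) = (\<Union>w\<in>?W. cylinder w)"
      by (auto simp: cylinder_def space_measure_of_conv)
    also have "\<dots> \<in> sets (sigma Omega ?C)"
      using sub by (intro sets.countable_UN') (auto simp: sets_measure_of)
    finally show "id -` U \<inter> space (sigma Omega ?C) \<in> sets (sigma Omega ?C)" .
  qed
  then show "sets (restrict_space borel Omega) \<subseteq> sigma_sets Omega ?C"
    using sub by (auto simp: sets_restrict_space measurable_def sets_measure_of Int_commute)
  show "sigma_sets Omega ?C \<subseteq> sets (restrict_space borel Omega)"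
    using sets.sigma_sets_subset[of ?C "restrict_space borel Omega"] sets_cylinder
    by (auto simp: space_restrict_space)
qed

lemma borel_prob_space: "borel_prob M \<Longrightarrow> space M = Omega"
  unfolding borel_prob_def by (metis sets_eq_imp_space_eq space_restrict_space space_borel Int_UNIV_right)

lemma borel_prob_sets: "borel_prob M \<Longrightarrow> sets M = sets (restrict_space borel Omega)"
  by (simp add: borel_prob_def)

lemma borel_prob_prob_space: "borel_prob M \<Longrightarrow> prob_space M"
  by (simp add: borel_prob_def)

text \<open>
  Two cylinders are nested or disjoint, so the long ones together with the empty set form a
  generator that is closed under intersection.
\<close>

lemma borel_prob_eqI:
  assumes M: "borel_prob M" and N: "borel_prob N"
    and eq: "\<And>w. set w \<subseteq> letters \<Longrightarrow> length w \<ge> k \<Longrightarrow> measure M (cylinder w) = measure N (cylinder w)"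
  shows "M = N"
proof -
  interpret M: prob_space M using M by (rule borel_prob_prob_space)
  interpret N: prob_space N using N by (rule borel_prob_prob_space)
  let ?C = "cylinder ` {w. set w \<subseteq> letters \<and> length w \<ge> k}"
  let ?E = "insert {} ?C"
  have sub: "?E \<subseteq> Pow Omega" by (auto simp: cylinder_def)
  have gen: "sigma_sets Omega ?E = sets (restrict_space borel Omega)"
    unfolding sets_Omega_eq_sigma_cylinders[of k]
    by (intro sigma_sets_eqI) (auto intro: sigma_sets.intros)
  have "Int_stable ?E"
  proof (rule Int_stableI)
    fix A B assume AB: "A \<in> ?E" "B \<in> ?E"
    have nested: "cylinder u \<inter> cylinder v \<in> {{}, cylinder v}" if le: "length u \<le> length v" for u v
    proof (cases "\<exists>i<length u. u ! i \<noteq> v ! i")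
      case True
      then have "cylinder u \<inter> cylinder v = {}" using le by (force simp: cylinder_def)
      then show ?thesis by simp
    next
      case False
      then have "cylinder u \<inter> cylinder v = cylinder v" using le by (auto simp: cylinder_def)
      then show ?thesis by simp
    qed
    show "A \<inter> B \<in> ?E"
    proof (cases "A = {} \<or> B = {}")
      case False
      then obtain u v where uv: "A = cylinder u" "B = cylinder v" "u \<in> {w. set w \<subseteq> letters \<and> length w \<ge> k}"
        "v \<in> {w. set w \<subseteq> letters \<and> length w \<ge> k}" using AB by blast
      then show ?thesis
        using nested[of u v] nested[of v u] by (cases "length u \<le> length v") (auto simp: Int_commute)
    qed auto
  qed
  moreover have "emeasure M X = emeasure N X" if "X \<in> ?E" for X
    using that eq by (auto simp: M.emeasure_eq_measure N.emeasure_eq_measure)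
  moreover have "Omega = (\<Union>w\<in>words letters k. cylinder w)"
  proof -
    have "x \<in> (\<Union>w\<in>words letters k. cylinder w)" if "x \<in> Omega" for x
      using that prefix_in_words[of x k] by (intro UN_I[of "map x [0..<k]"]) (auto simp: in_cylinder_iff)
    then show ?thesis by (auto simp: cylinder_def)
  qed
  ultimately show ?thesis
    using M N gen sub
    by (intro measure_eqI_generator_eq_countable[where E = ?E and \<Omega> = Omega and A = "cylinder ` words letters k"])
      (auto simp: borel_prob_def words_def M.emeasure_eq_measure intro!: countable_finite finite_imageI finite_words[unfolded words_def])
qed


lemma cylinder_same_length:
  "x \<in> cylinder w \<Longrightarrow> x \<in> cylinder v \<Longrightarrow> length w = length v \<Longrightarrow> w = v"
  by (simp add: in_cylinder_iff)

lemma sum_indicator_cylinder: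
  fixes g :: "nat list \<Rightarrow> real"
  assumes "x \<in> Omega"
  shows "(\<Sum>w\<in>words letters n. g w * indicator (cylinder w) x) = g (map x [0..<n])"
proof -
  have "(\<Sum>w\<in>words letters n. g w * indicator (cylinder w) x) = (\<Sum>w\<in>{map x [0..<n]}. g w)"
    using assms prefix_in_words[OF assms, of n]
    by (intro sum.mono_neutral_cong_right finite_words) (auto simp: in_cylinder_iff indicator_def words_def)
  then show ?thesis by simp
qed

section \<open>Integrals of continuous functions\<close>

lemma integrable_continuous_Omega:
  fixes f :: "(nat \<Rightarrow> nat) \<Rightarrow> real"
  assumes M: "borel_prob M" and f: "continuous_on Omega f"
  shows "integrable M f"
proof -
  interpret M: prob_space M using M by (rule borel_prob_prob_space)
  obtain B where B: "\<And>x. x \<in> Omega \<Longrightarrow> \<bar>f x\<bar> \<le> B"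
    using compact_continuous_image[OF f compact_Omega, THEN compact_imp_bounded]
    by (auto simp: bounded_iff)
  have "f \<in> borel_measurable (restrict_space borel Omega)"
    by (rule borel_measurable_continuous_on_restrict[OF f])
  then have "f \<in> borel_measurable M"
    using measurable_cong_sets[OF borel_prob_sets[OF M] refl] by blast
  then show ?thesis
    using B borel_prob_space[OF M] by (intro M.integrable_const_bound[where B = B]) auto
qed

lemma measurable_cylinder: "borel_prob M \<Longrightarrow> cylinder w \<in> sets M"
  by (simp add: borel_prob_sets sets_cylinder)

lemma integrable_indicator_cylinder:
  assumes "borel_prob M"
  shows "integrable M (indicator (cylinder w) :: _ \<Rightarrow> real)"
proof -
  interpret prob_space M using assms by (rule borel_prob_prob_space)
  show ?thesis
    using measurable_cylinder[OF assms] by (simp add: emeasure_eq_measure)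
qed

lemma integral_cylinder_sum:
  assumes "borel_prob M"
  shows "(\<integral>x. (\<Sum>w\<in>words letters n. g w * indicator (cylinder w) x) \<partial>M) =
    (\<Sum>w\<in>words letters n. measure M (cylinder w) * g w)"
proof -
  interpret prob_space M using assms by (rule borel_prob_prob_space)
  show ?thesis
    using measurable_cylinder[OF assms] integrable_indicator_cylinder[OF assms]
    by (subst Bochner_Integration.integral_sum) (auto simp: mult.commute)
qed

text \<open>
  Replacing \<open>x\<close> by its prefix of length \<open>n\<close> followed by a fixed tail \<open>x0\<close> moves \<open>f\<close> by little, uniformly
  in \<open>x\<close>.
\<close>

lemma step_function_approximation:
  fixes f :: "(nat \<Rightarrow> nat) \<Rightarrow> real"
  assumes f: "continuous_on Omega f" and x0: "x0 \<in> Omega" and e: "e > 0"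
  shows "\<exists>k. \<forall>n\<ge>k. \<forall>x\<in>Omega.
    \<bar>(\<Sum>w\<in>words letters n. f (prepend w x0) * indicator (cylinder w) x) - f x\<bar> < e"
proof -
  obtain k where k: "\<And>x y. x \<in> Omega \<Longrightarrow> y \<in> Omega \<Longrightarrow> \<forall>i<k. x i = y i \<Longrightarrow> \<bar>f x - f y\<bar> < e"
    using uniformly_continuous_prefix[OF f e] by auto
  have "\<bar>(\<Sum>w\<in>words letters n. f (prepend w x0) * indicator (cylinder w) x) - f x\<bar> < e"
    if n: "n \<ge> k" and x: "x \<in> Omega" for n x
  proof -
    have p: "set (map x [0..<n]) \<subseteq> letters" using prefix_in_words[OF x, of n] by (simp add: words_def)
    have "\<forall>i<k. prepend (map x [0..<n]) x0 i = x i"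
      using n by (auto simp: prepend_nth)
    then show ?thesis
      using k[OF prepend_in_Omega[OF p x0] x]
      unfolding sum_indicator_cylinder[OF x, where g = "\<lambda>w. f (prepend w x0)"] by blast
  qed
  then show ?thesis by blast
qed

lemma integrable_step_function:
  assumes "borel_prob M"
  shows "integrable M (\<lambda>x. \<Sum>w\<in>words letters n. g w * indicator (cylinder w) x :: real)"
  using integrable_indicator_cylinder[OF assms] by (intro Bochner_Integration.integrable_sum) auto

lemma integral_diff_le:
  fixes f g :: "(nat \<Rightarrow> nat) \<Rightarrow> real"
  assumes M: "borel_prob M" and int: "integrable M f" "integrable M g"
    and le: "\<And>x. x \<in> Omega \<Longrightarrow> \<bar>f x - g x\<bar> \<le> e"
  shows "\<bar>(\<integral>x. f x \<partial>M) - (\<integral>x. g x \<partial>M)\<bar> \<le> e"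
proof -
  interpret M: prob_space M using M by (rule borel_prob_prob_space)
  have "\<bar>(\<integral>x. f x \<partial>M) - (\<integral>x. g x \<partial>M)\<bar> = norm (\<integral>x. f x - g x \<partial>M)"
    using int by simp
  also have "\<dots> \<le> (\<integral>x. norm (f x - g x) \<partial>M)" by (rule integral_norm_bound)
  also have "\<dots> \<le> (\<integral>x. e \<partial>M)"
    using int le borel_prob_space[OF M] by (intro integral_mono) auto
  finally show ?thesis by (simp add: M.prob_space)
qed

text \<open>
  This reduces identities between integrals of continuous functions to identities between finite
  sums of cylinder weights.
\<close>

lemma integral_cylinder_limit:
  fixes f :: "(nat \<Rightarrow> nat) \<Rightarrow> real"
  assumes M: "borel_prob M" and f: "continuous_on Omega f" and x0: "x0 \<in> Omega"
  shows "(\<lambda>n. \<Sum>w\<in>words letters n. measure M (cylinder w) * f (prepend w x0)) \<longlonglongrightarrow> (\<integral>x. f x \<partial>M)"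
proof (rule LIMSEQ_I)
  fix e :: real assume "e > 0"
  then obtain k where k: "\<And>n x. n \<ge> k \<Longrightarrow> x \<in> Omega \<Longrightarrow>
      \<bar>(\<Sum>w\<in>words letters n. f (prepend w x0) * indicator (cylinder w) x) - f x\<bar> < e / 2"
    using step_function_approximation[OF f x0, of "e / 2"] by auto
  have "norm ((\<Sum>w\<in>words letters n. measure M (cylinder w) * f (prepend w x0)) - (\<integral>x. f x \<partial>M)) < e" if "n \<ge> k" for n
    using integral_diff_le[OF M integrable_step_function[OF M] integrable_continuous_Omega[OF M f] less_imp_le[OF k[OF that]]]
      \<open>e > 0\<close> unfolding integral_cylinder_sum[OF M, where g = "\<lambda>w. f (prepend w x0)"] by simp
  then show "\<exists>no. \<forall>n\<ge>no. norm ((\<Sum>w\<in>words letters n. measure M (cylinder w) * f (prepend w x0)) - (\<integral>x. f x \<partial>M)) < e"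
    by blast
qed

section \<open>Measures with prescribed cylinder weights\<close>

text \<open>
  Membership is decided by the first \<open>n\<close> coordinates. Over all \<open>n\<close> these sets form the algebra of
  clopen subsets.
\<close>

definition prefix_set :: "nat \<Rightarrow> (nat \<Rightarrow> nat) set \<Rightarrow> bool" where
  "prefix_set n A \<longleftrightarrow> A \<subseteq> Omega \<and> (\<forall>x\<in>Omega. \<forall>y\<in>Omega. (\<forall>i<n. x i = y i) \<longrightarrow> x \<in> A \<longrightarrow> y \<in> A)"

lemma prefix_set_mono: "prefix_set m A \<Longrightarrow> m \<le> n \<Longrightarrow> prefix_set n A"
  unfolding prefix_set_def by (meson less_le_trans)

lemma prefix_set_Un: "prefix_set n A \<Longrightarrow> prefix_set n B \<Longrightarrow> prefix_set n (A \<union> B)"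
  unfolding prefix_set_def by blast

lemma prefix_set_Diff: "prefix_set n A \<Longrightarrow> prefix_set n B \<Longrightarrow> prefix_set n (A - B)"
  unfolding prefix_set_def by (metis (no_types, lifting) Diff_iff Diff_subset subset_trans)

lemma prefix_set_Omega: "prefix_set n Omega"
  by (simp add: prefix_set_def)

lemma prefix_set_empty: "prefix_set n {}"
  by (simp add: prefix_set_def)

lemma prefix_set_cylinder: "length w \<le> n \<Longrightarrow> prefix_set n (cylinder w)"
  by (auto simp: prefix_set_def cylinder_def)

lemma prefix_set_eq_UN_cylinder:
  assumes "prefix_set n A"
  shows "A = (\<Union>w\<in>{w \<in> words letters n. cylinder w \<subseteq> A}. cylinder w)"
proof
  show "A \<subseteq> (\<Union>w\<in>{w \<in> words letters n. cylinder w \<subseteq> A}. cylinder w)"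
  proof
    fix x assume x: "x \<in> A"
    then have xO: "x \<in> Omega" using assms by (auto simp: prefix_set_def)
    let ?w = "map x [0..<n]"
    have "cylinder ?w \<subseteq> A" using assms x xO by (auto simp: prefix_set_def cylinder_def)
    moreover have "x \<in> cylinder ?w" using xO by (simp add: in_cylinder_iff)
    ultimately show "x \<in> (\<Union>w\<in>{w \<in> words letters n. cylinder w \<subseteq> A}. cylinder w)"
      using prefix_in_words[OF xO, of n] by blast
  qed
qed blast

lemma compact_prefix_set: "prefix_set n A \<Longrightarrow> compact A"
  by (subst prefix_set_eq_UN_cylinder) (auto intro!: compact_UN finite_subset[OF _ finite_words] compact_cylinder)

lemma closed_prefix_set: "prefix_set n A \<Longrightarrow> closed A"
  by (subst prefix_set_eq_UN_cylinder) (auto intro!: closed_UN finite_subset[OF _ finite_words] closed_cylinder)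

lemma sets_prefix_set: "prefix_set n A \<Longrightarrow> A \<in> sets (restrict_space borel Omega)"
  by (subst prefix_set_eq_UN_cylinder) (auto intro!: sets.finite_UN finite_subset[OF _ finite_words] sets_cylinder)

lemma sigma_prefix_sets: "sigma_sets Omega {A. \<exists>n. prefix_set n A} = sets (restrict_space borel Omega)"
proof
  show "sigma_sets Omega {A. \<exists>n. prefix_set n A} \<subseteq> sets (restrict_space borel Omega)"
    using sets.sigma_sets_subset[of "{A. \<exists>n. prefix_set n A}" "restrict_space borel Omega"] sets_prefix_set
    by (auto simp: space_restrict_space)
  show "sets (restrict_space borel Omega) \<subseteq> sigma_sets Omega {A. \<exists>n. prefix_set n A}"
    unfolding sets_Omega_eq_sigma_cylinders[of 0] using prefix_set_cylinder
    by (intro sigma_sets_mono') blast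
qed

lemma ring_prefix_sets: "ring_of_sets Omega {A. \<exists>n. prefix_set n A}"
proof (rule ring_of_setsI)
  show "{A. \<exists>n. prefix_set n A} \<subseteq> Pow Omega" by (auto simp: prefix_set_def)
  show "{} \<in> {A. \<exists>n. prefix_set n A}" using prefix_set_empty by blast
  fix A B assume "A \<in> {A. \<exists>n. prefix_set n A}" "B \<in> {A. \<exists>n. prefix_set n A}"
  then obtain m n where "prefix_set m A" "prefix_set n B" by blast
  then have AB: "prefix_set (max m n) A" "prefix_set (max m n) B" by (auto intro: prefix_set_mono)
  from prefix_set_Un[OF AB] show "A \<union> B \<in> {A. \<exists>n. prefix_set n A}" by blast
  from prefix_set_Diff[OF AB] show "A - B \<in> {A. \<exists>n. prefix_set n A}" by blast
qed

text \<open>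
  The extension theorem of Kolmogorov for two letters. Consistent weights define a finitely additive
  content on the clopen sets, and compactness makes countable additivity automatic: a decreasing
  sequence of clopen sets with empty intersection is eventually empty.
\<close>

theorem cylinder_extension:
  fixes a :: "nat list \<Rightarrow> real"
  assumes nonneg: "\<And>w. set w \<subseteq> letters \<Longrightarrow> a w \<ge> 0" and total: "a [] = 1"
    and split: "\<And>w. set w \<subseteq> letters \<Longrightarrow> a w = a (w @ [1]) + a (w @ [2])"
  shows "\<exists>M. borel_prob M \<and> (\<forall>w. set w \<subseteq> letters \<longrightarrow> measure M (cylinder w) = a w)"
proof -
  define x0 :: "nat \<Rightarrow> nat" where "x0 = (\<lambda>_. 1)"
  have x0: "x0 \<in> Omega" by (simp add: x0_def Omega_def)
  \<comment> \<open>For a set decided by \<open>n\<close> coordinates the tail \<open>x0\<close> is immaterial: the sum runs over the cylinders in \<open>A\<close>.\<close>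
  define S where "S n A = (\<Sum>w\<in>words letters n. a w * indicator A (prepend w x0))" for n A
  define content where "content A = S (LEAST n. prefix_set n A) A" for A
  let ?C = "{A. \<exists>n. prefix_set n A}"
  interpret C: ring_of_sets Omega ?C by (rule ring_prefix_sets)
  have S_stable: "S n A = S m A" if "prefix_set m A" "m \<le> n" for n m A
    using that(2)
  proof (induction n rule: dec_induct)
    case (step n)
    have "S (Suc n) A = (\<Sum>w\<in>words letters n. \<Sum>j\<in>letters. a (w @ [j]) * indicator A (prepend (w @ [j]) x0))"
      unfolding S_def sum_words_snoc ..
    also have "\<dots> = (\<Sum>w\<in>words letters n. \<Sum>j\<in>letters. a (w @ [j]) * indicator A (prepend w x0))"
    proof (intro sum.cong refl arg_cong2[where f = "(*)"])
      fix w j assume w: "w \<in> words letters n" and j: "j \<in> letters"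
      have 1: "prepend w x0 \<in> Omega" "prepend (w @ [j]) x0 \<in> Omega"
        using w j x0 by (auto intro!: prepend_in_Omega simp: words_def)
      have "\<forall>i<m. prepend w x0 i = prepend (w @ [j]) x0 i"
        using w step.hyps by (auto simp: prepend_nth words_def nth_append)
      then have "prepend w x0 \<in> A \<longleftrightarrow> prepend (w @ [j]) x0 \<in> A"
        using that(1) 1 by (metis prefix_set_def)
      then show "indicator A (prepend (w @ [j]) x0) = (indicator A (prepend w x0) :: real)"
        by (simp add: indicator_def)
    qed
    also have "\<dots> = S n A"
      unfolding S_def
    proof (intro sum.cong refl)
      fix w assume "w \<in> words letters n"
      then have "a w = a (w @ [1]) + a (w @ [2])" by (intro split) (simp add: words_def)
      then have "(\<Sum>j\<in>letters. a (w @ [j]) * k) = a w * k" for k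
        by (simp add: distrib_right)
      then show "(\<Sum>j\<in>letters. a (w @ [j]) * indicator A (prepend w x0)) = a w * indicator A (prepend w x0)" .
    qed
    finally show ?case using step.IH by simp
  qed simp
  have content: "content A = S n A" if "prefix_set n A" for n A
    unfolding content_def
    using S_stable[OF LeastI[of "\<lambda>n. prefix_set n A", OF that] Least_le[of "\<lambda>n. prefix_set n A", OF that]]
    by (rule sym)
  have content_nonneg: "content A \<ge> 0" for A
    unfolding content_def S_def by (intro sum_nonneg) (auto simp: words_def nonneg)
  have content_empty: "content {} = 0"
    using content[OF prefix_set_empty] by (simp add: S_def)
  have content_add: "content (A \<union> B) = content A + content B"
    if AB: "A \<in> ?C" "B \<in> ?C" and disj: "A \<inter> B = {}" for A B
  proof -
    obtain m n where "prefix_set m A" "prefix_set n B" using AB by blast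
    then have AB: "prefix_set (max m n) A" "prefix_set (max m n) B" by (auto intro: prefix_set_mono)
    have "indicator (A \<union> B) x = (indicator A x + indicator B x :: real)" for x
      using disj by (auto simp: indicator_def)
    then show ?thesis
      using content[OF AB(1)] content[OF AB(2)] content[OF prefix_set_Un[OF AB]]
      by (simp add: S_def algebra_simps sum.distrib)
  qed
  have "\<exists>\<mu>. (\<forall>A\<in>?C. \<mu> A = ennreal (content A)) \<and> measure_space Omega (sigma_sets Omega ?C) \<mu>"
  proof (rule C.caratheodory_empty_continuous)
    show "positive ?C (\<lambda>A. ennreal (content A))"
      by (simp add: positive_def content_empty)
    show "additive ?C (\<lambda>A. ennreal (content A))"
      using content_nonneg content_add by (auto simp: additive_def ennreal_plus)
    fix A :: "nat \<Rightarrow> (nat \<Rightarrow> nat) set"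
    assume A: "range A \<subseteq> ?C" "decseq A" "(\<Inter>i. A i) = {}"
    have comp: "compact (A i)" for i using A(1) compact_prefix_set by blast
    have "\<exists>i. A i = {}"
    proof -
      have "closed (A i)" for i using A(1) closed_prefix_set by blast
      then have "open (- A i)" for i by (simp add: open_Compl)
      moreover have "A 0 \<subseteq> (\<Union>i. - A i)" using A(3) by blast
      ultimately obtain D where D: "finite D" "A 0 \<subseteq> (\<Union>i\<in>D. - A i)"
        by (rule compactE_image[OF comp[of 0]])
      obtain N where N: "\<And>i. i \<in> D \<Longrightarrow> i \<le> N" using D(1) finite_nat_set_iff_bounded_le by auto
      have "A N = {}"
      proof (rule equals0I)
        fix x assume x: "x \<in> A N"
        then have "x \<in> A 0" using A(2) by (auto simp: decseq_def)
        with D(2) obtain i where "i \<in> D" "x \<notin> A i" by blast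
        with N[of i] A(2) x show False by (auto simp: decseq_def)
      qed
      then show ?thesis ..
    qed
    then obtain N where "A N = {}" ..
    then have "A i = {}" if "i \<ge> N" for i using A(2) that by (auto simp: decseq_def)
    then show "(\<lambda>i. ennreal (content (A i))) \<longlonglongrightarrow> 0"
      by (intro tendsto_eventually eventually_sequentiallyI[of N]) (simp add: content_empty)
  qed auto
  then obtain \<mu> where \<mu>: "\<And>A. A \<in> ?C \<Longrightarrow> \<mu> A = ennreal (content A)"
    and ms: "measure_space Omega (sigma_sets Omega ?C) \<mu>" by blast
  define M where "M = measure_of Omega ?C \<mu>"
  have sub: "?C \<subseteq> Pow Omega" by (auto simp: prefix_set_def)
  have em: "emeasure M A = ennreal (content A)" if "A \<in> ?C" for A
    using emeasure_measure_of[OF M_def sub, of A] that ms \<mu>[OF that]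
    by (auto simp: measure_space_def M_def sets_measure_of sub)
  have sp: "space M = Omega" by (simp add: M_def sub)
  have meas: "measure M (cylinder w) = a w" if w: "set w \<subseteq> letters" for w
  proof -
    have ww: "w \<in> words letters (length w)" using w by (simp add: words_def)
    have "content (cylinder w) = (\<Sum>v\<in>words letters (length w). a v * indicator (cylinder w) (prepend v x0))"
      using content[OF prefix_set_cylinder[OF order_refl]] by (simp add: S_def)
    also have "\<dots> = (\<Sum>v\<in>{w}. a v)"
    proof (intro sum.mono_neutral_cong_right finite_words ballI)
      fix v assume v: "v \<in> words letters (length w) - {w}"
      then have "prepend v x0 \<notin> cylinder w"
        using cylinder_same_length[OF prepend_in_cylinder[of v x0], of w] x0 by (auto simp: words_def)
      then show "a v * indicator (cylinder w) (prepend v x0) = 0" by simp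
    qed (use ww x0 w prepend_in_cylinder in auto)
    finally have "emeasure M (cylinder w) = ennreal (a w)"
      using em[of "cylinder w"] prefix_set_cylinder[OF order_refl, of w] by auto
    then show ?thesis
      using nonneg[OF w] by (simp add: measure_def)
  qed
  have "emeasure M Omega = 1"
    using em[of Omega] prefix_set_Omega content[OF prefix_set_Omega[of 0]] total
    by (auto simp: S_def prepend_in_Omega x0)
  then have "prob_space M" by (intro prob_spaceI) (simp add: sp)
  then have "borel_prob M"
    by (simp add: borel_prob_def M_def sub sigma_prefix_sets)
  with meas show ?thesis by blast
qed

section \<open>Entropy of finite-valued random variables\<close>

definition rv_entropy :: "'a measure \<Rightarrow> ('a \<Rightarrow> 'b) \<Rightarrow> real" where
  "rv_entropy M X =
    - (\<Sum>b\<in>X ` space M. measure M (X -` {b} \<inter> space M) * ln (measure M (X -` {b} \<inter> space M)))"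

definition fibers :: "'a measure \<Rightarrow> ('a \<Rightarrow> 'b) \<Rightarrow> 'a set set" where
  "fibers M X = (\<lambda>b. X -` {b} \<inter> space M) ` (X ` space M)"

lemma partition_entropy_fibers: "partition_entropy M (fibers M X) = rv_entropy M X"
  unfolding partition_entropy_def fibers_def rv_entropy_def
  by (subst sum.reindex) (auto simp: inj_on_def)

text \<open>
  Values that are never taken contribute \<open>0 * ln 0 = 0\<close>.
\<close>

lemma rv_entropy_superset:
  assumes "finite B" "X ` space M \<subseteq> B"
  shows "rv_entropy M X = - (\<Sum>b\<in>B. measure M (X -` {b} \<inter> space M) * ln (measure M (X -` {b} \<inter> space M)))"
proof -
  have "X -` {b} \<inter> space M = {}" if "b \<in> B - X ` space M" for b using that by auto
  then have "(\<Sum>b\<in>X ` space M. measure M (X -` {b} \<inter> space M) * ln (measure M (X -` {b} \<inter> space M))) =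
      (\<Sum>b\<in>B. measure M (X -` {b} \<inter> space M) * ln (measure M (X -` {b} \<inter> space M)))"
    by (intro sum.mono_neutral_left assms) simp
  then show ?thesis by (simp only: rv_entropy_def)
qed

lemma rv_entropy_cong:
  assumes "\<And>x. x \<in> space M \<Longrightarrow> X x = Y x"
  shows "rv_entropy M X = rv_entropy M Y"
proof -
  have "X ` space M = Y ` space M" "\<And>b. X -` {b} \<inter> space M = Y -` {b} \<inter> space M"
    using assms by auto
  then show ?thesis by (simp add: rv_entropy_def)
qed

text \<open>
  This bound and the next make the summands of an entropy small near probability one and near
  probability zero respectively.
\<close>

lemma neg_mult_ln_le_one_minus:
  fixes t :: real
  assumes "t \<ge> 0"
  shows "- (t * ln t) \<le> 1 - t"
proof (cases "t = 0")
  case False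
  then have "ln (1 / t) \<le> 1 / t - 1" using assms by (intro ln_le_minus_one) simp
  then show ?thesis using False assms by (simp add: ln_div field_simps)
qed simp

lemma neg_mult_ln_le_sqrt:
  fixes t :: real
  assumes "t \<ge> 0"
  shows "- (t * ln t) \<le> 2 * sqrt t"
proof (cases "t = 0")
  case False
  then have t: "t > 0" using assms by simp
  have "- ln (sqrt t) \<le> 1 / sqrt t - 1" using ln_le_minus_one[of "1 / sqrt t"] t by (simp add: ln_div)
  then have "- ln t \<le> 2 * (1 / sqrt t)" using t by (simp add: ln_sqrt)
  then have "- ln t \<le> 2 / sqrt t" by simp
  then have "t * (- ln t) \<le> t * (2 / sqrt t)" using t by (intro mult_left_mono) auto
  also have "\<dots> = 2 * sqrt t" using t by (simp add: field_simps)
  finally show ?thesis by simp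
qed simp

context prob_space
begin

text \<open>
  Base \<open>exp 1\<close> turns the logarithms of information theory into \<open>ln\<close>.
\<close>

lemma information_space_exp1: "information_space M (exp 1)"
  by unfold_locales simp

lemma rv_entropy_eq:
  assumes "simple_function M X"
  shows "rv_entropy M X = entropy (exp 1) (count_space (X ` space M)) X"
  using information_space.entropy_simple_distributed[OF information_space_exp1
      simple_distributedI[OF assms measure_nonneg refl]]
  by (simp add: rv_entropy_def log_ln)

text \<open>
  Subadditivity: by the chain rule the pair has entropy \<open>H(X) + H(Y | X)\<close>, and conditioning does not
  increase entropy.
\<close>

lemma rv_entropy_pair_le:
  assumes X: "simple_function M X" and Y: "simple_function M Y"
  shows "rv_entropy M (\<lambda>x. (X x, Y x)) \<le> rv_entropy M X + rv_entropy M Y"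
proof -
  interpret information_space M "exp 1" by (rule information_space_exp1)
  show ?thesis
    unfolding rv_entropy_eq[OF X] rv_entropy_eq[OF Y] rv_entropy_eq[OF simple_function_Pair[OF X Y]]
    using entropy_chain_rule[OF X Y] conditional_entropy_less_eq_entropy[OF Y X] by linarith
qed

lemma rv_entropy_le_if_determined:
  assumes Z: "simple_function M Z"
    and det: "\<And>x y. x \<in> space M \<Longrightarrow> y \<in> space M \<Longrightarrow> Z x = Z y \<Longrightarrow> W x = W y"
  shows "rv_entropy M W \<le> rv_entropy M Z"
proof -
  interpret information_space M "exp 1" by (rule information_space_exp1)
  define f where "f z = W (SOME x. x \<in> space M \<and> Z x = z)" for z
  have "W x = (f \<circ> Z) x" if x: "x \<in> space M" for x
  proof -
    define y where "y = (SOME y. y \<in> space M \<and> Z y = Z x)"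
    have "y \<in> space M \<and> Z y = Z x"
      unfolding y_def by (rule someI[of _ x]) (simp add: x)
    then have "W x = W y" by (intro det x) simp_all
    then show ?thesis by (simp only: f_def y_def comp_apply)
  qed
  then have "rv_entropy M W = rv_entropy M (f \<circ> Z)" by (rule rv_entropy_cong)
  also have "\<dots> \<le> rv_entropy M Z"
    unfolding rv_entropy_eq[OF Z] rv_entropy_eq[OF simple_function_compose[OF Z]]
    by (rule entropy_data_processing[OF Z])
  finally show ?thesis .
qed

lemma rv_entropy_nonneg: "rv_entropy M X \<ge> 0"
proof -
  have "measure M A * ln (measure M A) \<le> 0" for A
    by (cases "measure M A = 0") (auto intro!: mult_nonneg_nonpos simp: zero_less_measure_iff)
  then show ?thesis unfolding rv_entropy_def by (simp add: sum_nonpos)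
qed

text \<open>
  The value \<open>c\<close> has probability at least \<open>1 - d\<close> and contributes at most \<open>d\<close>; all other values have
  probability at most \<open>d\<close>. The bound tends to zero with \<open>d\<close> as long as the number of values is fixed.
\<close>

lemma rv_entropy_le_if_almost_constant:
  assumes E: "simple_function M E" and B: "finite B" "E ` space M \<subseteq> B"
    and d: "prob {x \<in> space M. E x \<noteq> c} \<le> d"
  shows "rv_entropy M E \<le> d + 2 * card B * sqrt d"
proof -
  let ?p = "\<lambda>b. prob (E -` {b} \<inter> space M)"
  have ev: "E -` S \<inter> space M \<in> events" for S using simple_functionD(2)[OF E] .
  have ne: "{x \<in> space M. E x \<noteq> c} = E -` (- {c}) \<inter> space M" by auto
  have d0: "d \<ge> 0" using d measure_nonneg order_trans by blast
  have pb: "?p b \<le> d" if "b \<noteq> c" for b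
    using that d ev unfolding ne by (intro order_trans[OF finite_measure_mono d]) (auto simp: ne)
  have pc: "1 - d \<le> ?p c"
  proof -
    have "{x \<in> space M. E x \<noteq> c} = space M - (E -` {c} \<inter> space M)" by auto
    then show ?thesis using d prob_compl[OF ev[of "{c}"]] by simp
  qed
  have "rv_entropy M E = (\<Sum>b\<in>B. - (?p b * ln (?p b)))"
    by (simp add: rv_entropy_superset[OF B] sum_negf)
  also have "\<dots> \<le> (\<Sum>b\<in>B. (if b = c then d else 0) + 2 * sqrt d)"
  proof (rule sum_mono)
    fix b
    show "- (?p b * ln (?p b)) \<le> (if b = c then d else 0) + 2 * sqrt d"
    proof (cases "b = c")
      case True
      have "- (?p c * ln (?p c)) \<le> d + 2 * sqrt d"
        using neg_mult_ln_le_one_minus[of "?p c", OF measure_nonneg] pc d0 real_sqrt_ge_zero[OF d0] by linarith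
      then show ?thesis using True by simp
    next
      case False
      have "- (?p b * ln (?p b)) \<le> 2 * sqrt (?p b)" by (rule neg_mult_ln_le_sqrt) simp
      also have "\<dots> \<le> 2 * sqrt d" using pb[OF False] by simp
      finally show ?thesis using False by simp
    qed
  qed
  also have "\<dots> \<le> d + 2 * card B * sqrt d"
    using B(1) d0 by (simp add: sum.distrib sum.delta)
  finally show ?thesis .
qed

end

section \<open>Subadditive sequences\<close>

lemma subadditive_mult:
  fixes a :: "nat \<Rightarrow> real"
  assumes "\<And>m n. a (m + n) \<le> a m + a n"
  shows "a (q * m + r) \<le> real q * a m + a r"
proof (induction q)
  case (Suc q)
  have "a (Suc q * m + r) \<le> a m + a (q * m + r)" using assms[of m "q * m + r"] by (simp add: add_ac)
  then show ?case using Suc by (simp add: algebra_simps)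
qed simp

text \<open>
  Fekete's lemma. If \<open>a m / m\<close> nearly attains the infimum \<open>L\<close>, then division with remainder by \<open>m\<close> shows
  that \<open>a n / n\<close> exceeds it by at most a constant over \<open>n\<close>.
\<close>

lemma fekete:
  fixes a :: "nat \<Rightarrow> real"
  assumes sub: "\<And>m n. a (m + n) \<le> a m + a n" and nonneg: "\<And>n. a n \<ge> 0"
  shows "convergent (\<lambda>n. a n / real n)"
proof -
  define L where "L = (INF n\<in>{1..}. a n / real n)"
  have bdd: "bdd_below ((\<lambda>n. a n / real n) ` {1..})" using nonneg by (intro bdd_belowI[of _ 0]) auto
  have L_le: "L \<le> a n / real n" if "n \<ge> 1" for n
    unfolding L_def using bdd that by (intro cINF_lower) auto
  have "(\<lambda>n. a n / real n) \<longlonglongrightarrow> L"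
  proof (rule LIMSEQ_I)
    fix e :: real assume e: "e > 0"
    then have "\<exists>n\<in>{1..}. a n / real n < L + e / 2"
      using cINF_less_iff[OF _ bdd, of "L + e / 2"] unfolding L_def by auto
    then obtain m where m: "m \<ge> 1" "a m / real m < L + e / 2" by auto
    define C where "C = (\<Sum>r<m. a r)"
    have C: "a r \<le> C" if "r < m" for r
      unfolding C_def using that nonneg by (intro member_le_sum) auto
    obtain N where N: "N \<ge> 1" "C / real N < e / 2"
    proof -
      obtain N where N: "real N > 2 * C / e" using reals_Archimedean2 by blast
      have "C < real (Suc N) * (e / 2)" using N e by (simp add: field_simps)
      then show ?thesis by (intro that[of "Suc N"]) (auto simp: field_simps)
    qed
    have "norm (a n / real n - L) < e" if n: "n \<ge> N" for n
    proof -
      have n1: "n \<ge> 1" using N(1) n by simp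
      have "a n \<le> real (n div m) * a m + a (n mod m)"
        using subadditive_mult[OF sub, of "n div m" m "n mod m"] by simp
      also have "\<dots> \<le> real n / real m * a m + C"
      proof (intro add_mono mult_right_mono C nonneg)
        have "real (n div m) * real m \<le> real n"
          by (metis div_times_less_eq_dividend of_nat_le_iff of_nat_mult)
        then show "real (n div m) \<le> real n / real m" using m(1) by (simp add: field_simps)
      qed (use m(1) in simp)
      finally have "a n / real n \<le> a m / real m + C / real n"
        using n1 m(1) by (simp add: field_simps)
      also have "C / real n \<le> C / real N"
        using n N(1) C_def nonneg by (intro divide_left_mono) (auto simp: sum_nonneg)
      finally have "a n / real n < L + e" using m(2) N(2) by linarith
      then show ?thesis using L_le[OF n1] by simp
    qed
    then show "\<exists>no. \<forall>n\<ge>no. norm (a n / real n - L) < e" by blast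
  qed
  then show ?thesis by (rule convergentI)
qed

section \<open>Entropy along a measure-preserving map\<close>

definition trajectory :: "('a \<Rightarrow> 'a) \<Rightarrow> ('a \<Rightarrow> 'b) \<Rightarrow> nat \<Rightarrow> 'a \<Rightarrow> 'b list" where
  "trajectory T X n x = map (\<lambda>i. X ((T ^^ i) x)) [0..<n]"

lemma trajectory_eq_iff: "trajectory T X n x = trajectory T X n y \<longleftrightarrow> (\<forall>i<n. X ((T ^^ i) x) = X ((T ^^ i) y))"
  by (auto simp: trajectory_def)

lemma fibers_eq: "fibers M X = (\<lambda>x. {y \<in> space M. X y = X x}) ` space M"
  by (auto simp: fibers_def)

text \<open>
  On a cell of the common refinement every \<open>X i\<close> is constant, and a cell is determined by these
  constants. Without any partition, for \<open>n = 0\<close>, the only cell would be the universe of the type.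
\<close>

lemma common_refinement_fibers:
  fixes X :: "nat \<Rightarrow> 'a \<Rightarrow> 'b"
  assumes n: "n \<ge> 1"
  shows "common_refinement ((\<lambda>i. fibers M (X i)) ` {..<n}) = fibers M (\<lambda>x. map (\<lambda>i. X i x) [0..<n])"
    (is "common_refinement ?P = fibers M ?Y")
proof -
  define cell where "cell i x = {y \<in> space M. X i y = X i x}" for i x
  have fib: "fibers M (X i) = cell i ` space M" for i by (simp add: fibers_eq cell_def)
  have cellY: "{y \<in> space M. ?Y y = ?Y x} = (\<Inter>i<n. cell i x)" for x
  proof (intro equalityI subsetI)
    fix y assume y: "y \<in> (\<Inter>i<n. cell i x)"
    then have "y \<in> cell 0 x" using n by force
    then have "y \<in> space M" by (simp add: cell_def)
    then show "y \<in> {y \<in> space M. ?Y y = ?Y x}" using y by (auto simp: cell_def)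
  qed (auto simp: cell_def)
  show ?thesis
  proof (intro equalityI subsetI)
    fix A assume "A \<in> common_refinement ?P"
    then obtain f where f: "f \<in> (\<Pi> P\<in>?P. P)" "A = \<Inter> (f ` ?P)" "A \<noteq> {}"
      by (auto simp: common_refinement)
    then obtain z where z: "z \<in> A" by blast
    have fi: "f (fibers M (X i)) = cell i z" if "i < n" for i
    proof -
      have "f (fibers M (X i)) \<in> cell i ` space M" using f(1) that fib by blast
      then obtain u where u: "u \<in> space M" "f (fibers M (X i)) = cell i u" by auto
      have "z \<in> f (fibers M (X i))" using z f(2) that by auto
      then show ?thesis using u by (auto simp: cell_def)
    qed
    then have "A = (\<Inter>i<n. cell i z)" using f(2) by (simp add: image_image)
    moreover have "z \<in> space M" using fi[of 0] n z f(2) by (auto simp: cell_def)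
    ultimately show "A \<in> fibers M ?Y" unfolding fibers_eq cellY by blast
  next
    fix A assume "A \<in> fibers M ?Y"
    then obtain x where x: "x \<in> space M" "A = (\<Inter>i<n. cell i x)" unfolding fibers_eq cellY by auto
    define f where "f P = (SOME c. c \<in> P \<and> x \<in> c)" for P
    have f: "f (fibers M (X i)) = cell i x" for i
    proof -
      have "cell i x \<in> fibers M (X i) \<and> x \<in> cell i x" using x(1) by (auto simp: fib cell_def)
      then have "f (fibers M (X i)) \<in> fibers M (X i) \<and> x \<in> f (fibers M (X i))"
        unfolding f_def by (rule someI)
      then obtain u where "f (fibers M (X i)) = cell i u" "x \<in> cell i u" unfolding fib by blast
      then show ?thesis by (simp add: cell_def)
    qed
    have "f \<in> (\<Pi> P\<in>?P. P)" using x(1) f by (auto simp: fib)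
    moreover have "A = \<Inter> (f ` ?P)" using x(2) f by (simp add: image_image)
    moreover have "x \<in> A" using x by (auto simp: cell_def)
    ultimately show "A \<in> common_refinement ?P" unfolding common_refinement by blast
  qed
qed

locale measure_preserving = prob_space M for M :: "'a measure" +
  fixes T :: "'a \<Rightarrow> 'a"
  assumes T_measurable: "T \<in> M \<rightarrow>\<^sub>M M" and T_distr: "distr M M T = M"
begin

lemma funpow_measurable: "T ^^ i \<in> M \<rightarrow>\<^sub>M M"
proof (induction i)
  case (Suc i)
  then show ?case unfolding funpow.simps by (rule measurable_comp[OF _ T_measurable])
qed simp

lemma funpow_space: "x \<in> space M \<Longrightarrow> (T ^^ i) x \<in> space M"
  using measurable_space[OF funpow_measurable] .

lemma funpow_distr: "distr M M (T ^^ i) = M"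
proof (induction i)
  case 0
  then show ?case by (simp add: distr_id2)
next
  case (Suc i)
  have "distr M M (T ^^ Suc i) = distr (distr M M (T ^^ i)) M T"
    by (simp only: funpow.simps distr_distr[OF T_measurable funpow_measurable])
  then show ?case by (simp only: Suc T_distr)
qed

lemma simple_function_funpow:
  assumes X: "simple_function M X"
  shows "simple_function M (\<lambda>x. X ((T ^^ i) x))"
proof (rule simple_function_comp[OF funpow_measurable, unfolded comp_def])
qed (rule X)

lemma simple_function_trajectory:
  assumes X: "simple_function M X"
  shows "simple_function M (trajectory T X n)"
proof (induction n)
  case 0
  then show ?case by (simp add: trajectory_def)
next
  case (Suc n)
  have "simple_function M (\<lambda>x. (\<lambda>(l, b). l @ [b]) (trajectory T X n x, X ((T ^^ n) x)))"
    by (rule simple_function_compose1[OF simple_function_Pair[OF Suc simple_function_funpow[OF X]]])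
  then show ?case by (simp add: trajectory_def)
qed

lemma rv_entropy_funpow:
  assumes X: "simple_function M X"
  shows "rv_entropy M (\<lambda>x. X ((T ^^ i) x)) = rv_entropy M X"
proof -
  have "prob ((\<lambda>x. X ((T ^^ i) x)) -` {b} \<inter> space M) = prob (X -` {b} \<inter> space M)" for b
  proof -
    have "prob (X -` {b} \<inter> space M) = measure (distr M M (T ^^ i)) (X -` {b} \<inter> space M)"
      by (simp add: funpow_distr)
    also have "\<dots> = prob ((T ^^ i) -` (X -` {b} \<inter> space M) \<inter> space M)"
      using simple_functionD(2)[OF X] by (intro measure_distr funpow_measurable)
    also have "(T ^^ i) -` (X -` {b} \<inter> space M) \<inter> space M = (\<lambda>x. X ((T ^^ i) x)) -` {b} \<inter> space M"
      using funpow_space by auto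
    finally show ?thesis ..
  qed
  moreover have "rv_entropy M (\<lambda>x. X ((T ^^ i) x)) = - (\<Sum>b\<in>X ` space M.
      prob ((\<lambda>x. X ((T ^^ i) x)) -` {b} \<inter> space M) * ln (prob ((\<lambda>x. X ((T ^^ i) x)) -` {b} \<inter> space M)))"
    using funpow_space by (intro rv_entropy_superset simple_functionD(1)[OF X]) auto
  ultimately show ?thesis by (simp only: rv_entropy_def)
qed

text \<open>
  A trajectory of length \<open>m + n\<close> is one of length \<open>m\<close> followed by one of length \<open>n\<close> that starts \<open>m\<close> steps
  later, and the latter has the same distribution as if it started at once.
\<close>

lemma rv_entropy_trajectory_add:
  assumes X: "simple_function M X"
  shows "rv_entropy M (trajectory T X (m + n)) \<le> rv_entropy M (trajectory T X m) + rv_entropy M (trajectory T X n)"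
proof -
  let ?Y = "\<lambda>x. trajectory T X n ((T ^^ m) x)"
  have Y: "simple_function M ?Y" by (intro simple_function_funpow simple_function_trajectory X)
  have "rv_entropy M (trajectory T X (m + n)) \<le> rv_entropy M (\<lambda>x. (trajectory T X m x, ?Y x))"
  proof (rule rv_entropy_le_if_determined)
    show "simple_function M (\<lambda>x. (trajectory T X m x, ?Y x))"
      by (intro simple_function_Pair simple_function_trajectory X Y)
    fix x y assume "(trajectory T X m x, ?Y x) = (trajectory T X m y, ?Y y)"
    then have 1: "\<And>i. i < m \<Longrightarrow> X ((T ^^ i) x) = X ((T ^^ i) y)"
      and 2: "\<And>i. i < n \<Longrightarrow> X ((T ^^ (i + m)) x) = X ((T ^^ (i + m)) y)"
      by (auto simp: trajectory_eq_iff funpow_add)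
    have "X ((T ^^ i) x) = X ((T ^^ i) y)" if "i < m + n" for i
      using 1[of i] 2[of "i - m"] that by (cases "i < m") auto
    then show "trajectory T X (m + n) x = trajectory T X (m + n) y" by (simp add: trajectory_eq_iff)
  qed
  also have "\<dots> \<le> rv_entropy M (trajectory T X m) + rv_entropy M ?Y"
    by (intro rv_entropy_pair_le simple_function_trajectory X Y)
  also have "rv_entropy M ?Y = rv_entropy M (trajectory T X n)"
    by (intro rv_entropy_funpow simple_function_trajectory X)
  finally show ?thesis by simp
qed

lemma rv_entropy_trajectory_le:
  assumes X: "simple_function M X"
  shows "rv_entropy M (trajectory T X n) \<le> real n * rv_entropy M X"
proof -
  have "rv_entropy M (trajectory T X (n * 1 + 0)) \<le> real n * rv_entropy M (trajectory T X 1) + rv_entropy M (trajectory T X 0)"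
    by (rule subadditive_mult) (rule rv_entropy_trajectory_add[OF X])
  moreover have "rv_entropy M (trajectory T X 1) \<le> rv_entropy M X"
    by (intro rv_entropy_le_if_determined X) (simp add: trajectory_def)
  then have "real n * rv_entropy M (trajectory T X 1) \<le> real n * rv_entropy M X" by (intro mult_left_mono) auto
  moreover have "rv_entropy M (trajectory T X 0) = 0"
  proof -
    have "trajectory T X 0 -` {[]} \<inter> space M = space M" by (auto simp: trajectory_def)
    then show ?thesis
      by (subst rv_entropy_superset[of "{[]}"]) (auto simp: trajectory_def prob_space)
  qed
  ultimately show ?thesis by simp
qed

lemma iterated_join_fibers:
  assumes n: "n \<ge> 1"
  shows "iterated_join M T (fibers M X) n = fibers M (trajectory T X n)"
proof -
  have "pullback_partition M (T ^^ i) (fibers M X) = fibers M (\<lambda>x. X ((T ^^ i) x))" for i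
  proof (intro equalityI subsetI)
    fix A assume "A \<in> pullback_partition M (T ^^ i) (fibers M X)"
    then obtain u where u: "u \<in> space M" "A = (T ^^ i) -` {y \<in> space M. X y = X u} \<inter> space M" "A \<noteq> {}"
      unfolding pullback_partition_def fibers_eq by auto
    then obtain x where "x \<in> A" by blast
    then have "x \<in> space M" "A = {y \<in> space M. X ((T ^^ i) y) = X ((T ^^ i) x)}"
      using u funpow_space by auto
    then show "A \<in> fibers M (\<lambda>x. X ((T ^^ i) x))" unfolding fibers_eq by blast
  next
    fix A assume "A \<in> fibers M (\<lambda>x. X ((T ^^ i) x))"
    then obtain x where x: "x \<in> space M" "A = {y \<in> space M. X ((T ^^ i) y) = X ((T ^^ i) x)}"
      unfolding fibers_eq by blast
    then have "A = (T ^^ i) -` {y \<in> space M. X y = X ((T ^^ i) x)} \<inter> space M" "A \<noteq> {}"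
      using funpow_space by auto
    moreover have "{y \<in> space M. X y = X ((T ^^ i) x)} \<in> fibers M X"
      unfolding fibers_eq using funpow_space[OF x(1)] by blast
    ultimately show "A \<in> pullback_partition M (T ^^ i) (fibers M X)"
      unfolding pullback_partition_def by (intro DiffI image_eqI) auto
  qed
  then show ?thesis
    unfolding iterated_join_def using common_refinement_fibers[OF n, of M "\<lambda>i x. X ((T ^^ i) x)"]
    by (simp add: trajectory_def[abs_def])
qed

text \<open>
  The definition of \<open>entropy_wrt\<close> speaks of \<open>lim\<close>, which says nothing unless the limit exists;
  subadditivity provides it.
\<close>

lemma entropy_wrt_limit:
  assumes X: "simple_function M X"
  shows "(\<lambda>n. rv_entropy M (trajectory T X n) / real n) \<longlonglongrightarrow> entropy_wrt M T (fibers M X)"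
proof -
  have conv: "convergent (\<lambda>n. rv_entropy M (trajectory T X n) / real n)"
    by (intro fekete rv_entropy_trajectory_add[OF X] rv_entropy_nonneg)
  have "(\<lambda>n. partition_entropy M (iterated_join M T (fibers M X) n) / real n) =
      (\<lambda>n. rv_entropy M (trajectory T X n) / real n)"
  proof
    fix n
    show "partition_entropy M (iterated_join M T (fibers M X) n) / real n = rv_entropy M (trajectory T X n) / real n"
      by (cases "n = 0") (simp_all add: iterated_join_fibers partition_entropy_fibers)
  qed
  with conv show ?thesis by (simp add: entropy_wrt_def convergent_LIMSEQ_iff)
qed

end

text \<open>
  Every partition consists of the fibers of a random variable. The label of a point is the set of
  cells that contain it, rather than the cell itself, because this label can be perturbed cell by
  cell when the cells are approximated.
\<close>

lemma fibers_label:
  assumes "partition_on (space M) \<xi>"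
  shows "fibers M (\<lambda>x. {A \<in> \<xi>. x \<in> A}) = \<xi>"
proof -
  have cell: "{y \<in> space M. {A \<in> \<xi>. y \<in> A} = {A \<in> \<xi>. x \<in> A}} = B" if "B \<in> \<xi>" "x \<in> B" for x B
  proof -
    have label: "{A \<in> \<xi>. y \<in> A} = {B'}" if "B' \<in> \<xi>" "y \<in> B'" for y B'
    proof (intro equalityI subsetI)
      fix A assume "A \<in> {A \<in> \<xi>. y \<in> A}"
      then show "A \<in> {B'}" using disjointD[OF partition_onD2[OF assms], of A B'] that by blast
    qed (use that in auto)
    have x: "{A \<in> \<xi>. x \<in> A} = {B}" by (rule label[OF that])
    have "B \<subseteq> space M" using that(1) partition_onD1[OF assms] by blast
    moreover have "{A \<in> \<xi>. y \<in> A} = {B} \<longleftrightarrow> y \<in> B" for y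
      using label[OF that(1), of y] by blast
    ultimately show ?thesis unfolding x by auto
  qed
  show ?thesis
  proof (intro equalityI subsetI)
    fix B assume "B \<in> fibers M (\<lambda>x. {A \<in> \<xi>. x \<in> A})"
    then obtain x where x: "x \<in> space M" "B = {y \<in> space M. {A \<in> \<xi>. y \<in> A} = {A \<in> \<xi>. x \<in> A}}"
      unfolding fibers_eq by blast
    then obtain B' where "B' \<in> \<xi>" "x \<in> B'" using partition_onD1[OF assms] by blast
    then show "B \<in> \<xi>" using cell x by simp
  next
    fix B assume B: "B \<in> \<xi>"
    then obtain x where x: "x \<in> B" using partition_onD3[OF assms] by fastforce
    then have "x \<in> space M" using B partition_onD1[OF assms] by blast
    then show "B \<in> fibers M (\<lambda>x. {A \<in> \<xi>. x \<in> A})"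
      unfolding fibers_eq using cell[OF B x] by blast
  qed
qed


section \<open>Bounds for the entropy of the shift\<close>

lemma invariant_probs_measure_preserving:
  assumes "M \<in> invariant_probs"
  shows "measure_preserving M shift"
proof -
  have M: "borel_prob M" "distr M M shift = M" using assms by (auto simp: invariant_probs_def)
  interpret prob_space M using M(1) by (rule borel_prob_prob_space)
  show ?thesis by unfold_locales (use M shift_measurable in auto)
qed

lemma shift_funpow: "(shift ^^ i) x = (\<lambda>j. x (i + j))"
  by (induction i) (auto simp: shift_def)

lemma trajectory_shift: "trajectory shift (\<lambda>x. x 0) n x = map x [0..<n]"
  by (simp add: trajectory_def shift_funpow)

lemma simple_function_prefix_determined:
  assumes M: "borel_prob M"
    and Y: "\<And>x y. x \<in> Omega \<Longrightarrow> y \<in> Omega \<Longrightarrow> \<forall>i<n. x i = y i \<Longrightarrow> Y x = Y y"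
  shows "simple_function M Y"
proof -
  have sp: "space M = Omega" by (rule borel_prob_space[OF M])
  have Yw: "Y x = Y (prepend (map x [0..<n]) (\<lambda>_. 1))" if "x \<in> Omega" for x
    using that prefix_in_words[OF that, of n]
    by (intro Y prepend_in_Omega) (auto simp: prepend_nth words_def Omega_def)
  have "Y ` Omega \<subseteq> (\<lambda>w. Y (prepend w (\<lambda>_. 1))) ` words letters n"
    using Yw prefix_in_words by blast
  then have "finite (Y ` Omega)" by (rule finite_subset) (simp add: finite_words)
  moreover have "Y -` S \<inter> Omega \<in> sets M" for S
  proof -
    have "prefix_set n (Y -` S \<inter> Omega)"
      unfolding prefix_set_def
    proof (intro conjI ballI impI)
      fix x y assume xy: "x \<in> Omega" "y \<in> Omega" "\<forall>i<n. x i = y i" "x \<in> Y -` S \<inter> Omega"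
      have "Y x = Y y" by (rule Y[OF xy(1-3)])
      then show "y \<in> Y -` S \<inter> Omega" using xy by simp
    qed simp
    then show ?thesis using sets_prefix_set borel_prob_sets[OF M] by blast
  qed
  ultimately show ?thesis by (simp add: simple_function_def sp)
qed

text \<open>
  The sets that can be approximated include the clopen ones and are closed under complements and
  countable unions: a union is first truncated, then its finitely many members are approximated.
\<close>

lemma approximation_by_prefix_set:
  assumes M: "borel_prob M" and A: "A \<in> sets M" and e: "e > 0"
  shows "\<exists>n B. prefix_set n B \<and> measure M ((A - B) \<union> (B - A)) < e"
proof -
  interpret prob_space M using M by (rule borel_prob_prob_space)
  have sp: "space M = Omega" by (rule borel_prob_space[OF M])
  have sets_eq: "sets M = sigma_sets Omega {A. \<exists>n. prefix_set n A}"
    by (simp add: borel_prob_sets[OF M] sigma_prefix_sets)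
  have pm: "B \<in> events" if "prefix_set n B" for n B
    using sets_prefix_set[OF that] by (simp add: borel_prob_sets[OF M])
  have "A \<in> sigma_sets Omega {A. \<exists>n. prefix_set n A}" using A sets_eq by simp
  then show ?thesis using e
  proof (induction arbitrary: e)
    case (Basic A)
    then show ?case by (auto intro!: exI[of _ A])
  next
    case Empty
    then show ?case using prefix_set_empty by (intro exI[of _ 0] exI[of _ "{}"]) auto
  next
    case (Compl A)
    then obtain n B where B: "prefix_set n B" "prob ((A - B) \<union> (B - A)) < e" by blast
    have "A \<subseteq> Omega" using Compl.hyps sets_eq sets.sets_into_space sp by blast
    moreover have "B \<subseteq> Omega" using B(1) by (simp add: prefix_set_def)
    ultimately have "((Omega - A) - (Omega - B)) \<union> ((Omega - B) - (Omega - A)) = (A - B) \<union> (B - A)" by blast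
    then show ?case
      using B prefix_set_Diff[OF prefix_set_Omega B(1)] by (intro exI[of _ n] exI[of _ "Omega - B"]) simp
  next
    case (Union A)
    have Aev: "A i \<in> events" for i using Union.hyps sets_eq by simp
    let ?U = "\<Union>i. A i"
    have "(\<lambda>N. prob (\<Union>i<N. A i)) \<longlonglongrightarrow> prob (\<Union>N. \<Union>i<N. A i)"
      using Aev by (intro finite_Lim_measure_incseq incseq_SucI UN_mono) auto
    also have "(\<Union>N. \<Union>i<N. A i) = ?U" by auto
    finally obtain N where N: "\<bar>prob (\<Union>i<N. A i) - prob ?U\<bar> < e / 2"
      using Union.prems LIMSEQ_D[of "\<lambda>N. prob (\<Union>i<N. A i)" "prob ?U" "e / 2"] by auto
    define d where "d = e / (2 * real (Suc N))"
    have d: "d > 0" using Union.prems by (simp add: d_def)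
    have "\<exists>n B. prefix_set n B \<and> prob ((A i - B) \<union> (B - A i)) < d" for i
      using Union.IH d by blast
    then obtain n B where B: "\<And>i. prefix_set (n i) (B i)" "\<And>i. prob ((A i - B i) \<union> (B i - A i)) < d"
      by metis
    let ?B = "\<Union>i<N. B i"
    have "\<exists>k. prefix_set k (\<Union>i<m. B i)" for m
    proof (induction m)
      case (Suc m)
      then obtain k where "prefix_set k (\<Union>i<m. B i)" by blast
      then have "prefix_set (max k (n m)) ((\<Union>i<m. B i) \<union> B m)"
        using B(1)[of m] by (intro prefix_set_Un) (auto intro: prefix_set_mono)
      then show ?case by (auto simp: lessThan_Suc Un_commute)
    qed (auto simp: prefix_set_empty)
    then obtain k where k: "prefix_set k ?B" by blast
    have Bev: "B i \<in> events" for i using pm B(1) by blast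
    have sub: "(?U - ?B) \<union> (?B - ?U) \<subseteq> (?U - (\<Union>i<N. A i)) \<union> (\<Union>i<N. (A i - B i) \<union> (B i - A i))" by blast
    have "prob ((?U - ?B) \<union> (?B - ?U)) \<le> prob ((?U - (\<Union>i<N. A i)) \<union> (\<Union>i<N. (A i - B i) \<union> (B i - A i)))"
      using Aev Bev by (intro finite_measure_mono sub) auto
    also have "\<dots> \<le> prob (?U - (\<Union>i<N. A i)) + prob (\<Union>i<N. (A i - B i) \<union> (B i - A i))"
      using Aev Bev by (intro measure_Un_le) auto
    also have "prob (?U - (\<Union>i<N. A i)) = prob ?U - prob (\<Union>i<N. A i)"
      using Aev by (intro finite_measure_Diff) auto
    also have "prob (\<Union>i<N. (A i - B i) \<union> (B i - A i)) \<le> (\<Sum>i<N. prob ((A i - B i) \<union> (B i - A i)))"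
      using Aev Bev by (intro finite_measure_subadditive_finite) auto
    also have "\<dots> \<le> (\<Sum>i<N. d)" using B(2) by (intro sum_mono less_imp_le)
    also have "\<dots> \<le> e / 2"
      using Union.prems by (simp add: d_def field_simps)
    finally have "prob ((?U - ?B) \<union> (?B - ?U)) < e" using N by linarith
    then show ?case using k by blast
  qed
qed

lemma ks_entropy_ge:
  assumes M: "M \<in> invariant_probs"
    and H: "\<And>n. rv_entropy M (\<lambda>x. map x [0..<n]) \<ge> real n * H"
  shows "ks_entropy M shift \<ge> ereal H"
proof -
  interpret measure_preserving M shift using M by (rule invariant_probs_measure_preserving)
  have bp: "borel_prob M" using M by (simp add: invariant_probs_def)
  let ?X = "\<lambda>x :: nat \<Rightarrow> nat. x 0"
  have X: "simple_function M ?X" by (rule simple_function_prefix_determined[OF bp, of 1]) simp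
  have lim: "(\<lambda>n. rv_entropy M (trajectory shift ?X n) / real n) \<longlonglongrightarrow> entropy_wrt M shift (fibers M ?X)"
    by (rule entropy_wrt_limit[OF X])
  have "H \<le> entropy_wrt M shift (fibers M ?X)"
  proof (rule LIMSEQ_le_const[OF lim], intro exI[of _ 1] allI impI)
    fix n :: nat assume "n \<ge> 1"
    then show "H \<le> rv_entropy M (trajectory shift ?X n) / real n"
      using H[of n] by (simp add: trajectory_shift[abs_def] field_simps)
  qed
  moreover have "finite (fibers M ?X) \<and> partition_on (space M) (fibers M ?X) \<and> fibers M ?X \<subseteq> sets M"
  proof (intro conjI)
    show "finite (fibers M ?X)" using simple_functionD(1)[OF X] by (simp add: fibers_def)
    show "fibers M ?X \<subseteq> sets M" using simple_functionD(2)[OF X] by (auto simp: fibers_def)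
    show "partition_on (space M) (fibers M ?X)"
      by (rule partition_onI) (auto simp: fibers_def disjnt_def)
  qed
  ultimately show ?thesis
    unfolding ks_entropy_def by (intro SUP_upper2[of "fibers M ?X"]) auto
qed

text \<open>
  The coordinates form a generator, so the entropy of the process of letters bounds the entropy of
  every finite partition. The label \<open>X\<close> of a partition agrees, up to a small error event, with a label \<open>Y\<close> that
  depends on \<open>m\<close> coordinates. Write \<open>E\<close> for the correction: the value of \<open>X\<close> where it differs from \<open>Y\<close>, and
  \<open>None\<close> elsewhere. The trajectory of \<open>X\<close> can be read off from those of \<open>Y\<close> and \<open>E\<close>. The former is read off from
  a prefix of length \<open>n + m\<close>, and the latter has entropy at most \<open>n\<close> times that of \<open>E\<close>, which is
  small.
\<close>

lemma ks_entropy_le: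
  assumes M: "M \<in> invariant_probs"
    and H: "\<And>n. rv_entropy M (\<lambda>x. map x [0..<n]) \<le> K + real n * H"
  shows "ks_entropy M shift \<le> ereal H"
  unfolding ks_entropy_def
proof (rule SUP_least)
  interpret measure_preserving M shift using M by (rule invariant_probs_measure_preserving)
  have bp: "borel_prob M" using M by (simp add: invariant_probs_def)
  have sp: "space M = Omega" by (rule borel_prob_space[OF bp])
  fix \<xi> assume "\<xi> \<in> {\<xi>. finite \<xi> \<and> partition_on (space M) \<xi> \<and> \<xi> \<subseteq> sets M}"
  then have \<xi>: "finite \<xi>" "partition_on (space M) \<xi>" "\<xi> \<subseteq> sets M" by auto
  define X where "X x = {A \<in> \<xi>. x \<in> A}" for x
  have X: "simple_function M X"
  proof -
    have X_ran: "X ` space M \<subseteq> Pow \<xi>" by (auto simp: X_def)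
    have "X -` {S} \<inter> space M \<in> events" for S
    proof (cases "X -` {S} \<inter> space M = {}")
      case False
      then have "X -` {S} \<inter> space M \<in> fibers M X" by (auto simp: fibers_def)
      then show ?thesis using \<xi>(3) fibers_label[OF \<xi>(2)] by (auto simp: X_def[abs_def])
    qed simp
    then show ?thesis
      using finite_subset[OF X_ran] \<xi>(1) by (simp add: simple_function_def)
  qed
  have "entropy_wrt M shift \<xi> \<le> H"
  proof (rule field_le_epsilon)
    fix e :: real assume e: "e > 0"
    \<comment> \<open>The correction \<open>E\<close> below takes values in this finite set, whatever the quality of the approximation.\<close>
    define c where "c = real (2 * card (insert None (Some ` Pow \<xi>)))"
    have "\<exists>d>0. d + c * sqrt d \<le> e"
    proof -
      have "((\<lambda>d. d + c * sqrt d) \<longlongrightarrow> 0 + c * sqrt 0) (at_right 0)"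
        by (intro tendsto_intros)
      then have "eventually (\<lambda>d. d + c * sqrt d < e) (at_right 0)"
        using e by (intro order_tendstoD(2)) auto
      then have "eventually (\<lambda>d. d > 0 \<and> d + c * sqrt d < e) (at_right 0)"
        using eventually_at_right_less by (rule eventually_elim2) auto
      from eventually_happens'[OF _ this] show ?thesis by (auto intro: less_imp_le)
    qed
    then obtain d where d: "d > 0" "d + c * sqrt d \<le> e" by blast
    \<comment> \<open>The error is shared among the cells; adding one to the count keeps it positive.\<close>
    define d' where "d' = d / (real (card \<xi>) + 1)"
    have d': "d' > 0" using d by (simp add: d'_def add_nonneg_pos)
    have "\<exists>n B. prefix_set n B \<and> prob ((A - B) \<union> (B - A)) < d'" if "A \<in> \<xi>" for A
      using approximation_by_prefix_set[OF bp _ d', of A] that \<xi>(3) by blast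
    then obtain lev B where B: "\<And>A. A \<in> \<xi> \<Longrightarrow> prefix_set (lev A) (B A)"
      "\<And>A. A \<in> \<xi> \<Longrightarrow> prob ((A - B A) \<union> (B A - A)) < d'" by metis
    define m where "m = (\<Sum>A\<in>\<xi>. lev A)"
    have Bm: "prefix_set m (B A)" if "A \<in> \<xi>" for A
      by (rule prefix_set_mono[OF B(1)[OF that]]) (use \<xi>(1) that in \<open>simp add: m_def member_le_sum\<close>)
    define Y where "Y x = {A \<in> \<xi>. x \<in> B A}" for x
    define E where "E x = (if X x = Y x then None else Some (X x))" for x
    have Y_det: "Y x = Y y" if "x \<in> Omega" "y \<in> Omega" "\<forall>i<m. x i = y i" for x y
    proof -
      have "x \<in> B A \<longleftrightarrow> y \<in> B A" if "A \<in> \<xi>" for A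
        using Bm[OF that] \<open>x \<in> Omega\<close> \<open>y \<in> Omega\<close> \<open>\<forall>i<m. x i = y i\<close> unfolding prefix_set_def by metis
      then show ?thesis by (auto simp: Y_def)
    qed
    have Y: "simple_function M Y" by (rule simple_function_prefix_determined[OF bp Y_det])
    have E: "simple_function M E"
      using simple_function_compose1[OF simple_function_Pair[OF X Y], of "\<lambda>(a, b). if a = b then None else Some a"]
      by (simp add: E_def[abs_def])
    have HE: "rv_entropy M E \<le> e"
    proof -
      have "prob {x \<in> space M. E x \<noteq> None} \<le> prob (\<Union>A\<in>\<xi>. (A - B A) \<union> (B A - A))"
        using \<xi>(1,3) sets_prefix_set[OF Bm] borel_prob_sets[OF bp]
        by (intro finite_measure_mono sets.finite_UN) (auto simp: E_def X_def Y_def)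
      also have "\<dots> \<le> (\<Sum>A\<in>\<xi>. prob ((A - B A) \<union> (B A - A)))"
        using \<xi>(1,3) sets_prefix_set[OF Bm] borel_prob_sets[OF bp]
        by (intro finite_measure_subadditive_finite) auto
      also have "\<dots> \<le> (\<Sum>A\<in>\<xi>. d')" using B(2) by (intro sum_mono less_imp_le)
      also have "\<dots> \<le> d" using d(1) by (simp add: d'_def field_simps)
      finally have le: "prob {x \<in> space M. E x \<noteq> None} \<le> d" .
      have "rv_entropy M E \<le> d + 2 * card (insert None (Some ` Pow \<xi>)) * sqrt d"
        using \<xi>(1) by (intro rv_entropy_le_if_almost_constant[OF E _ _ le]) (auto simp: E_def X_def)
      then show ?thesis using d(2) by (simp add: c_def)
    qed
    let ?P = "\<lambda>n x :: nat \<Rightarrow> nat. map x [0..<n]"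
    have main: "rv_entropy M (trajectory shift X n) \<le> K + real (n + m) * H + real n * e" for n
    proof -
      have "rv_entropy M (trajectory shift X n) \<le> rv_entropy M (\<lambda>x. (trajectory shift Y n x, trajectory shift E n x))"
      proof (rule rv_entropy_le_if_determined)
        show "simple_function M (\<lambda>x. (trajectory shift Y n x, trajectory shift E n x))"
          by (intro simple_function_Pair simple_function_trajectory Y E)
        fix x y
        assume "(trajectory shift Y n x, trajectory shift E n x) = (trajectory shift Y n y, trajectory shift E n y)"
        then show "trajectory shift X n x = trajectory shift X n y"
          by (auto simp: trajectory_eq_iff E_def split: if_splits)
      qed
      also have "\<dots> \<le> rv_entropy M (trajectory shift Y n) + rv_entropy M (trajectory shift E n)"
        by (intro rv_entropy_pair_le simple_function_trajectory Y E)
      also have "rv_entropy M (trajectory shift E n) \<le> real n * rv_entropy M E"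
        by (rule rv_entropy_trajectory_le[OF E])
      also have "\<dots> \<le> real n * e" using HE by (intro mult_left_mono) auto
      also have "rv_entropy M (trajectory shift Y n) \<le> rv_entropy M (?P (n + m))"
      proof (rule rv_entropy_le_if_determined)
        show "simple_function M (?P (n + m))"
          by (rule simple_function_prefix_determined[OF bp, of "n + m"]) auto
        fix x y assume xy: "x \<in> space M" "y \<in> space M" "?P (n + m) x = ?P (n + m) y"
        have "Y ((shift ^^ i) x) = Y ((shift ^^ i) y)" if "i < n" for i
          using xy that funpow_space by (intro Y_det) (auto simp: sp shift_funpow)
        then show "trajectory shift Y n x = trajectory shift Y n y" by (simp add: trajectory_eq_iff)
      qed
      also have "\<dots> \<le> K + real (n + m) * H" by (rule H)
      finally show ?thesis by simp
    qed
    have lim: "(\<lambda>n. rv_entropy M (trajectory shift X n) / real n) \<longlonglongrightarrow> entropy_wrt M shift \<xi>"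
      using entropy_wrt_limit[OF X] fibers_label[OF \<xi>(2)] by (simp add: X_def[abs_def])
    have lim2: "(\<lambda>n. (K + real m * H) * inverse (real n) + (H + e)) \<longlonglongrightarrow> (K + real m * H) * 0 + (H + e)"
      by (intro tendsto_intros lim_inverse_n)
    have "entropy_wrt M shift \<xi> \<le> (K + real m * H) * 0 + (H + e)"
    proof (rule LIMSEQ_le[OF lim lim2], intro exI[of _ 1] allI impI)
      fix n :: nat assume "n \<ge> 1"
      then show "rv_entropy M (trajectory shift X n) / real n \<le> (K + real m * H) * inverse (real n) + (H + e)"
        using main[of n] by (simp add: field_simps)
    qed
    then show "entropy_wrt M shift \<xi> \<le> H + e" by simp
  qed
  then show "ereal (entropy_wrt M shift \<xi>) \<le> ereal H" by simp
qed

section \<open>Continuous functions and invariant measures\<close>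

lemma continuous_on_prefix_determined:
  fixes \<phi> :: "(nat \<Rightarrow> nat) \<Rightarrow> real"
  assumes "\<And>x y. x \<in> Omega \<Longrightarrow> y \<in> Omega \<Longrightarrow> \<forall>i<n. x i = y i \<Longrightarrow> \<phi> x = \<phi> y"
  shows "continuous_on Omega \<phi>"
  unfolding continuous_on_topological
proof (intro ballI allI impI)
  fix x B assume x: "x \<in> Omega" "\<phi> x \<in> B"
  show "\<exists>A. open A \<and> x \<in> A \<and> (\<forall>y\<in>Omega. y \<in> A \<longrightarrow> \<phi> y \<in> B)"
  proof (intro exI conjI ballI impI)
    show "open {y :: nat \<Rightarrow> nat. \<forall>i<n. y i = x i}" by (rule open_prefix)
    fix y assume y: "y \<in> Omega" "y \<in> {y. \<forall>i<n. y i = x i}"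
    then have "\<phi> y = \<phi> x" by (intro assms x) auto
    then show "\<phi> y \<in> B" using x by simp
  qed simp
qed

lemma continuous_on_indicator_cylinder: "continuous_on Omega (indicator (cylinder w) :: _ \<Rightarrow> real)"
  by (rule continuous_on_prefix_determined[of "length w"]) (auto simp: indicator_def cylinder_def)

lemma continuous_on_case_nat: "continuous_on S (case_nat j :: (nat \<Rightarrow> nat) \<Rightarrow> nat \<Rightarrow> nat)"
proof (rule continuous_on_coordinatewise_then_product)
  fix i show "continuous_on S (\<lambda>x. case_nat j x i)"
    by (cases i) (auto intro: continuous_on_product_then_coordinatewise continuous_on_id)
qed

lemma continuous_on_compose_case_nat:
  fixes \<phi> :: "(nat \<Rightarrow> nat) \<Rightarrow> real"
  assumes "continuous_on Omega \<phi>" "j \<in> letters"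
  shows "continuous_on Omega (\<lambda>x. \<phi> (case_nat j x))"
  by (rule continuous_on_compose2[OF assms(1) continuous_on_case_nat]) (use assms(2) case_nat_in_Omega in auto)

lemma continuous_on_shift: "continuous_on S shift"
  unfolding shift_def
  by (intro continuous_on_coordinatewise_then_product continuous_on_subset[OF continuous_on_product_coordinates]) auto

lemma continuous_on_compose_shift:
  fixes \<phi> :: "(nat \<Rightarrow> nat) \<Rightarrow> real"
  assumes "continuous_on Omega \<phi>"
  shows "continuous_on Omega (\<lambda>x. \<phi> (shift x))"
  by (rule continuous_on_compose2[OF assms continuous_on_shift]) (use shift_in_Omega in auto)

lemma preimages_shift:
  assumes "x \<in> Omega"
  shows "{y \<in> Omega. shift y = x} = (\<lambda>j. case_nat j x) ` letters"
proof (intro equalityI subsetI)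
  fix y assume y: "y \<in> {y \<in> Omega. shift y = x}"
  have "y i = case_nat (y 0) x i" for i using y by (cases i) (auto simp: shift_def)
  then have "y = case_nat (y 0) x" by blast
  moreover have "y 0 \<in> letters" using y by (auto simp: Omega_def)
  ultimately show "y \<in> (\<lambda>j. case_nat j x) ` letters" by blast
qed (use assms in \<open>auto intro!: case_nat_in_Omega\<close>)

lemma sum_preimages_shift:
  assumes "x \<in> Omega"
  shows "(\<Sum>y\<in>{y \<in> Omega. shift y = x}. F y) = (\<Sum>j\<in>letters. F (case_nat j x))"
proof -
  have "inj_on (\<lambda>j. case_nat j x) letters"
    by (rule inj_onI) (metis nat.case(1))
  then show ?thesis
    unfolding preimages_shift[OF assms] by (simp only: sum.reindex comp_def)
qed

lemma indicator_cylinder_case_nat: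
  assumes "x \<in> Omega" "j \<in> letters"
  shows "indicator (cylinder (i # w)) (case_nat j x) = (if i = j then indicator (cylinder w) x else 0 :: real)"
proof -
  have "case_nat j x \<in> cylinder (i # w) \<longleftrightarrow> i = j \<and> x \<in> cylinder w"
    using assms case_nat_in_Omega[of j x] by (auto simp: cylinder_def All_less_Suc2)
  then show ?thesis by (simp add: indicator_def)
qed

lemma measure_cylinder_eq_integral:
  assumes "borel_prob M"
  shows "measure M (cylinder w) = (\<integral>x. indicator (cylinder w) x \<partial>M)"
  using measurable_cylinder[OF assms, of w] sets.sets_into_space by (simp add: Int_absorb2)

text \<open>
  Prepending a letter in all possible ways gives the preimage of a cylinder under the shift.
\<close>

lemma invariant_probsI:
  assumes M: "borel_prob M"
    and inv: "\<And>w. set w \<subseteq> letters \<Longrightarrow> measure M (cylinder w) = (\<Sum>j\<in>letters. measure M (cylinder (j # w)))"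
  shows "M \<in> invariant_probs"
proof -
  interpret prob_space M using M by (rule borel_prob_prob_space)
  have sp: "space M = Omega" by (rule borel_prob_space[OF M])
  have N: "borel_prob (distr M M shift)"
    using M prob_space_distr[OF shift_measurable[OF M]] by (simp add: borel_prob_def)
  have "distr M M shift = M"
  proof (rule borel_prob_eqI[OF N M, of 0])
    fix w :: "nat list" assume w: "set w \<subseteq> letters"
    have "shift -` cylinder w \<inter> space M = cylinder (1 # w) \<union> cylinder (2 # w)"
      by (auto simp: sp cylinder_def shift_def All_less_Suc2 Omega_def)
    moreover have "cylinder (1 # w) \<inter> cylinder (2 # w) = {}" by (force simp: cylinder_def)
    ultimately show "measure (distr M M shift) (cylinder w) = measure M (cylinder w)"
      using measurable_cylinder[OF M] inv[OF w]
      by (simp add: measure_distr[OF shift_measurable[OF M]] finite_measure_Union)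
  qed
  with M show ?thesis by (simp add: invariant_probs_def)
qed

lemma rv_entropy_prefix:
  assumes M: "borel_prob M"
  shows "rv_entropy M (\<lambda>x. map x [0..<n]) =
    - (\<Sum>w\<in>words letters n. measure M (cylinder w) * ln (measure M (cylinder w)))"
proof -
  have sp: "space M = Omega" by (rule borel_prob_space[OF M])
  have "(\<lambda>x. map x [0..<n]) -` {w} \<inter> space M = cylinder w" if "w \<in> words letters n" for w
    using that by (auto simp: sp in_cylinder_iff words_def)
  then show ?thesis
    using prefix_in_words by (subst rv_entropy_superset[of "words letters n"]) (auto simp: sp finite_words cong: sum.cong)
qed

section \<open>Normalised potentials have pressure at least zero\<close>

text \<open>
  The graph of \<open>x ln x\<close> lies above its tangent at \<open>a\<close>, evaluated at \<open>x = exp s\<close>. Integrating this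
  inequality gives the instance of Jensen's inequality that is applied below.
\<close>

lemma neg_entropy_tangent:
  fixes a s :: real
  assumes "a > 0"
  shows "exp s * s \<ge> exp s * ln a + exp s - a"
proof -
  have "ln (a / exp s) \<le> a / exp s - 1" using assms by (intro ln_le_minus_one) simp
  then have "exp s * (ln a - s) \<le> exp s * (a / exp s - 1)"
    using assms by (intro mult_left_mono) (auto simp: ln_div)
  then show ?thesis by (simp add: algebra_simps)
qed

locale normalised_potential =
  fixes f :: "(nat \<Rightarrow> nat) \<Rightarrow> real"
  assumes cont: "continuous_on Omega f"
    and normalised: "\<And>x. x \<in> Omega \<Longrightarrow> (\<Sum>j\<in>letters. exp (f (case_nat j x))) = 1"
begin

text \<open>
  The Ruelle transfer operator of \<open>f\<close>. For a normalised potential it is the Markov operator that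
  averages over the two preimages of a point.
\<close>

definition transfer :: "((nat \<Rightarrow> nat) \<Rightarrow> real) \<Rightarrow> (nat \<Rightarrow> nat) \<Rightarrow> real" where
  "transfer \<phi> x = (\<Sum>j\<in>letters. exp (f (case_nat j x)) * \<phi> (case_nat j x))"

definition birkhoff :: "nat \<Rightarrow> (nat \<Rightarrow> nat) \<Rightarrow> real" where
  "birkhoff n x = (\<Sum>i<n. f ((shift ^^ i) x))"

lemma birkhoff_Suc: "birkhoff (Suc n) x = f x + birkhoff n (shift x)"
  unfolding birkhoff_def sum.lessThan_Suc_shift by (simp add: funpow_Suc_right del: funpow.simps)

lemma transfer_iterate:
  "(transfer ^^ n) \<phi> x = (\<Sum>w\<in>words letters n. exp (birkhoff n (prepend w x)) * \<phi> (prepend w x))"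
proof (induction n arbitrary: \<phi>)
  case 0
  then show ?case by (simp add: birkhoff_def)
next
  case (Suc n)
  have "(transfer ^^ Suc n) \<phi> x = (transfer ^^ n) (transfer \<phi>) x"
    by (simp add: funpow_Suc_right del: funpow.simps)
  also have "\<dots> = (\<Sum>w\<in>words letters n. \<Sum>j\<in>letters.
      exp (birkhoff (Suc n) (prepend (j # w) x)) * \<phi> (prepend (j # w) x))"
    unfolding Suc transfer_def by (simp add: birkhoff_Suc exp_add sum_distrib_left algebra_simps)
  also have "\<dots> = (\<Sum>w\<in>words letters (Suc n). exp (birkhoff (Suc n) (prepend w x)) * \<phi> (prepend w x))"
    unfolding sum_words_Suc by (rule sum.swap)
  finally show ?case .
qed

lemma transfer_iterate_one: "x \<in> Omega \<Longrightarrow> (transfer ^^ n) (\<lambda>_. 1) x = 1"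
proof (induction n arbitrary: x)
  case (Suc n)
  have "(transfer ^^ Suc n) (\<lambda>_. 1) x = (\<Sum>j\<in>letters. exp (f (case_nat j x)) * (transfer ^^ n) (\<lambda>_. 1) (case_nat j x))"
    by (simp add: transfer_def)
  also have "\<dots> = (\<Sum>j\<in>letters. exp (f (case_nat j x)))"
    using Suc.prems by (intro sum.cong refl) (simp add: Suc.IH case_nat_in_Omega)
  finally show ?case using normalised[OF Suc.prems] by simp
qed simp

lemma transfer_iterate_bound:
  assumes x: "x \<in> Omega" and B: "\<And>y. y \<in> Omega \<Longrightarrow> \<bar>\<phi> y\<bar> \<le> B"
  shows "\<bar>(transfer ^^ n) \<phi> x\<bar> \<le> B"
proof -
  have "\<bar>(transfer ^^ n) \<phi> x\<bar> \<le> (\<Sum>w\<in>words letters n. exp (birkhoff n (prepend w x)) * B)"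
    unfolding transfer_iterate
  proof (intro order_trans[OF sum_abs] sum_mono)
    fix w assume "w \<in> words letters n"
    then have "prepend w x \<in> Omega" using x by (intro prepend_in_Omega) (simp_all add: words_def)
    then show "\<bar>exp (birkhoff n (prepend w x)) * \<phi> (prepend w x)\<bar> \<le> exp (birkhoff n (prepend w x)) * B"
      by (simp add: abs_mult B)
  qed
  also have "\<dots> = B * (transfer ^^ n) (\<lambda>_. 1) x"
    unfolding transfer_iterate by (simp add: sum_distrib_left mult.commute)
  finally show ?thesis by (simp add: transfer_iterate_one x)
qed

lemma transfer_iterate_diff: "(transfer ^^ n) (\<lambda>x. \<phi> x - \<psi> x) x = (transfer ^^ n) \<phi> x - (transfer ^^ n) \<psi> x"
  unfolding transfer_iterate by (simp add: right_diff_distrib sum_subtractf)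

lemma transfer_iterate_sum:
  "(transfer ^^ n) (\<lambda>x. \<Sum>v\<in>V. c v * \<phi> v x) x = (\<Sum>v\<in>V. c v * (transfer ^^ n) (\<phi> v) x)"
  unfolding transfer_iterate sum_distrib_left
  by (subst sum.swap) (simp add: mult_ac)

lemma continuous_on_transfer:
  assumes "continuous_on Omega \<phi>"
  shows "continuous_on Omega (transfer \<phi>)"
  unfolding transfer_def[abs_def]
  by (intro continuous_on_sum continuous_on_mult continuous_on_exp
      continuous_on_compose_case_nat[OF cont] continuous_on_compose_case_nat[OF assms])

text \<open>
  The Cesaro mean, over the times up to \<open>N\<close>, of the Markov chain of random preimages started at the
  constant sequence.
\<close>

definition average :: "nat \<Rightarrow> ((nat \<Rightarrow> nat) \<Rightarrow> real) \<Rightarrow> real" where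
  "average N \<phi> = (\<Sum>n\<le>N. (transfer ^^ n) \<phi> (\<lambda>_. 1)) / real (Suc N)"

lemma one_in_Omega: "(\<lambda>_. 1) \<in> Omega"
  by (simp add: Omega_def)

lemma average_bound:
  assumes "\<And>y. y \<in> Omega \<Longrightarrow> \<bar>\<phi> y\<bar> \<le> B"
  shows "\<bar>average N \<phi>\<bar> \<le> B"
proof -
  have "\<bar>\<Sum>n\<le>N. (transfer ^^ n) \<phi> (\<lambda>_. 1)\<bar> \<le> (\<Sum>n\<le>N. B)"
    by (intro order_trans[OF sum_abs] sum_mono transfer_iterate_bound one_in_Omega assms)
  then show ?thesis by (simp add: average_def abs_divide field_simps)
qed

lemma average_diff: "average N (\<lambda>x. \<phi> x - \<psi> x) = average N \<phi> - average N \<psi>"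
  unfolding average_def transfer_iterate_diff by (simp add: sum_subtractf diff_divide_distrib)

lemma average_sum: "average N (\<lambda>x. \<Sum>v\<in>V. c v * \<phi> v x) = (\<Sum>v\<in>V. c v * average N (\<phi> v))"
  unfolding average_def transfer_iterate_sum
  by (subst sum.swap) (simp add: sum_distrib_left sum_divide_distrib)

text \<open>
  The two sums differ only in their first and last terms.
\<close>

lemma average_transfer:
  assumes "\<And>y. y \<in> Omega \<Longrightarrow> \<bar>\<phi> y\<bar> \<le> B"
  shows "\<bar>average N (transfer \<phi>) - average N \<phi>\<bar> \<le> 2 * B / real (Suc N)"
proof -
  let ?a = "\<lambda>n. (transfer ^^ n) \<phi> (\<lambda>_. 1)"
  have "(\<Sum>n\<le>N. (transfer ^^ n) (transfer \<phi>) (\<lambda>_. 1)) - (\<Sum>n\<le>N. ?a n) = (\<Sum>n\<le>N. ?a (Suc n) - ?a n)"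
    by (simp only: sum_subtractf[symmetric] funpow_swap1 funpow.simps comp_apply)
  also have "\<dots> = ?a (Suc N) - ?a 0"
    by (induction N) simp_all
  finally have "average N (transfer \<phi>) - average N \<phi> = (?a (Suc N) - ?a 0) / real (Suc N)"
    unfolding average_def by (simp only: diff_divide_distrib[symmetric])
  moreover have "\<bar>?a (Suc N) - ?a 0\<bar> \<le> 2 * B"
    using transfer_iterate_bound[where \<phi> = \<phi> and n = "Suc N", OF one_in_Omega assms] transfer_iterate_bound[where \<phi> = \<phi> and n = 0, OF one_in_Omega assms]
    by linarith
  ultimately show ?thesis
    by (simp only: abs_divide) (simp add: divide_right_mono)
qed

lemma average_cong: "(\<And>x. x \<in> Omega \<Longrightarrow> \<phi> x = \<psi> x) \<Longrightarrow> average N \<phi> = average N \<psi>"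
  using average_bound[of "\<lambda>x. \<phi> x - \<psi> x" 0 N] by (simp add: average_diff)

lemma average_nonneg:
  assumes "\<And>x. x \<in> Omega \<Longrightarrow> \<phi> x \<ge> 0"
  shows "average N \<phi> \<ge> 0"
  unfolding average_def transfer_iterate
  using assms one_in_Omega by (intro divide_nonneg_nonneg sum_nonneg mult_nonneg_nonneg) (auto simp: words_def prepend_in_Omega)

text \<open>
  The Krylov--Bogoliubov argument. The Cesaro means assign to each of the countably many words a number
  in \<open>[0, 1]\<close>, so along a subsequence all these numbers converge. The limits are consistent weights and
  therefore define a measure; continuous functions are uniform limits of cylinder functions, so their
  means converge to their integrals, and the limit is invariant because one more step of the chain
  changes the mean by order \<open>1 / N\<close>.
\<close>

lemma exists_transfer_invariant:
  "\<exists>M. borel_prob M \<and> (\<forall>\<phi>. continuous_on Omega \<phi> \<longrightarrow> (\<integral>x. transfer \<phi> x \<partial>M) = (\<integral>x. \<phi> x \<partial>M))"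
proof -
  define a where "a N w = average N (indicator (cylinder w))" for N and w :: "nat list"
  have a_range: "a N w \<in> {0..1}" for N w
    using average_bound[of "indicator (cylinder w)" 1 N] average_nonneg[of "indicator (cylinder w)" N]
    by (auto simp: a_def)
  have "compact (\<Pi>\<^sub>E w\<in>(UNIV :: nat list set). {0..1::real})"
    unfolding compactin_euclidean_iff[symmetric] euclidean_product_topology[symmetric] compactin_PiE
    by simp
  then have "seq_compact (\<Pi>\<^sub>E w\<in>(UNIV :: nat list set). {0..1::real})"
    by (rule compact_imp_seq_compact)
  moreover have "\<forall>N. a N \<in> (\<Pi>\<^sub>E w\<in>(UNIV :: nat list set). {0..1::real})"
    using a_range by (auto simp: PiE_iff)
  ultimately obtain l r where r: "strict_mono r" "(a \<circ> r) \<longlonglongrightarrow> l"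
    unfolding seq_compact_def by metis
  have lim: "(\<lambda>N. a (r N) w) \<longlonglongrightarrow> l w" for w
    using continuous_on_tendsto_compose[OF continuous_on_product_coordinates[of w] r(2)] by simp
  have l_nonneg: "l w \<ge> 0" for w
    using a_range by (intro LIMSEQ_le_const[OF lim]) auto
  have l_total: "l [] = 1"
  proof -
    have "a N [] = 1" for N
      unfolding a_def average_def using transfer_iterate_one[OF one_in_Omega]
      by (subst average_cong[of _ "\<lambda>_. 1", unfolded average_def]) auto
    then show ?thesis using lim[of "[]"] by (simp add: LIMSEQ_const_iff)
  qed
  have l_split: "l w = l (w @ [1]) + l (w @ [2])" for w
  proof -
    have "a N w = a N (w @ [1]) + a N (w @ [2])" for N
    proof -
      have "a N w = average N (\<lambda>x. \<Sum>j\<in>letters. 1 * indicator (cylinder (w @ [j])) x)"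
        unfolding a_def
      proof (rule average_cong)
        fix x assume x: "x \<in> Omega"
        then have "x (length w) \<in> letters" by (auto simp: Omega_def)
        moreover have "x \<in> cylinder (w @ [j]) \<longleftrightarrow> x \<in> cylinder w \<and> x (length w) = j" for j
          by (auto simp: cylinder_def nth_append less_Suc_eq)
        ultimately show "indicator (cylinder w) x = (\<Sum>j\<in>letters. 1 * indicator (cylinder (w @ [j])) x :: real)"
          by (auto simp: indicator_def)
      qed
      then show ?thesis by (simp only: average_sum) (simp add: a_def)
    qed
    then have "(\<lambda>N. a (r N) w) \<longlonglongrightarrow> l (w @ [1]) + l (w @ [2])"
      using tendsto_add[OF lim[of "w @ [1]"] lim[of "w @ [2]"]] by simp
    then show ?thesis using lim LIMSEQ_unique by blast
  qed
  obtain M where M: "borel_prob M" "\<And>w. set w \<subseteq> letters \<Longrightarrow> measure M (cylinder w) = l w"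
    using cylinder_extension[of l] l_nonneg l_total l_split by blast
  have conv: "(\<lambda>N. average (r N) \<phi>) \<longlonglongrightarrow> (\<integral>x. \<phi> x \<partial>M)" if \<phi>: "continuous_on Omega \<phi>" for \<phi>
  proof (rule LIMSEQ_I)
    fix e :: real assume e: "e > 0"
    obtain k where k: "\<And>x. x \<in> Omega \<Longrightarrow>
        \<bar>(\<Sum>w\<in>words letters k. \<phi> (prepend w (\<lambda>_. 1)) * indicator (cylinder w) x) - \<phi> x\<bar> < e / 3"
      using step_function_approximation[OF \<phi> one_in_Omega, of "e / 3"] e by auto
    let ?s = "\<lambda>x. \<Sum>w\<in>words letters k. \<phi> (prepend w (\<lambda>_. 1)) * indicator (cylinder w) x"
    have 1: "\<bar>(\<integral>x. ?s x \<partial>M) - (\<integral>x. \<phi> x \<partial>M)\<bar> \<le> e / 3"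
      by (rule integral_diff_le[OF M(1) integrable_step_function[OF M(1)] integrable_continuous_Omega[OF M(1) \<phi>] less_imp_le[OF k]])
    have 2: "\<bar>average N ?s - average N \<phi>\<bar> \<le> e / 3" for N
      unfolding average_diff[symmetric] by (rule average_bound[OF less_imp_le[OF k]])
    have lim_s: "(\<lambda>N. average (r N) ?s) \<longlonglongrightarrow> (\<integral>x. ?s x \<partial>M)"
    proof -
      have "(\<lambda>N. \<Sum>w\<in>words letters k. \<phi> (prepend w (\<lambda>_. 1)) * a (r N) w) \<longlonglongrightarrow>
          (\<Sum>w\<in>words letters k. \<phi> (prepend w (\<lambda>_. 1)) * l w)"
        by (intro tendsto_intros lim)
      moreover have "(\<integral>x. ?s x \<partial>M) = (\<Sum>w\<in>words letters k. \<phi> (prepend w (\<lambda>_. 1)) * l w)"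
        unfolding integral_cylinder_sum[OF M(1), where g = "\<lambda>w. \<phi> (prepend w (\<lambda>_. 1))"]
        by (intro sum.cong refl) (simp add: M(2) words_def)
      ultimately show ?thesis by (simp only: average_sum a_def)
    qed
    obtain N0 where N0: "\<forall>N\<ge>N0. norm (average (r N) ?s - (\<integral>x. ?s x \<partial>M)) < e / 3"
      using LIMSEQ_D[OF lim_s, of "e / 3"] e by auto
    have "norm (average (r N) \<phi> - (\<integral>x. \<phi> x \<partial>M)) < e" if "N \<ge> N0" for N
      using N0[rule_format, OF that] 1 2[of "r N"] unfolding real_norm_def by linarith
    then show "\<exists>no. \<forall>N\<ge>no. norm (average (r N) \<phi> - (\<integral>x. \<phi> x \<partial>M)) < e" by blast
  qed
  have "(\<integral>x. transfer \<phi> x \<partial>M) = (\<integral>x. \<phi> x \<partial>M)" if \<phi>: "continuous_on Omega \<phi>" for \<phi>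
  proof -
    obtain B where B: "\<And>x. x \<in> Omega \<Longrightarrow> \<bar>\<phi> x\<bar> \<le> B"
      using compact_continuous_image[OF \<phi> compact_Omega, THEN compact_imp_bounded] by (auto simp: bounded_iff)
    have "(\<lambda>N. 2 * B * inverse (real (Suc N))) \<longlonglongrightarrow> 2 * B * 0"
      by (intro tendsto_intros LIMSEQ_inverse_real_of_nat)
    then have "(\<lambda>N. 2 * B / real (Suc (r N))) \<longlonglongrightarrow> 0"
      using LIMSEQ_subseq_LIMSEQ[OF _ r(1)] by (fastforce simp: divide_inverse comp_def)
    then have "(\<lambda>N. average (r N) (transfer \<phi>) - average (r N) \<phi>) \<longlonglongrightarrow> 0"
      by (rule Lim_null_comparison[rotated])
        (intro always_eventually allI, unfold real_norm_def, rule average_transfer[OF B])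
    moreover have "(\<lambda>N. average (r N) (transfer \<phi>) - average (r N) \<phi>) \<longlonglongrightarrow> (\<integral>x. transfer \<phi> x \<partial>M) - (\<integral>x. \<phi> x \<partial>M)"
      by (intro tendsto_diff conv \<phi> continuous_on_transfer)
    ultimately show ?thesis using LIMSEQ_unique by fastforce
  qed
  with M(1) show ?thesis by blast
qed

text \<open>
  An invariant measure of the transfer operator is shift-invariant, because \<open>transfer (\<phi> \<circ> shift) = \<phi>\<close>.
  Let \<open>G w x = exp (birkhoff n (prepend w x))\<close>, the probability that the chain of preimages, started at
  \<open>x\<close>, prepends \<open>w\<close> in \<open>n\<close> steps; the cylinder of \<open>w\<close> has the mean of \<open>G w x\<close> over \<open>x\<close> as its measure. As \<open>x ln x\<close> is convex, the entropy of the first \<open>n\<close> letters is at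
  least the mean over \<open>x\<close> of the entropy of \<open>G w x\<close> as a distribution of \<open>w\<close>. Here \<open>ln (G w x)\<close> is a Birkhoff sum
  of \<open>f\<close>, so by invariance that mean is exactly \<open>- n\<close> times the integral of \<open>f\<close>.
\<close>

theorem exists_equilibrium:
  "\<exists>\<rho>\<in>invariant_probs. ks_entropy \<rho> shift \<ge> ereal (- (\<integral>x. f x \<partial>\<rho>))"
proof -
  obtain M where M: "borel_prob M"
    and inv: "\<And>\<phi>. continuous_on Omega \<phi> \<Longrightarrow> (\<integral>x. transfer \<phi> x \<partial>M) = (\<integral>x. \<phi> x \<partial>M)"
    using exists_transfer_invariant by blast
  interpret prob_space M using M by (rule borel_prob_prob_space)
  have sp: "space M = Omega" by (rule borel_prob_space[OF M])
  have invariant: "M \<in> invariant_probs"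
  proof (rule invariant_probsI[OF M])
    fix w :: "nat list"
    let ?g = "\<lambda>x. \<Sum>i\<in>letters. indicator (cylinder (i # w)) x :: real"
    have "(\<Sum>j\<in>letters. measure M (cylinder (j # w))) = (\<integral>x. ?g x \<partial>M)"
      unfolding measure_cylinder_eq_integral[OF M]
      using integrable_indicator_cylinder[OF M] by (intro Bochner_Integration.integral_sum[symmetric])
    also have "\<dots> = (\<integral>x. transfer ?g x \<partial>M)"
      by (intro inv[symmetric] continuous_on_sum continuous_on_indicator_cylinder)
    also have "\<dots> = (\<integral>x. indicator (cylinder w) x \<partial>M)"
    proof (rule Bochner_Integration.integral_cong[OF refl])
      fix x assume "x \<in> space M"
      then have x: "x \<in> Omega" by (simp add: sp)
      have "?g (case_nat j x) = indicator (cylinder w) x" if "j \<in> letters" for j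
        using that by (simp only: indicator_cylinder_case_nat[OF x that]) auto
      then have "transfer ?g x = (\<Sum>j\<in>letters. exp (f (case_nat j x)) * indicator (cylinder w) x)"
        unfolding transfer_def by (intro sum.cong refl) simp
      then show "transfer ?g x = indicator (cylinder w) x"
        by (simp only: sum_distrib_right[symmetric] normalised[OF x] mult_1)
    qed
    finally show "measure M (cylinder w) = (\<Sum>j\<in>letters. measure M (cylinder (j # w)))"
      unfolding measure_cylinder_eq_integral[OF M] ..
  qed
  have cont_shift: "continuous_on Omega (\<lambda>x. f ((shift ^^ i) x))" for i
  proof (induction i)
    case (Suc i)
    then show ?case using continuous_on_compose_shift[OF Suc]
      by (simp add: funpow_Suc_right del: funpow.simps)
  qed (simp add: cont)
  have int_shift: "(\<integral>x. \<phi> (shift x) \<partial>M) = (\<integral>x. \<phi> x \<partial>M)" if \<phi>: "continuous_on Omega \<phi>" for \<phi> :: "_ \<Rightarrow> real"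
  proof -
    have "(\<integral>x. \<phi> (shift x) \<partial>M) = (\<integral>x. transfer (\<lambda>x. \<phi> (shift x)) x \<partial>M)"
      by (intro inv[symmetric] continuous_on_compose_shift \<phi>)
    also have "\<dots> = (\<integral>x. \<phi> x \<partial>M)"
    proof (rule Bochner_Integration.integral_cong[OF refl])
      fix x assume "x \<in> space M"
      then show "transfer (\<lambda>x. \<phi> (shift x)) x = \<phi> x"
        using normalised[of x] unfolding transfer_def shift_case_nat sum_distrib_right[symmetric] by (simp add: sp)
    qed
    finally show ?thesis .
  qed
  have int_funpow: "(\<integral>x. f ((shift ^^ i) x) \<partial>M) = (\<integral>x. f x \<partial>M)" for i
  proof (induction i)
    case (Suc i)
    then show ?case using int_shift[OF cont_shift[of i]]
      by (simp add: funpow_Suc_right del: funpow.simps)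
  qed simp
  have cont_birkhoff: "continuous_on Omega (birkhoff n)" for n
    unfolding birkhoff_def[abs_def] by (intro continuous_on_sum cont_shift)
  have int_birkhoff: "(\<integral>x. birkhoff n x \<partial>M) = real n * (\<integral>x. f x \<partial>M)" for n
    unfolding birkhoff_def[abs_def]
    by (subst Bochner_Integration.integral_sum) (auto simp: int_funpow intro: integrable_continuous_Omega[OF M cont_shift])
  have cont_iter: "continuous_on Omega ((transfer ^^ n) \<phi>)" if "continuous_on Omega \<phi>" for n \<phi>
    by (induction n) (auto intro: continuous_on_transfer that)
  have int_iter: "(\<integral>x. (transfer ^^ n) \<phi> x \<partial>M) = (\<integral>x. \<phi> x \<partial>M)" if \<phi>: "continuous_on Omega \<phi>" for n \<phi>
  proof (induction n)
    case (Suc n)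
    then show ?case using inv[OF cont_iter[OF \<phi>, of n]] by simp
  qed simp
  have cont_prepend: "continuous_on Omega (\<lambda>x. \<phi> (prepend w x))" if "continuous_on Omega \<phi>" "set w \<subseteq> letters" for \<phi> :: "_ \<Rightarrow> real" and w
    using that
  proof (induction w arbitrary: \<phi>)
    case (Cons j w)
    then have "continuous_on Omega (\<lambda>x. \<phi> (case_nat j x))" by (intro continuous_on_compose_case_nat) auto
    with Cons show ?case by auto
  qed simp
  have entropy: "rv_entropy M (\<lambda>x. map x [0..<n]) \<ge> real n * (- (\<integral>x. f x \<partial>M))" for n
  proof -
    let ?S = "\<lambda>w x. birkhoff n (prepend w x)"
    have cont_S: "continuous_on Omega (?S w)" if "w \<in> words letters n" for w
      using that by (intro cont_prepend cont_birkhoff) (simp add: words_def)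
    have int1: "integrable M (\<lambda>x. exp (?S w x))" and int2: "integrable M (\<lambda>x. exp (?S w x) * ?S w x)"
      if "w \<in> words letters n" for w
      using cont_S[OF that] by (auto intro!: integrable_continuous_Omega[OF M] continuous_intros)
    have meas: "measure M (cylinder w) = (\<integral>x. exp (?S w x) \<partial>M)" if w: "w \<in> words letters n" for w
    proof -
      have "(transfer ^^ n) (indicator (cylinder w)) x = exp (?S w x)" if x: "x \<in> Omega" for x
      proof -
        have "(transfer ^^ n) (indicator (cylinder w)) x = (\<Sum>v\<in>{w}. exp (?S v x))"
          unfolding transfer_iterate
        proof (intro sum.mono_neutral_cong_right finite_words ballI)
          fix v assume v: "v \<in> words letters n - {w}"
          then have "prepend v x \<notin> cylinder w"
            using cylinder_same_length[OF prepend_in_cylinder[of v x], of w] x w by (auto simp: words_def)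
          then show "exp (?S v x) * indicator (cylinder w) (prepend v x) = 0" by simp
        qed (use w x prepend_in_cylinder in \<open>auto simp: words_def\<close>)
        then show ?thesis by simp
      qed
      then have "(\<integral>x. (transfer ^^ n) (indicator (cylinder w)) x \<partial>M) = (\<integral>x. exp (?S w x) \<partial>M)"
        by (intro Bochner_Integration.integral_cong) (auto simp: sp)
      then show ?thesis
        using int_iter[OF continuous_on_indicator_cylinder] measure_cylinder_eq_integral[OF M] by simp
    qed
    have "measure M (cylinder w) * ln (measure M (cylinder w)) \<le> (\<integral>x. exp (?S w x) * ?S w x \<partial>M)"
      if w: "w \<in> words letters n" for w
    proof -
      define a where "a = measure M (cylinder w)"
      show ?thesis
      proof (cases "a = 0")
        case True
        have "(\<integral>x. exp (?S w x) \<partial>M) > 0"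
          using int1[OF w] by (intro expectation_greater) auto
        then show ?thesis using True meas[OF w] by (simp add: a_def)
      next
        case False
        then have a: "a > 0" by (simp add: a_def zero_less_measure_iff)
        have "a * ln a = (\<integral>x. exp (?S w x) * ln a + exp (?S w x) - a \<partial>M)"
          using int1[OF w] meas[OF w] by (simp add: a_def prob_space)
        also have "\<dots> \<le> (\<integral>x. exp (?S w x) * ?S w x \<partial>M)"
          using int1[OF w] int2[OF w] neg_entropy_tangent[OF a] by (intro integral_mono) auto
        finally show ?thesis by (simp add: a_def)
      qed
    qed
    then have "(\<Sum>w\<in>words letters n. measure M (cylinder w) * ln (measure M (cylinder w)))
        \<le> (\<Sum>w\<in>words letters n. \<integral>x. exp (?S w x) * ?S w x \<partial>M)" by (rule sum_mono)
    also have "\<dots> = (\<integral>x. (transfer ^^ n) (birkhoff n) x \<partial>M)"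
      unfolding transfer_iterate using int2 by (intro Bochner_Integration.integral_sum[symmetric])
    also have "\<dots> = real n * (\<integral>x. f x \<partial>M)"
      unfolding int_iter[OF cont_birkhoff] by (rule int_birkhoff)
    finally show ?thesis unfolding rv_entropy_prefix[OF M] by simp
  qed
  show ?thesis
    using ks_entropy_ge[OF invariant entropy] invariant by blast
qed

end

section \<open>Entropy of the zero-temperature measure\<close>

lemma spin_weight_nonneg: "0 \<le> t \<Longrightarrow> t \<le> 1 \<Longrightarrow> a \<in> {1, -1} \<Longrightarrow> spin_weight t a j \<ge> 0"
  by (auto simp: spin_weight_def)

lemma spin_weight_pos: "0 \<le> t \<Longrightarrow> t < 1 \<Longrightarrow> a \<in> {1, -1} \<Longrightarrow> spin_weight t a j > 0"
  by (auto simp: spin_weight_def)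

lemma sum_spin_weight: "(\<Sum>j\<in>letters. spin_weight t a j) = 1"
  by (simp add: spin_weight_def field_simps)

lemma alt_weight_nonneg: "0 \<le> t \<Longrightarrow> t \<le> 1 \<Longrightarrow> a \<in> {1, -1} \<Longrightarrow> alt_weight t a w \<ge> 0"
  by (induction w arbitrary: a) (auto intro!: mult_nonneg_nonneg spin_weight_nonneg)

lemma alt_weight_pos: "0 \<le> t \<Longrightarrow> t < 1 \<Longrightarrow> a \<in> {1, -1} \<Longrightarrow> alt_weight t a w > 0"
  by (induction w arbitrary: a) (auto intro!: mult_pos_pos spin_weight_pos)

lemma alt_weight_snoc: "(\<Sum>j\<in>letters. alt_weight t a (w @ [j])) = alt_weight t a w"
proof (induction w arbitrary: a)
  case Nil
  then show ?case using sum_spin_weight[of t a] by simp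
next
  case (Cons i w)
  have "(\<Sum>j\<in>letters. alt_weight t a ((i # w) @ [j])) = spin_weight t a i * (\<Sum>j\<in>letters. alt_weight t (- a) (w @ [j]))"
    by (simp add: distrib_left)
  then show ?case unfolding Cons.IH by simp
qed

lemma sum_alt_weight: "(\<Sum>w\<in>words letters n. alt_weight t a w) = 1"
proof (induction n arbitrary: a)
  case (Suc n)
  have "(\<Sum>w\<in>words letters (Suc n). alt_weight t a w) =
      (\<Sum>j\<in>letters. spin_weight t a j * (\<Sum>w\<in>words letters n. alt_weight t (- a) w))"
    unfolding sum_words_Suc by (simp add: sum_distrib_left)
  then show ?case unfolding Suc.IH using sum_spin_weight[of t a] by simp
qed simp

text \<open>
  The entropy of a single outcome. Changing the sign of the spin swaps the two probabilities, so it
  is the same for both signs.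
\<close>

definition spin_entropy :: "real \<Rightarrow> real" where
  "spin_entropy t = - (\<Sum>j\<in>letters. spin_weight t 1 j * ln (spin_weight t 1 j))"

lemma spin_entropy_eq:
  "a \<in> {1, -1} \<Longrightarrow> (\<Sum>j\<in>letters. spin_weight t a j * ln (spin_weight t a j)) = - spin_entropy t"
  by (auto simp: spin_entropy_def spin_weight_def)

text \<open>
  The outcomes are independent, so their entropies add up.
\<close>

lemma alt_weight_entropy:
  assumes t: "0 \<le> t" "t \<le> 1" and a: "a \<in> {1, -1}"
  shows "(\<Sum>w\<in>words letters n. alt_weight t a w * ln (alt_weight t a w)) = - real n * spin_entropy t"
  using a
proof (induction n arbitrary: a)
  case (Suc n)
  have prod_ln: "s * A * ln (s * A) = A * (s * ln s) + s * (A * ln A)" if "s \<ge> 0" "A \<ge> 0" for s A :: real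
    using that by (cases "s = 0 \<or> A = 0") (auto simp: ln_mult algebra_simps)
  have a': "- a \<in> {1, -1}" using Suc.prems by auto
  have "(\<Sum>w\<in>words letters (Suc n). alt_weight t a w * ln (alt_weight t a w)) =
    (\<Sum>j\<in>letters. \<Sum>w\<in>words letters n. alt_weight t (- a) w * (spin_weight t a j * ln (spin_weight t a j)) +
        spin_weight t a j * (alt_weight t (- a) w * ln (alt_weight t (- a) w)))"
    unfolding sum_words_Suc alt_weight.simps
    using t Suc.prems a' by (intro sum.cong refl prod_ln spin_weight_nonneg alt_weight_nonneg)
  also have "\<dots> = (\<Sum>j\<in>letters. spin_weight t a j * ln (spin_weight t a j) + spin_weight t a j * (- real n * spin_entropy t))"
    by (simp only: sum.distrib sum_distrib_right[symmetric] sum_distrib_left[symmetric] sum_alt_weight Suc.IH[OF a'] mult_1)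
  also have "\<dots> = - real (Suc n) * spin_entropy t"
    unfolding sum.distrib sum_distrib_right[symmetric] sum_spin_weight spin_entropy_eq[OF Suc.prems]
    by (simp add: algebra_simps)
  finally show ?case .
qed simp

lemma exists_alt_measure:
  assumes t: "0 \<le> t" "t \<le> 1" and a: "a \<in> {1, -1}"
  shows "\<exists>M. borel_prob M \<and> (\<forall>w. set w \<subseteq> letters \<longrightarrow> measure M (cylinder w) = alt_weight t a w)"
proof (rule cylinder_extension)
  show "alt_weight t a w = alt_weight t a (w @ [1]) + alt_weight t a (w @ [2])" for w
    using alt_weight_snoc[of t a w] by simp
qed (simp_all add: alt_weight_nonneg[OF t a])

text \<open>
  The weights are consistent and so extend to a measure; it is the only one with the prescribed
  values because cylinders of length at least two determine a measure.
\<close>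

lemma mu_cylinder:
  fixes \<theta> :: real
  defines "t \<equiv> sin (2 * \<theta>)"
  assumes t: "0 \<le> t"
  shows "borel_prob (mu \<theta>)"
    and "set w \<subseteq> letters \<Longrightarrow> measure (mu \<theta>) (cylinder w) = (alt_weight t 1 w + alt_weight t (-1) w) / 2"
proof -
  have t1: "t \<le> 1" by (simp add: t_def)
  let ?P = "\<lambda>M. borel_prob M \<and> (\<forall>js. length js \<ge> 2 \<and> set js \<subseteq> {1, 2} \<longrightarrow>
        complex_of_real (measure M (cylinder js)) = mu_infty \<theta> js)"
  let ?a = "\<lambda>w. (alt_weight t 1 w + alt_weight t (-1) w) / 2"
  have "\<exists>M. borel_prob M \<and> (\<forall>w. set w \<subseteq> letters \<longrightarrow> measure M (cylinder w) = ?a w)"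
  proof (rule cylinder_extension)
    show "?a w = ?a (w @ [1]) + ?a (w @ [2])" for w
      using alt_weight_snoc[of t 1 w] alt_weight_snoc[of t "-1" w] by (simp add: field_simps)
    show "?a w \<ge> 0" for w
      using alt_weight_nonneg[OF t t1, of 1 w] alt_weight_nonneg[OF t t1, of "-1" w] by simp
  qed simp
  then obtain M where M: "borel_prob M" "\<And>w. set w \<subseteq> letters \<Longrightarrow> measure M (cylinder w) = ?a w" by blast
  have inf: "mu_infty \<theta> js = complex_of_real (?a js)" if "length js \<ge> 2" for js
    unfolding t_def using that by (intro mu_infty_eq) auto
  have PM: "?P M"
    using M inf by (metis (no_types, lifting))
  have "mu \<theta> = M"
    unfolding mu_def
  proof (rule the_equality)
    show "?P M" by (rule PM)
    fix N assume N: "?P N"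
    show "N = M"
    proof (rule borel_prob_eqI[of N M 2])
      fix w :: "nat list" assume "set w \<subseteq> letters" "length w \<ge> 2"
      then have "complex_of_real (measure N (cylinder w)) = complex_of_real (measure M (cylinder w))"
        using N PM by metis
      then show "measure N (cylinder w) = measure M (cylinder w)" by (simp only: of_real_eq_iff)
    qed (use N M in auto)
  qed
  then show "borel_prob (mu \<theta>)" "set w \<subseteq> letters \<Longrightarrow> measure (mu \<theta>) (cylinder w) = ?a w"
    using M by auto
qed

lemma mu_invariant:
  assumes t: "0 \<le> sin (2 * \<theta>)"
  shows "mu \<theta> \<in> invariant_probs"
proof (rule invariant_probsI[OF mu_cylinder(1)[OF t]])
  fix w :: "nat list" assume w: "set w \<subseteq> letters"
  then show "measure (mu \<theta>) (cylinder w) = (\<Sum>j\<in>letters. measure (mu \<theta>) (cylinder (j # w)))"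
    by (simp add: mu_cylinder(2)[OF t] spin_weight_def field_simps)
qed

text \<open>
  Mixing two product measures of entropy \<open>n * spin_entropy t\<close> adds at most \<open>ln 2\<close>, the entropy of the
  choice between them, and this constant disappears in the rate.
\<close>

lemma ks_entropy_mu_le:
  assumes t: "0 \<le> sin (2 * \<theta>)"
  shows "ks_entropy (mu \<theta>) shift \<le> ereal (spin_entropy (sin (2 * \<theta>)))"
proof (rule ks_entropy_le[OF mu_invariant[OF t]])
  fix n
  let ?t = "sin (2 * \<theta>)"
  have t1: "?t \<le> 1" by simp
  have pt: "- ((A + B) / 2 * ln ((A + B) / 2)) \<le> ln 2 * ((A + B) / 2) - (A * ln A + B * ln B) / 2"
    if AB: "A \<ge> 0" "B \<ge> 0" for A B :: real
  proof -
    have *: "A * (- ln ((A + B) / 2)) \<le> A * (ln 2 - ln A)" if "A \<ge> 0" "B \<ge> 0" for A B :: real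
    proof (cases "A = 0")
      case False
      then have "ln (A / 2) \<le> ln ((A + B) / 2)" using that by simp
      then show ?thesis using that False by (intro mult_left_mono) (simp_all add: ln_div)
    qed simp
    show ?thesis using *[OF AB] *[OF AB(2,1)] by (simp add: algebra_simps add_divide_distrib) 
  qed
  have "rv_entropy (mu \<theta>) (\<lambda>x. map x [0..<n]) = (\<Sum>w\<in>words letters n.
      - ((alt_weight ?t 1 w + alt_weight ?t (-1) w) / 2 * ln ((alt_weight ?t 1 w + alt_weight ?t (-1) w) / 2)))"
    unfolding rv_entropy_prefix[OF mu_cylinder(1)[OF t]] sum_negf[symmetric]
    by (intro sum.cong refl) (simp add: mu_cylinder(2)[OF t] words_def)
  also have "\<dots> \<le> (\<Sum>w\<in>words letters n. ln 2 * ((alt_weight ?t 1 w + alt_weight ?t (-1) w) / 2)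
      - (alt_weight ?t 1 w * ln (alt_weight ?t 1 w) + alt_weight ?t (-1) w * ln (alt_weight ?t (-1) w)) / 2)"
    by (intro sum_mono pt alt_weight_nonneg t t1) auto
  also have "\<dots> = ln 2 + real n * spin_entropy ?t"
    unfolding sum_subtractf sum_distrib_left[symmetric] sum_divide_distrib[symmetric] sum.distrib sum_alt_weight
    using alt_weight_entropy[OF t t1, of 1 n] alt_weight_entropy[OF t t1, of "-1" n] by simp
  finally show "rv_entropy (mu \<theta>) (\<lambda>x. map x [0..<n]) \<le> ln 2 + real n * spin_entropy ?t" .
qed

section \<open>The zero-temperature measure is never in equilibrium\<close>

context normalised_potential
begin

text \<open>
  The conditional mean of \<open>f\<close> given that the tail is \<open>y\<close> and the first spin has sign \<open>a\<close>.
\<close>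

definition mean_potential :: "real \<Rightarrow> real \<Rightarrow> (nat \<Rightarrow> nat) \<Rightarrow> real" where
  "mean_potential t a y = (\<Sum>j\<in>letters. spin_weight t a j * f (case_nat j y))"

lemma continuous_on_mean_potential: "continuous_on Omega (mean_potential t a)"
  unfolding mean_potential_def[abs_def]
  by (intro continuous_on_sum continuous_on_mult continuous_on_const continuous_on_compose_case_nat cont)

text \<open>
  In each of the two phases the first outcome is independent of the tail, and the tail is distributed
  as in the opposite phase.
\<close>

lemma integral_mu:
  fixes \<theta> :: real
  defines "t \<equiv> sin (2 * \<theta>)"
  assumes t: "0 \<le> t"
    and Mp: "borel_prob Mp" "\<And>w. set w \<subseteq> letters \<Longrightarrow> measure Mp (cylinder w) = alt_weight t 1 w"
    and Mm: "borel_prob Mm" "\<And>w. set w \<subseteq> letters \<Longrightarrow> measure Mm (cylinder w) = alt_weight t (-1) w"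
  shows "(\<integral>x. f x \<partial>(mu \<theta>)) = ((\<integral>x. mean_potential t 1 x \<partial>Mm) + (\<integral>x. mean_potential t (-1) x \<partial>Mp)) / 2"
proof -
  let ?x = "(\<lambda>_. 1) :: nat \<Rightarrow> nat"
  let ?F = "\<lambda>M g n. \<Sum>w\<in>words letters n. measure M (cylinder w) * g (prepend w ?x)"
  have mu: "borel_prob (mu \<theta>)" using mu_cylinder(1)[of \<theta>] t by (simp add: t_def)
  have step: "?F (mu \<theta>) f (Suc n) = (?F Mm (mean_potential t 1) n + ?F Mp (mean_potential t (-1)) n) / 2" for n
  proof -
    have "?F (mu \<theta>) f (Suc n) = (\<Sum>w\<in>words letters n. \<Sum>j\<in>letters.
        measure (mu \<theta>) (cylinder (j # w)) * f (prepend (j # w) ?x))"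
      unfolding sum_words_Suc by (rule sum.swap)
    also have "\<dots> = (\<Sum>w\<in>words letters n. (measure Mm (cylinder w) * mean_potential t 1 (prepend w ?x) +
        measure Mp (cylinder w) * mean_potential t (-1) (prepend w ?x)) / 2)"
    proof (rule sum.cong[OF refl])
      fix w assume "w \<in> words letters n"
      then have w: "set w \<subseteq> letters" by (simp add: words_def)
      have "measure (mu \<theta>) (cylinder (j # w)) =
          (spin_weight t 1 j * measure Mm (cylinder w) + spin_weight t (-1) j * measure Mp (cylinder w)) / 2"
        if "j \<in> letters" for j
        using mu_cylinder(2)[of \<theta> "j # w"] t that w Mp(2)[OF w] Mm(2)[OF w] by (simp add: t_def)
      then have "(\<Sum>j\<in>letters. measure (mu \<theta>) (cylinder (j # w)) * f (prepend (j # w) ?x)) =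
         (\<Sum>j\<in>letters. (spin_weight t 1 j * measure Mm (cylinder w) + spin_weight t (-1) j * measure Mp (cylinder w)) / 2
            * f (case_nat j (prepend w ?x)))"
        by (intro sum.cong refl) simp
      also have "\<dots> = (measure Mm (cylinder w) * mean_potential t 1 (prepend w ?x) +
        measure Mp (cylinder w) * mean_potential t (-1) (prepend w ?x)) / 2"
        by (simp add: mean_potential_def field_simps)
      finally show "(\<Sum>j\<in>letters. measure (mu \<theta>) (cylinder (j # w)) * f (prepend (j # w) ?x)) =
        (measure Mm (cylinder w) * mean_potential t 1 (prepend w ?x) +
        measure Mp (cylinder w) * mean_potential t (-1) (prepend w ?x)) / 2" .
    qed
    also have "\<dots> = (?F Mm (mean_potential t 1) n + ?F Mp (mean_potential t (-1)) n) / 2"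
      by (simp only: sum_divide_distrib[symmetric] sum.distrib)
    finally show ?thesis .
  qed
  have "(\<lambda>n. ?F (mu \<theta>) f (Suc n)) \<longlonglongrightarrow> (\<integral>x. f x \<partial>(mu \<theta>))"
    using LIMSEQ_Suc[OF integral_cylinder_limit[OF mu cont one_in_Omega]] .
  moreover have "(\<lambda>n. (?F Mm (mean_potential t 1) n + ?F Mp (mean_potential t (-1)) n) / 2) \<longlonglongrightarrow>
      ((\<integral>x. mean_potential t 1 x \<partial>Mm) + (\<integral>x. mean_potential t (-1) x \<partial>Mp)) / 2"
    by (intro tendsto_divide tendsto_add tendsto_const integral_cylinder_limit Mp(1) Mm(1)
        continuous_on_mean_potential one_in_Omega) simp
  ultimately show ?thesis unfolding step by (rule LIMSEQ_unique)
qed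

text \<open>
  Gibbs' inequality: \<open>f\<close> is the logarithm of a probability vector on the two letters in front of \<open>y\<close>, and
  its mean under another probability vector is largest if the two vectors agree.
\<close>

lemma mean_potential_le:
  assumes t: "0 \<le> t" "t \<le> 1" and a: "a \<in> {1, -1}" and y: "y \<in> Omega"
  shows "mean_potential t a y \<le> - spin_entropy t"
    and "exp (f (case_nat 1 y)) \<noteq> spin_weight t a 1 \<Longrightarrow> mean_potential t a y < - spin_entropy t"
proof -
  let ?s = "spin_weight t a" and ?g = "\<lambda>j. exp (f (case_nat j y))"
  have s: "?s j \<ge> 0" for j by (rule spin_weight_nonneg[OF t a])
  have diff: "mean_potential t a y + spin_entropy t = (\<Sum>j\<in>letters. ?s j * (f (case_nat j y) - ln (?s j)))"
    using spin_entropy_eq[OF a, of t] by (simp add: mean_potential_def right_diff_distrib)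
  have sum0: "(\<Sum>j\<in>letters. ?g j - ?s j) = 0"
    unfolding sum_subtractf normalised[OF y] sum_spin_weight by simp
  have le: "?s j * (f (case_nat j y) - ln (?s j)) \<le> ?g j - ?s j" for j
  proof (cases "?s j = 0")
    case False
    then have "?s j > 0" using s[of j] by simp
    moreover from this have "ln (?g j / ?s j) \<le> ?g j / ?s j - 1" by (intro ln_le_minus_one) simp
    ultimately show ?thesis by (simp add: ln_div field_simps)
  qed simp
  show "mean_potential t a y \<le> - spin_entropy t"
    using sum_mono[of letters "\<lambda>j. ?s j * (f (case_nat j y) - ln (?s j))" "\<lambda>j. ?g j - ?s j"] le
    unfolding sum0 diff[symmetric] by simp
  assume ne: "?g 1 \<noteq> ?s 1"
  have less: "?s 1 * (f (case_nat 1 y) - ln (?s 1)) < ?g 1 - ?s 1"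
  proof (cases "?s 1 = 0")
    case False
    then have s1: "?s 1 > 0" using s[of 1] by simp
    have "ln (?g 1 / ?s 1) \<noteq> ?g 1 / ?s 1 - 1"
      using ln_eq_minus_one[of "?g 1 / ?s 1"] s1 ne by (auto simp: field_simps)
    moreover have "ln (?g 1 / ?s 1) \<le> ?g 1 / ?s 1 - 1" using s1 by (intro ln_le_minus_one) simp
    ultimately have "ln (?g 1 / ?s 1) < ?g 1 / ?s 1 - 1" by simp
    then show ?thesis using s1 by (simp add: ln_div field_simps)
  qed simp
  have "(\<Sum>j\<in>letters. ?s j * (f (case_nat j y) - ln (?s j))) < (\<Sum>j\<in>letters. ?g j - ?s j)"
    using less le[of 2] by simp
  then show "mean_potential t a y < - spin_entropy t"
    unfolding sum0 diff[symmetric] by simp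
qed

lemma integral_mean_potential_le:
  assumes M: "borel_prob M" and t: "0 \<le> t" "t \<le> 1" and a: "a \<in> {1, -1}"
  shows "(\<integral>x. mean_potential t a x \<partial>M) \<le> - spin_entropy t"
    and "A \<in> sets M \<Longrightarrow> measure M A \<noteq> 0 \<Longrightarrow> (\<And>y. y \<in> A \<Longrightarrow> mean_potential t a y < - spin_entropy t) \<Longrightarrow>
      (\<integral>x. mean_potential t a x \<partial>M) < - spin_entropy t"
proof -
  interpret prob_space M using M by (rule borel_prob_prob_space)
  have sp: "space M = Omega" by (rule borel_prob_space[OF M])
  have int: "integrable M (mean_potential t a)" by (rule integrable_continuous_Omega[OF M continuous_on_mean_potential])
  have const: "(\<integral>x. - spin_entropy t \<partial>M) = - spin_entropy t" by (simp add: prob_space)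
  have le: "mean_potential t a x \<le> - spin_entropy t" if "x \<in> space M" for x
    using mean_potential_le(1)[OF t a] that by (simp add: sp)
  have "(\<integral>x. mean_potential t a x \<partial>M) \<le> (\<integral>x. - spin_entropy t \<partial>M)"
    using int le by (intro integral_mono) auto
  then show "(\<integral>x. mean_potential t a x \<partial>M) \<le> - spin_entropy t" by (simp only: const)
  assume A: "A \<in> sets M" "measure M A \<noteq> 0" and less: "\<And>y. y \<in> A \<Longrightarrow> mean_potential t a y < - spin_entropy t"
  have "(\<integral>x. mean_potential t a x \<partial>M) < (\<integral>x. - spin_entropy t \<partial>M)"
  proof (rule integral_less_AE[OF int, where A = A])
    show "AE x in M. x \<in> A \<longrightarrow> mean_potential t a x \<noteq> - spin_entropy t"
      using less by (auto intro!: AE_I2 dest: less_imp_neq)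
    show "AE x in M. mean_potential t a x \<le> - spin_entropy t" using le by (intro AE_I2)
  qed (use A in \<open>auto simp: emeasure_eq_measure\<close>)
  then show "(\<integral>x. mean_potential t a x \<partial>M) < - spin_entropy t" by (simp only: const)
qed

text \<open>
  Equality would force the probability \<open>exp (f (case_nat 1 y))\<close> of the letter \<open>1\<close> in front of \<open>y\<close> to equal
  \<open>(1 + t) / 2\<close> for almost all \<open>y\<close> in one phase and \<open>(1 - t) / 2\<close> for almost all \<open>y\<close> in the other. If \<open>t < 1\<close>,
  both phases charge every cylinder, so at any chosen point one of the two equalities fails, and by
  continuity it fails on a cylinder of positive measure. If \<open>t = 1\<close>, the first value is \<open>1\<close>, whereas both
  letters must have positive probability.
\<close>

lemma integral_mu_less:
  fixes \<theta> :: real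
  defines "t \<equiv> sin (2 * \<theta>)"
  assumes t: "0 < t"
  shows "(\<integral>x. f x \<partial>(mu \<theta>)) < - spin_entropy t"
proof -
  have t0: "0 \<le> t" and t1: "t \<le> 1" using t by (simp_all add: t_def)
  obtain Mp where Mp: "borel_prob Mp" "\<And>w. set w \<subseteq> letters \<Longrightarrow> measure Mp (cylinder w) = alt_weight t 1 w"
    using exists_alt_measure[OF t0 t1, of 1] by auto
  obtain Mm where Mm: "borel_prob Mm" "\<And>w. set w \<subseteq> letters \<Longrightarrow> measure Mm (cylinder w) = alt_weight t (-1) w"
    using exists_alt_measure[OF t0 t1, of "-1"] by auto
  let ?I = "\<lambda>a M. \<integral>x. mean_potential t a x \<partial>M"
  have "?I 1 Mm < - spin_entropy t \<or> ?I (-1) Mp < - spin_entropy t"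
  proof (cases "t = 1")
    case True
    have "mean_potential t 1 y < - spin_entropy t" if y: "y \<in> Omega" for y
    proof (rule mean_potential_le(2)[OF t0 t1 _ y])
      have "exp (f (case_nat 1 y)) < 1"
      proof -
        have "exp (f (case_nat 1 y)) + exp (f (case_nat 2 y)) = 1" using normalised[OF y] by simp
        then show ?thesis using exp_gt_zero[of "f (case_nat 2 y)"] by linarith
      qed
      then show "exp (f (case_nat 1 y)) \<noteq> spin_weight t 1 1" using True by (simp add: spin_weight_def)
    qed simp
    moreover have "measure Mm Omega \<noteq> 0" "Omega \<in> sets Mm"
      using Mm(2)[of "[]"] measurable_cylinder[OF Mm(1), of "[]"] by simp_all
    ultimately show ?thesis using integral_mean_potential_le(2)[OF Mm(1) t0 t1, of 1 Omega] by simp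
  next
    case False
    then have t_less: "t < 1" using t1 by simp
    let ?y = "(\<lambda>_. 1) :: nat \<Rightarrow> nat"
    have strict: "(\<integral>x. mean_potential t a x \<partial>M) < - spin_entropy t"
      if ne: "exp (f (case_nat 1 ?y)) \<noteq> spin_weight t a 1" and a: "a \<in> {1, -1}" and M: "borel_prob M"
        "\<And>w. set w \<subseteq> letters \<Longrightarrow> measure M (cylinder w) = alt_weight t (- a) w" for a M
    proof -
      have "mean_potential t a ?y < - spin_entropy t"
        by (rule mean_potential_le(2)[OF t0 t1 a one_in_Omega ne])
      then obtain n where n: "\<And>x y. x \<in> Omega \<Longrightarrow> y \<in> Omega \<Longrightarrow> \<forall>i<n. x i = y i \<Longrightarrow>
          \<bar>mean_potential t a x - mean_potential t a y\<bar> < - spin_entropy t - mean_potential t a ?y"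
        using uniformly_continuous_prefix[OF continuous_on_mean_potential[of t a],
            of "- spin_entropy t - mean_potential t a ?y"] by auto
      let ?w = "map ?y [0..<n]"
      have w: "set ?w \<subseteq> letters" by auto
      have "mean_potential t a x < - spin_entropy t" if x: "x \<in> cylinder ?w" for x
      proof -
        have "x \<in> Omega" "\<forall>i<n. x i = ?y i" using x by (auto simp: cylinder_def)
        from n[OF this(1) one_in_Omega this(2)] show ?thesis by linarith
      qed
      moreover have "measure M (cylinder ?w) \<noteq> 0"
        using M(2)[OF w] alt_weight_pos[OF t0 t_less, of "- a" ?w] a by auto
      ultimately show ?thesis
        by (intro integral_mean_potential_le(2)[OF M(1) t0 t1 a measurable_cylinder[OF M(1)]])
    qed
    have "spin_weight t 1 1 \<noteq> spin_weight t (-1) 1" using t by (simp add: spin_weight_def)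
    then have "exp (f (case_nat 1 ?y)) \<noteq> spin_weight t 1 1 \<or> exp (f (case_nat 1 ?y)) \<noteq> spin_weight t (-1) 1"
      by metis
    then show ?thesis
    proof
      assume "exp (f (case_nat 1 ?y)) \<noteq> spin_weight t 1 1"
      from strict[OF this _ Mm(1)] Mm(2) show ?thesis by simp
    next
      assume "exp (f (case_nat 1 ?y)) \<noteq> spin_weight t (-1) 1"
      from strict[OF this _ Mp(1)] Mp(2) show ?thesis by simp
    qed
  qed
  moreover have "?I 1 Mm \<le> - spin_entropy t" "?I (-1) Mp \<le> - spin_entropy t"
    using integral_mean_potential_le(1) Mm(1) Mp(1) t0 t1 by auto
  moreover have "(\<integral>x. f x \<partial>(mu \<theta>)) = (?I 1 Mm + ?I (-1) Mp) / 2"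
    using integral_mu[of \<theta> Mp Mm] t0 Mp Mm by (simp add: t_def)
  ultimately show ?thesis by auto
qed

end

theorem theorem21:
  fixes \<theta> :: real
  assumes "0 < \<theta>" and "\<theta> < pi / 2"
  shows "\<not> (\<exists>f :: (nat \<Rightarrow> nat) \<Rightarrow> real.
            continuous_on Omega f \<and>
            (\<forall>x\<in>Omega. (\<Sum>y\<in>{y \<in> Omega. shift y = x}. exp (f y)) = 1) \<and>
            (SUP \<rho>\<in>invariant_probs. ks_entropy \<rho> shift + ereal (\<integral>x. f x \<partial>\<rho>))
              = ks_entropy (mu \<theta>) shift + ereal (\<integral>x. f x \<partial>(mu \<theta>)))"
proof
  let ?t = "sin (2 * \<theta>)"
  have t: "0 < ?t" using assms by (intro sin_gt_zero) auto
  assume "\<exists>f :: (nat \<Rightarrow> nat) \<Rightarrow> real.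
            continuous_on Omega f \<and>
            (\<forall>x\<in>Omega. (\<Sum>y\<in>{y \<in> Omega. shift y = x}. exp (f y)) = 1) \<and>
            (SUP \<rho>\<in>invariant_probs. ks_entropy \<rho> shift + ereal (\<integral>x. f x \<partial>\<rho>))
              = ks_entropy (mu \<theta>) shift + ereal (\<integral>x. f x \<partial>(mu \<theta>))"
  then obtain f :: "(nat \<Rightarrow> nat) \<Rightarrow> real" where cont: "continuous_on Omega f"
    and norm: "\<And>x. x \<in> Omega \<Longrightarrow> (\<Sum>y\<in>{y \<in> Omega. shift y = x}. exp (f y)) = 1"
    and eq: "(SUP \<rho>\<in>invariant_probs. ks_entropy \<rho> shift + ereal (\<integral>x. f x \<partial>\<rho>))
              = ks_entropy (mu \<theta>) shift + ereal (\<integral>x. f x \<partial>(mu \<theta>))" by blast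
  interpret normalised_potential f
  proof
    show "continuous_on Omega f" by (rule cont)
    show "(\<Sum>j\<in>letters. exp (f (case_nat j x))) = 1" if "x \<in> Omega" for x
      using norm[OF that] unfolding sum_preimages_shift[OF that] .
  qed
  obtain \<rho> where \<rho>: "\<rho> \<in> invariant_probs" "ks_entropy \<rho> shift \<ge> ereal (- (\<integral>x. f x \<partial>\<rho>))"
    using exists_equilibrium by blast
  have "0 = ereal (- (\<integral>x. f x \<partial>\<rho>)) + ereal (\<integral>x. f x \<partial>\<rho>)" by simp
  also have "\<dots> \<le> ks_entropy \<rho> shift + ereal (\<integral>x. f x \<partial>\<rho>)"
    by (intro add_right_mono \<rho>(2))
  also have "\<dots> \<le> (SUP \<rho>\<in>invariant_probs. ks_entropy \<rho> shift + ereal (\<integral>x. f x \<partial>\<rho>))"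
    by (intro SUP_upper \<rho>(1))
  also have "\<dots> = ks_entropy (mu \<theta>) shift + ereal (\<integral>x. f x \<partial>(mu \<theta>))" by (rule eq)
  also have "\<dots> \<le> ereal (spin_entropy ?t) + ereal (\<integral>x. f x \<partial>(mu \<theta>))"
    using t by (intro add_right_mono ks_entropy_mu_le) simp
  also have "\<dots> < 0"
    using integral_mu_less[OF t] by simp
  finally show False by simp
qed

end
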